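(* Let $X$ be a proper geodesic Gromov hyperbolic space equipped with a proper, isometric and non-elementary action of a group $G$. Then $$\mathrm{Hdim}(\Lambda^{c}G)=\mathrm{Hdim}(\Lambda^{u}G)=\mathrm{Hdim}(\Lambda^{m}G)=\frac{\omega_G}{\epsilon},$$ where Hausdorff dimension is taken with respect to a visual metric on $\partial X$ with parameter $\epsilon$.
   Context: Visual metric: for a $\delta$-hyperbolic proper geodesic space $X$ with basepoint $o$ there is $\epsilon_0>0$ such that for $\epsilon\in(0,\epsilon_0)$ there is a metric $\rho_\epsilon$ on $\partial X$ with $\rho_\epsilon(\xi,\eta)\asymp e^{-\epsilon d(o,[\xi,\eta])}$, implicit constants depending only on $\delta$. $\omega_G=\limsup_n \frac1n\log\#\{g: d(o,go)\le n\}$. $\Lambda G$ is the set of accumulation points of $Go$ in $\partial X$; non-elementary means $|\Lambda G|\ge3$. $\xi\in\Lambda G$ is conical if there are $g_n\in G$, $R>0$ with $g_no\to\xi$ and all $g_no$ within $R$ of a geodesic ray $[o,\xi)$; it is uniformly conical if moreover $\sup_n d(g_no,g_{n+1}o)<\infty$. $\xi\in\Lambda G$ is a Myrberg point if for every pair of distinct $a,b\in\Lambda G$ there exist $g_n\in G$ with $g_no\to a$ and $g_n\xi\to b$. $\Lambda^cG,\Lambda^uG,\Lambda^mG$ denote the conical, uniformly conical and Myrberg limit sets. *)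

theory Defs
  imports "HOL-Analysis.Analysis" "HOL-Algebra.Group"
begin

definition proper_space :: "'a::metric_space itself \<Rightarrow> bool" where
  "proper_space T \<longleftrightarrow> (\<forall>(x::'a) r. compact (cball x r))"

definition geodesic_space :: "'a::metric_space itself \<Rightarrow> bool" where
  "geodesic_space T \<longleftrightarrow> (\<forall>x y::'a. \<exists>\<gamma>::real \<Rightarrow> 'a. \<gamma> 0 = x \<and> \<gamma> (dist x y) = y \<and>
       (\<forall>s\<in>{0..dist x y}. \<forall>t\<in>{0..dist x y}. dist (\<gamma> s) (\<gamma> t) = \<bar>s - t\<bar>))"

definition gromov_prod :: "'a::metric_space \<Rightarrow> 'a \<Rightarrow> 'a \<Rightarrow> real" where
  "gromov_prod w x y = (dist w x + dist w y - dist x y) / 2"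

definition gromov_hyperbolic :: "'a::metric_space itself \<Rightarrow> bool" where
  "gromov_hyperbolic T \<longleftrightarrow> (\<exists>\<delta>\<ge>0. \<forall>w x y z::'a.
      gromov_prod w x z \<ge> min (gromov_prod w x y) (gromov_prod w y z) - \<delta>)"

definition conv_inf :: "'a::metric_space \<Rightarrow> (nat \<Rightarrow> 'a) \<Rightarrow> bool" where
  "conv_inf bp x \<longleftrightarrow> (\<forall>M. \<exists>N. \<forall>m\<ge>N. \<forall>n\<ge>N. gromov_prod bp (x m) (x n) \<ge> M)"

definition seq_equiv :: "'a::metric_space \<Rightarrow> (nat \<Rightarrow> 'a) \<Rightarrow> (nat \<Rightarrow> 'a) \<Rightarrow> bool" where
  "seq_equiv bp x y \<longleftrightarrow> (\<forall>M. \<exists>N. \<forall>m\<ge>N. \<forall>n\<ge>N. gromov_prod bp (x m) (y n) \<ge> M)"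

text \<open>Boundary points are equivalence classes of sequences converging at infinity;
  a sequence in X converges to a boundary point iff it belongs to that class.\<close>
definition bdry :: "'a::metric_space \<Rightarrow> (nat \<Rightarrow> 'a) set set" where
  "bdry bp = {\<xi>. \<exists>x. conv_inf bp x \<and> \<xi> = {y. conv_inf bp y \<and> seq_equiv bp x y}}"

definition geodesic_ray :: "(real \<Rightarrow> 'a::metric_space) \<Rightarrow> bool" where
  "geodesic_ray \<gamma> \<longleftrightarrow> (\<forall>s\<ge>0. \<forall>t\<ge>0. dist (\<gamma> s) (\<gamma> t) = \<bar>s - t\<bar>)"

definition bigeodesic :: "(real \<Rightarrow> 'a::metric_space) \<Rightarrow> bool" where
  "bigeodesic \<gamma> \<longleftrightarrow> (\<forall>s t. dist (\<gamma> s) (\<gamma> t) = \<bar>s - t\<bar>)"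

definition dist_to_geod :: "'a::metric_space \<Rightarrow> (nat \<Rightarrow> 'a) set \<Rightarrow> (nat \<Rightarrow> 'a) set \<Rightarrow> real" where
  "dist_to_geod bp \<xi> \<eta> = Inf {infdist bp (range \<gamma>) | \<gamma>. bigeodesic \<gamma> \<and>
       (\<lambda>n. \<gamma> (- real n)) \<in> \<xi> \<and> (\<lambda>n. \<gamma> (real n)) \<in> \<eta>}"

definition visual_metric :: "'a::metric_space \<Rightarrow> real \<Rightarrow>
    ((nat \<Rightarrow> 'a) set \<Rightarrow> (nat \<Rightarrow> 'a) set \<Rightarrow> real) \<Rightarrow> bool" where
  "visual_metric bp \<epsilon> \<rho> \<longleftrightarrow>
     (\<forall>\<xi>\<in>bdry bp. \<forall>\<eta>\<in>bdry bp. \<rho> \<xi> \<eta> \<ge> 0 \<and> (\<rho> \<xi> \<eta> = 0 \<longleftrightarrow> \<xi> = \<eta>) \<and> \<rho> \<xi> \<eta> = \<rho> \<eta> \<xi>) \<and>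
     (\<forall>\<xi>\<in>bdry bp. \<forall>\<eta>\<in>bdry bp. \<forall>\<zeta>\<in>bdry bp. \<rho> \<xi> \<zeta> \<le> \<rho> \<xi> \<eta> + \<rho> \<eta> \<zeta>) \<and>
     (\<exists>C\<ge>1. \<forall>\<xi>\<in>bdry bp. \<forall>\<eta>\<in>bdry bp. \<xi> \<noteq> \<eta> \<longrightarrow>
        exp (- \<epsilon> * dist_to_geod bp \<xi> \<eta>) / C \<le> \<rho> \<xi> \<eta> \<and>
        \<rho> \<xi> \<eta> \<le> C * exp (- \<epsilon> * dist_to_geod bp \<xi> \<eta>))"

definition rdiam :: "('b \<Rightarrow> 'b \<Rightarrow> real) \<Rightarrow> 'b set \<Rightarrow> ennreal" where
  "rdiam \<rho> U = (SUP p\<in>U \<times> U. ennreal (\<rho> (fst p) (snd p)))"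

definition hausdorff_content :: "('b \<Rightarrow> 'b \<Rightarrow> real) \<Rightarrow> 'b set \<Rightarrow> real \<Rightarrow> real \<Rightarrow> 'b set \<Rightarrow> ennreal" where
  "hausdorff_content \<rho> S s d A =
     (INF U\<in>{U::nat \<Rightarrow> 'b set. A \<subseteq> (\<Union>i. U i) \<and> (\<forall>i. U i \<subseteq> S \<and> rdiam \<rho> (U i) \<le> ennreal d)}.
        (\<Sum>i. ennreal (enn2real (rdiam \<rho> (U i)) powr s)))"

definition hausdorff_measure :: "('b \<Rightarrow> 'b \<Rightarrow> real) \<Rightarrow> 'b set \<Rightarrow> real \<Rightarrow> 'b set \<Rightarrow> ennreal" where
  "hausdorff_measure \<rho> S s A = (SUP d\<in>{0<..}. hausdorff_content \<rho> S s d A)"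

definition hausdorff_dim :: "('b \<Rightarrow> 'b \<Rightarrow> real) \<Rightarrow> 'b set \<Rightarrow> 'b set \<Rightarrow> ereal" where
  "hausdorff_dim \<rho> S A = (INF s\<in>{s. s \<ge> 0 \<and> hausdorff_measure \<rho> S s A = 0}. ereal s)"

definition isometric_action :: "('g, 'm) monoid_scheme \<Rightarrow> ('g \<Rightarrow> 'a::metric_space \<Rightarrow> 'a) \<Rightarrow> bool" where
  "isometric_action G act \<longleftrightarrow>
     act \<one>\<^bsub>G\<^esub> = id \<and>
     (\<forall>g\<in>carrier G. \<forall>h\<in>carrier G. act (g \<otimes>\<^bsub>G\<^esub> h) = act g \<circ> act h) \<and>
     (\<forall>g\<in>carrier G. \<forall>x y. dist (act g x) (act g y) = dist x y)"

definition proper_action :: "('g, 'm) monoid_scheme \<Rightarrow> ('g \<Rightarrow> 'a::metric_space \<Rightarrow> 'a) \<Rightarrow> bool" where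
  "proper_action G act \<longleftrightarrow>
     (\<forall>K. compact K \<longrightarrow> finite {g\<in>carrier G. act g ` K \<inter> K \<noteq> {}})"

definition bdry_act :: "('g \<Rightarrow> 'a \<Rightarrow> 'a) \<Rightarrow> 'g \<Rightarrow> (nat \<Rightarrow> 'a) set \<Rightarrow> (nat \<Rightarrow> 'a) set" where
  "bdry_act act g \<xi> = (\<lambda>x. act g \<circ> x) ` \<xi>"

definition crit_exp :: "('g, 'm) monoid_scheme \<Rightarrow> ('g \<Rightarrow> 'a::metric_space \<Rightarrow> 'a) \<Rightarrow> 'a \<Rightarrow> ereal" where
  "crit_exp G act bp = limsup (\<lambda>n::nat. ereal (ln (real (card {g\<in>carrier G. dist bp (act g bp) \<le> real n})) / real n))"

definition limit_set :: "('g, 'm) monoid_scheme \<Rightarrow> ('g \<Rightarrow> 'a::metric_space \<Rightarrow> 'a) \<Rightarrow> 'a \<Rightarrow> (nat \<Rightarrow> 'a) set set" where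
  "limit_set G act bp = {\<xi>\<in>bdry bp. \<exists>g. (\<forall>n. g n \<in> carrier G) \<and> (\<lambda>n. act (g n) bp) \<in> \<xi>}"

definition non_elementary :: "('g, 'm) monoid_scheme \<Rightarrow> ('g \<Rightarrow> 'a::metric_space \<Rightarrow> 'a) \<Rightarrow> 'a \<Rightarrow> bool" where
  "non_elementary G act bp \<longleftrightarrow> (\<exists>a b c. {a, b, c} \<subseteq> limit_set G act bp \<and> a \<noteq> b \<and> b \<noteq> c \<and> a \<noteq> c)"

definition conical_limit_set :: "('g, 'm) monoid_scheme \<Rightarrow> ('g \<Rightarrow> 'a::metric_space \<Rightarrow> 'a) \<Rightarrow> 'a \<Rightarrow> (nat \<Rightarrow> 'a) set set" where
  "conical_limit_set G act bp = {\<xi>\<in>limit_set G act bp. \<exists>g R \<gamma>. (\<forall>n. g n \<in> carrier G) \<and> R > 0 \<and>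
      geodesic_ray \<gamma> \<and> \<gamma> 0 = bp \<and> (\<lambda>n. \<gamma> (real n)) \<in> \<xi> \<and>
      (\<lambda>n. act (g n) bp) \<in> \<xi> \<and> (\<forall>n. infdist (act (g n) bp) (\<gamma> ` {0..}) \<le> R)}"

definition unif_conical_limit_set :: "('g, 'm) monoid_scheme \<Rightarrow> ('g \<Rightarrow> 'a::metric_space \<Rightarrow> 'a) \<Rightarrow> 'a \<Rightarrow> (nat \<Rightarrow> 'a) set set" where
  "unif_conical_limit_set G act bp = {\<xi>\<in>limit_set G act bp. \<exists>g R \<gamma>. (\<forall>n. g n \<in> carrier G) \<and> R > 0 \<and>
      geodesic_ray \<gamma> \<and> \<gamma> 0 = bp \<and> (\<lambda>n. \<gamma> (real n)) \<in> \<xi> \<and>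
      (\<lambda>n. act (g n) bp) \<in> \<xi> \<and> (\<forall>n. infdist (act (g n) bp) (\<gamma> ` {0..}) \<le> R) \<and>
      (\<exists>B. \<forall>n. dist (act (g n) bp) (act (g (Suc n)) bp) \<le> B)}"

text \<open>Myrberg points; convergence in the boundary is measured with the (visual) metric rho.\<close>
definition myrberg_limit_set :: "('g, 'm) monoid_scheme \<Rightarrow> ('g \<Rightarrow> 'a::metric_space \<Rightarrow> 'a) \<Rightarrow> 'a \<Rightarrow>
    ((nat \<Rightarrow> 'a) set \<Rightarrow> (nat \<Rightarrow> 'a) set \<Rightarrow> real) \<Rightarrow> (nat \<Rightarrow> 'a) set set" where
  "myrberg_limit_set G act bp \<rho> = {\<xi>\<in>limit_set G act bp. \<forall>a\<in>limit_set G act bp. \<forall>b\<in>limit_set G act bp.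
      a \<noteq> b \<longrightarrow> (\<exists>g. (\<forall>n. g n \<in> carrier G) \<and> (\<lambda>n. act (g n) bp) \<in> a \<and>
                  (\<lambda>n. \<rho> (bdry_act act (g n) \<xi>) b) \<longlonglongrightarrow> 0)}"

end

(* Write |g| = d(o, g o) and (x|y) for Gromov products at the base point o.  The upper bound
   covers the conical limit set by shadows of orbit points, whose diameters are comparable to
   exp(-\<epsilon> |g|); Myrberg points are conical because translates g_n \<xi> -> b, g_n o -> a \<noteq> b put
   g_n^{-1} o close to the ray [o, \<xi>).

   For the lower bounds fix s < \<omega>_G.  By pigeonhole on the directions of g o and g^{-1} o there is a
   set N of elements, still of growth at least s, along which both directions converge.  No point of
   the limit set is fixed by G, so after multiplying N by one fixed element the two limit directions
   differ, and words in long letters of the resulting set are broken geodesics with uniformly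
   small backtracking.  Choosing the letters in one annulus and far apart gives a tree of infinite
   words whose ends satisfy \<rho> >= C exp(-\<epsilon> (length of the common prefix)); comparing with the product of
   the uniform measures on letters bounds its Hausdorff content below.  All these ends are uniformly
   conical.  Inserting, at sparse positions, one further letter f1 k f2 for each long k in G does
   not lower the dimension and makes all ends Myrberg points. *)
theory Submission
  imports Defs "HOL-Probability.Infinite_Product_Measure" "HOL-Real_Asymp.Real_Asymp"
begin

section \<open>Gromov products, broken geodesics and boundary classes\<close>

text \<open>Nearly all geometry goes through the four-point inequality for \<open>gp\<close>.
  Geodesics serve only to compare \<open>dist_to_geod\<close> with Gromov products, to supply the
  rays of conical points and shadows, and to sort orbit points by direction. No measure is put on
  the boundary. Covering sets are pulled back to sets of words, enlarged to cylinders and measured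
  there, so measurability of the coding map is never an issue. Growth of a set of elements is
  expressed by \<open>big s\<close>: no multiple of exp (s n) bounds its annuli. This survives
  finite partitions and translations with the same \<open>s\<close>, and leaves room for every
  multiplicative constant met later. There is no loxodromic element to start from. That no limit
  point is fixed by the whole group has to be extracted from three limit points and properness.
  Myrberg words need letters of unbounded length, which is why alphabets and length bounds depend on
  the position in the word.\<close>

abbreviation gp :: "'a::metric_space \<Rightarrow> 'a \<Rightarrow> 'a \<Rightarrow> real" where
  "gp \<equiv> gromov_prod"

lemma gp_commute: "gp w x y = gp w y x"
  by (simp add: gromov_prod_def dist_commute)

lemma gp_nonneg: "0 \<le> gp w x y"
  unfolding gromov_prod_def by (metis dist_triangle dist_commute diff_ge_0_iff_ge divide_nonneg_pos zero_less_numeral)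

lemma gp_le_dist: "gp w x y \<le> dist w x" "gp w x y \<le> dist w y"
  unfolding gromov_prod_def
  using dist_triangle[of w y x] dist_triangle[of w x y] by (auto simp: dist_commute)

lemma gp_self [simp]: "gp w x x = dist w x" "gp w w x = 0" "gp w x w = 0"
  by (simp_all add: gromov_prod_def dist_commute)

lemma gp_add: "gp x w y + gp w x y = dist w x"
  by (simp add: gromov_prod_def dist_commute field_simps)

lemma dist_eq_gp: "dist x y = dist w x + dist w y - 2 * gp w x y"
  by (simp add: gromov_prod_def field_simps)

lemma gp_lipschitz_right: "gp w x y \<le> gp w x y' + dist y y'"
  unfolding gromov_prod_def
  using dist_triangle[of w y y'] dist_triangle[of x y' y] by (simp add: dist_commute field_simps)

lemma gp_lipschitz_left: "gp w x y \<le> gp w x' y + dist x x'"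
  using gp_lipschitz_right[of w y x x'] by (simp add: gp_commute)

lemma gp_lipschitz_base: "gp w x y \<le> gp w' x y + dist w w'"
  unfolding gromov_prod_def
  using dist_triangle[of w x w'] dist_triangle[of w y w'] by (simp add: dist_commute field_simps)

locale gromov_space =
  fixes bp :: "'a::metric_space" and \<delta> :: real
  assumes proper: "proper_space TYPE('a)"
    and geodesic: "geodesic_space TYPE('a)"
    and \<delta>_nonneg: "0 \<le> \<delta>"
    and hyp: "\<And>w x y z :: 'a. min (gp w x y) (gp w y z) - \<delta> \<le> gp w x z"
begin

section \<open>The four-point condition and broken geodesics\<close>

lemma hyp_le: "b \<le> gp w x y \<Longrightarrow> b \<le> gp w y z \<Longrightarrow> b - \<delta> \<le> gp w x (z::'a)"
  using hyp[of w x y z] by linarith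

lemma hyp_or_le: "gp w x z \<le> b \<Longrightarrow> gp w x y \<le> b + \<delta> \<or> gp w y z \<le> b + \<delta>" for w x y z :: 'a
  using hyp[of w x y z] by linarith

lemma hyp3: "b \<le> gp w x y \<Longrightarrow> b \<le> gp w y z \<Longrightarrow> b \<le> gp w z u \<Longrightarrow> b - 2 * \<delta> \<le> gp w x (u::'a)"
  using hyp[of w x y z] hyp[of w x z u] \<delta>_nonneg by linarith

text \<open>The step length exceeds twice the bound \<open>c + 2 * \<delta>\<close> of
  \<open>broken_gp\<close> by 1, so that every step gains at least 1 in distance from the
  start.\<close>

definition "broken c x \<longleftrightarrow> (\<forall>i. gp (x (Suc i)) (x i) (x (Suc (Suc i))) \<le> c \<and>
    2 * c + 4 * \<delta> + 1 \<le> dist (x i) (x (Suc i)))" for c :: real and x :: "nat \<Rightarrow> 'a"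

lemma broken_nonneg: "broken c x \<Longrightarrow> 0 \<le> c"
  unfolding broken_def using gp_nonneg order_trans by blast

text \<open>The error does not accumulate. By induction and the step length, the new vertex sees
  \<open>x i\<close> and its predecessor under a product above \<open>c + \<delta>\<close>; one
  four-point step against the local bound \<open>c\<close> then gives \<open>c + \<delta>\<close>
  again.\<close>

lemma broken_right:
  assumes "broken c x"
  shows "gp (x (i + Suc n)) (x i) (x (i + Suc (Suc n))) \<le> c + \<delta>"
proof (induction n)
  case 0
  then show ?case using assms \<delta>_nonneg by (simp add: broken_def) (smt (verit, best))
next
  case (Suc n)
  let ?y = "x (i + Suc (Suc n))"
  have 1: "gp ?y (x (i + Suc n)) (x (i + Suc (Suc (Suc n)))) \<le> c"
    and 2: "2 * c + 4 * \<delta> + 1 \<le> dist (x (i + Suc n)) ?y"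
    using assms by (simp_all add: broken_def)
  have "gp ?y (x (i + Suc n)) (x i) = dist (x (i + Suc n)) ?y - gp (x (i + Suc n)) (x i) ?y"
    using gp_add[of ?y "x (i + Suc n)" "x i"] by (simp add: gp_commute)
  with 2 Suc.IH have "gp ?y (x (i + Suc n)) (x i) > c + \<delta>"
    using broken_nonneg[OF assms] \<delta>_nonneg by simp
  then show ?case using hyp_or_le[OF 1, of "x i"] by simp
qed

lemma broken_left:
  assumes "broken c x"
  shows "gp (x (Suc i)) (x i) (x (i + Suc (Suc n))) \<le> c + \<delta>"
proof (induction n arbitrary: i)
  case 0
  then show ?case using assms \<delta>_nonneg by (simp add: broken_def) (smt (verit, best))
next
  case (Suc n)
  let ?y = "x (Suc i)" and ?z = "x (i + Suc (Suc (Suc n)))"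
  have 1: "gp ?y (x i) (x (Suc (Suc i))) \<le> c"
    and 2: "2 * c + 4 * \<delta> + 1 \<le> dist ?y (x (Suc (Suc i)))"
    using assms by (simp_all add: broken_def)
  have "gp ?y (x (Suc (Suc i))) ?z = dist ?y (x (Suc (Suc i))) - gp (x (Suc (Suc i))) ?y ?z"
    using gp_add[of ?y "x (Suc (Suc i))" ?z] by (simp add: gp_commute dist_commute)
  moreover have "gp (x (Suc (Suc i))) ?y ?z \<le> c + \<delta>" using Suc.IH[of "Suc i"] by simp
  ultimately have "gp ?y ?z (x (Suc (Suc i))) > c + \<delta>"
    using 2 broken_nonneg[OF assms] \<delta>_nonneg by (simp add: gp_commute)
  then show ?case using hyp_or_le[OF 1, of ?z] by simp
qed

text \<open>The two neighbours of \<open>x j\<close> are replaced by far vertices one after the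
  other; the second replacement costs the second \<open>\<delta>\<close>.\<close>

lemma broken_gp:
  assumes "broken c x" "i \<le> j" "j \<le> k"
  shows "gp (x j) (x i) (x k) \<le> c + 2 * \<delta>"
proof -
  have c: "0 \<le> c" using broken_nonneg assms(1) .
  consider "i = j" | "j = k" | "i < j" "k = Suc j" | "i < j" "Suc (Suc j) \<le> k"
    using assms(2,3) by linarith
  then show ?thesis
  proof cases
    case 3
    then obtain n where "j = i + Suc n" by (metis less_iff_Suc_add add_Suc_right)
    then show ?thesis using broken_right[OF assms(1), of i n] 3 \<delta>_nonneg by simp
  next
    case 4
    obtain n where n: "j = i + Suc n" using 4 by (metis less_iff_Suc_add add_Suc_right)
    obtain m where m: "k = j + Suc (Suc m)" using 4 by (metis le_iff_add add_Suc_right add_Suc)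
    have 1: "gp (x j) (x i) (x (Suc j)) \<le> c + \<delta>"
      using broken_right[OF assms(1), of i n] n by simp
    have "gp (x j) (x (Suc j)) (x k) = dist (x j) (x (Suc j)) - gp (x (Suc j)) (x j) (x k)"
      using gp_add[of "x j" "x (Suc j)" "x k"] by (simp add: gp_commute dist_commute)
    moreover have "gp (x (Suc j)) (x j) (x k) \<le> c + \<delta>"
      using broken_left[OF assms(1), of j m] m by simp
    moreover have "2 * c + 4 * \<delta> + 1 \<le> dist (x j) (x (Suc j))"
      using assms(1) by (simp add: broken_def)
    ultimately have "gp (x j) (x k) (x (Suc j)) > c + \<delta> + \<delta>"
      using c \<delta>_nonneg by (simp add: gp_commute)
    then show ?thesis using hyp_or_le[OF 1, of "x k"] by simp
  qed (use c \<delta>_nonneg in auto)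
qed

lemma broken_dist:
  assumes "broken c x"
  shows "real n \<le> dist (x 0) (x n)"
proof (induction n)
  case (Suc n)
  have "dist (x 0) (x (Suc n)) = dist (x n) (x 0) + dist (x n) (x (Suc n)) - 2 * gp (x n) (x 0) (x (Suc n))"
    by (rule dist_eq_gp)
  moreover have "gp (x n) (x 0) (x (Suc n)) \<le> c + 2 * \<delta>" using broken_gp[OF assms] by simp
  moreover have "2 * c + 4 * \<delta> + 1 \<le> dist (x n) (x (Suc n))" using assms by (simp add: broken_def)
  ultimately show ?case using Suc by (simp add: dist_commute)
qed simp

lemma broken_gp0:
  assumes "broken c x" "m \<le> n"
  shows "dist (x 0) (x m) - (c + 2 * \<delta>) \<le> gp (x 0) (x m) (x n)"
  using broken_gp[OF assms(1), of 0 m n] assms(2) gp_add[of "x m" "x 0" "x n"]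
  by simp

lemma broken_conv_inf:
  assumes "broken c x" "x 0 = bp"
  shows "conv_inf bp x"
  unfolding conv_inf_def
proof
  fix M :: real
  obtain N :: nat where N: "M + c + 2 * \<delta> \<le> real N" using real_arch_simple by blast
  have *: "M \<le> gp bp (x m) (x n)" if "N \<le> m" "m \<le> n" for m n
    using broken_gp0[OF assms(1) that(2)] broken_dist[OF assms(1), of m] N that assms(2) by simp
  show "\<exists>N. \<forall>m\<ge>N. \<forall>n\<ge>N. M \<le> gp bp (x m) (x n)"
    by (rule exI[of _ N]) (metis * gp_commute nat_le_linear)
qed

section \<open>Sequences converging at infinity and their classes\<close>

lemma seq_equivD: "seq_equiv bp x y \<Longrightarrow> \<exists>N. \<forall>m\<ge>N. \<forall>n\<ge>N. M \<le> gp bp (x m) (y n)"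
  by (simp add: seq_equiv_def)

lemma conv_infD: "conv_inf bp x \<Longrightarrow> \<exists>N. \<forall>m\<ge>N. \<forall>n\<ge>N. M \<le> gp bp (x m) (x n)"
  by (simp add: conv_inf_def)

lemma seq_equiv_sym: "seq_equiv bp x y \<Longrightarrow> seq_equiv bp y x"
  unfolding seq_equiv_def by (metis gp_commute)

lemma conv_inf_iff_equiv: "conv_inf bp x \<longleftrightarrow> seq_equiv bp x x"
  unfolding conv_inf_def seq_equiv_def by simp

text \<open>Late terms of each sequence have large products among themselves, so a single late pair
  with a large product carries over to all late pairs.\<close>

lemma seq_equiv_frequently:
  assumes "conv_inf bp x" "conv_inf bp y" "\<And>M N. \<exists>m\<ge>N. \<exists>n\<ge>N. M \<le> gp bp (x m) (y n)"
  shows "seq_equiv bp x y"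
  unfolding seq_equiv_def
proof
  fix M :: real
  obtain N1 where N1: "\<And>m n. m \<ge> N1 \<Longrightarrow> n \<ge> N1 \<Longrightarrow> M + 2 * \<delta> \<le> gp bp (x m) (x n)"
    using conv_infD[OF assms(1)] by blast
  obtain N2 where N2: "\<And>m n. m \<ge> N2 \<Longrightarrow> n \<ge> N2 \<Longrightarrow> M + 2 * \<delta> \<le> gp bp (y m) (y n)"
    using conv_infD[OF assms(2)] by blast
  obtain p q where pq: "p \<ge> max N1 N2" "q \<ge> max N1 N2" "M + 2 * \<delta> \<le> gp bp (x p) (y q)"
    using assms(3) by blast
  have "M \<le> gp bp (x m) (y n)" if "m \<ge> max N1 N2" "n \<ge> max N1 N2" for m n
    using hyp3[OF N1[of m p] pq(3) N2[of q n]] that pq by simp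
  then show "\<exists>N. \<forall>m\<ge>N. \<forall>n\<ge>N. M \<le> gp bp (x m) (y n)" by blast
qed

lemma seq_equiv_trans:
  assumes "seq_equiv bp x y" "seq_equiv bp y z"
  shows "seq_equiv bp x z"
  unfolding seq_equiv_def
proof
  fix M :: real
  obtain N1 where N1: "\<And>m n. m \<ge> N1 \<Longrightarrow> n \<ge> N1 \<Longrightarrow> M + \<delta> \<le> gp bp (x m) (y n)"
    using seq_equivD[OF assms(1)] by blast
  obtain N2 where N2: "\<And>m n. m \<ge> N2 \<Longrightarrow> n \<ge> N2 \<Longrightarrow> M + \<delta> \<le> gp bp (y m) (z n)"
    using seq_equivD[OF assms(2)] by blast
  have "M \<le> gp bp (x m) (z n)" if "m \<ge> max N1 N2" "n \<ge> max N1 N2" for m n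
    using hyp_le[OF N1[of m "max N1 N2"] N2[of "max N1 N2" n]] that by simp
  then show "\<exists>N. \<forall>m\<ge>N. \<forall>n\<ge>N. M \<le> gp bp (x m) (z n)" by blast
qed

lemma not_equiv_bound:
  assumes "conv_inf bp x" "conv_inf bp y" "\<not> seq_equiv bp x y"
  shows "\<exists>D N. \<forall>m\<ge>N. \<forall>n\<ge>N. gp bp (x m) (y n) \<le> D"
proof (rule ccontr)
  assume "\<not> ?thesis"
  then have "\<exists>m\<ge>N. \<exists>n\<ge>N. M \<le> gp bp (x m) (y n)" for M N by (meson linear)
  with assms seq_equiv_frequently show False by blast
qed

text \<open>Closeness to arbitrarily late terms of \<open>x\<close> suffices because
  \<open>x\<close> itself converges. This weak form is what cluster points and subsequences
  provide.\<close>

lemma equiv_limit: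
  assumes x: "conv_inf bp x"
    and q: "\<And>M. \<exists>N. \<forall>n\<ge>N. \<forall>K. \<exists>m\<ge>K. M \<le> gp bp (q n) (x m)"
  shows "conv_inf bp q" "seq_equiv bp x q"
proof -
  have *: "seq_equiv bp q x"
    unfolding seq_equiv_def
  proof
    fix M :: real
    obtain N1 where N1: "\<And>m n. m \<ge> N1 \<Longrightarrow> n \<ge> N1 \<Longrightarrow> M + \<delta> \<le> gp bp (x m) (x n)"
      using conv_infD[OF x] by blast
    obtain N2 where N2: "\<And>n K. n \<ge> N2 \<Longrightarrow> \<exists>m\<ge>K. M + \<delta> \<le> gp bp (q n) (x m)" using q by metis
    have "M \<le> gp bp (q m) (x n)" if "m \<ge> max N1 N2" "n \<ge> max N1 N2" for m n
    proof -
      obtain k where "k \<ge> N1" "M + \<delta> \<le> gp bp (q m) (x k)" using N2 \<open>m \<ge> max N1 N2\<close> by force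
      then show ?thesis using hyp_le[of "M + \<delta>" bp "q m" "x k" "x n"] N1[of k n] that by simp
    qed
    then show "\<exists>N. \<forall>m\<ge>N. \<forall>n\<ge>N. M \<le> gp bp (q m) (x n)" by blast
  qed
  then show "seq_equiv bp x q" by (rule seq_equiv_sym)
  with * show "conv_inf bp q" unfolding conv_inf_iff_equiv using seq_equiv_trans by blast
qed

lemma bdry_conv: "\<xi> \<in> bdry bp \<Longrightarrow> x \<in> \<xi> \<Longrightarrow> conv_inf bp x"
  by (auto simp: bdry_def)

lemma bdry_nonempty: "\<xi> \<in> bdry bp \<Longrightarrow> \<exists>x. x \<in> \<xi>"
  unfolding bdry_def using conv_inf_iff_equiv by blast

lemma bdry_equiv: "\<xi> \<in> bdry bp \<Longrightarrow> x \<in> \<xi> \<Longrightarrow> y \<in> \<xi> \<Longrightarrow> seq_equiv bp x y"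
  unfolding bdry_def using seq_equiv_trans seq_equiv_sym by blast

lemma bdry_mem: "\<xi> \<in> bdry bp \<Longrightarrow> x \<in> \<xi> \<Longrightarrow> conv_inf bp y \<Longrightarrow> seq_equiv bp x y \<Longrightarrow> y \<in> \<xi>"
  unfolding bdry_def using seq_equiv_trans by blast

lemma bdry_eqI: "\<xi> \<in> bdry bp \<Longrightarrow> \<eta> \<in> bdry bp \<Longrightarrow> x \<in> \<xi> \<Longrightarrow> y \<in> \<eta> \<Longrightarrow> seq_equiv bp x y \<Longrightarrow> \<xi> = \<eta>"
  using bdry_mem bdry_equiv bdry_conv seq_equiv_trans seq_equiv_sym by (smt (verit, best) subsetI subset_antisym)

definition "bdpt x = {y. conv_inf bp y \<and> seq_equiv bp x y}"

lemma bdpt_in: "conv_inf bp x \<Longrightarrow> bdpt x \<in> bdry bp" "conv_inf bp x \<Longrightarrow> x \<in> bdpt x"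
  unfolding bdry_def bdpt_def using conv_inf_iff_equiv by auto

lemma bdry_limit_mem:
  assumes "\<xi> \<in> bdry bp" "x \<in> \<xi>"
    and "\<And>M. \<exists>N. \<forall>n\<ge>N. \<forall>K. \<exists>m\<ge>K. M \<le> gp bp (q n) (x m)"
  shows "q \<in> \<xi>"
  using bdry_mem[OF assms(1,2)] equiv_limit[OF bdry_conv[OF assms(1,2)] assms(3)] by blast

lemma bdry_dist_tendsto:
  assumes "conv_inf bp x"
  shows "\<exists>N. \<forall>n\<ge>N. M \<le> dist bp (x n)"
  using conv_infD[OF assms, of M] gp_self(1)[of bp] by metis

end

section \<open>Geodesic rays, bi-infinite geodesics and visual metrics\<close>

context gromov_space
begin

section \<open>Rays and bi-infinite geodesics as limits of segments\<close>

lemma geodesicE: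
  fixes p q :: 'a
  obtains c where "c 0 = p" "c (dist p q) = q"
    "\<And>s t. s \<in> {0..dist p q} \<Longrightarrow> t \<in> {0..dist p q} \<Longrightarrow> dist (c s) (c t) = \<bar>s - t\<bar>"
  using geodesic unfolding geodesic_space_def by meson

lemma gp_between:
  fixes z :: 'a
  assumes "dist bp z \<le> D" "dist z p = k" "dist z q = l" "dist p q = l - k"
  shows "k - D \<le> gp bp p q"
proof -
  have "k \<le> dist bp p + D" "l \<le> dist bp q + D"
    using assms dist_triangle[of z p bp] dist_triangle[of z q bp] by (auto simp: dist_commute)
  then show ?thesis using assms(4) unfolding gromov_prod_def by (simp add: field_simps)
qed

text \<open>On a geodesic from \<open>p\<close> to \<open>q\<close>, \<open>z\<close> is the branch
  point of the comparison tripod of \<open>w\<close>, \<open>p\<close>, \<open>q\<close>. There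
  \<open>gp p z q\<close> equals \<open>gp p w q\<close>, and the four-point condition at
  \<open>p\<close> places \<open>w\<close> and \<open>z\<close> on a common way up to that
  point.\<close>

lemma dist_geodesic_le:
  fixes p q w z :: 'a
  assumes "dist p z = gp p w q" "dist z q = dist p q - gp p w q"
  shows "dist w z \<le> gp w p q + 2 * \<delta>"
proof -
  have "gp p z q = gp p w q" using assms by (simp add: gromov_prod_def[of p z q])
  then have "gp p w q - \<delta> \<le> gp p w z" using hyp_le[of "gp p w q" p w q z] by (simp add: gp_commute)
  then show ?thesis using assms(1) gp_add[of p w q] unfolding gromov_prod_def[of p w z]
    by (simp add: dist_commute)
qed

text \<open>Arzela--Ascoli via Tychonoff: \<open>\<gamma>\<close> is merely a cluster point in the topology of pointwise
  convergence, which is enough because being isometric involves two parameters at a time.\<close>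
lemma geodesic_cluster:
  fixes \<sigma> :: "nat \<Rightarrow> real \<Rightarrow> 'a" and I :: "real set"
  assumes "0 \<in> I"
    and bound: "\<And>n. dist bp (\<sigma> n 0) \<le> D"
    and iso: "\<And>s t. s \<in> I \<Longrightarrow> t \<in> I \<Longrightarrow> \<exists>N. \<forall>n\<ge>N. dist (\<sigma> n s) (\<sigma> n t) = \<bar>s - t\<bar>"
  shows "\<exists>\<gamma>. (\<forall>s\<in>I. \<forall>t\<in>I. dist (\<gamma> s) (\<gamma> t) = \<bar>s - t\<bar>) \<and>
     (\<forall>s\<in>I. \<forall>e>0. \<forall>N. \<exists>n\<ge>N. dist (\<gamma> s) (\<sigma> n s) < e)"
proof -
  \<comment> \<open>Values too far from \<open>bp\<close> are reset to \<open>bp\<close>, so that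
    every \<open>\<tau> n\<close> lies in one product of compact balls. For a fixed \<open>t\<close>
    in \<open>I\<close> this changes only finitely many \<open>n\<close>.\<close>
  define \<tau> where "\<tau> n t = (if dist bp (\<sigma> n t) \<le> D + \<bar>t\<bar> then \<sigma> n t else bp)" for n t
  have \<tau>_eq: "\<exists>N. \<forall>n\<ge>N. \<tau> n t = \<sigma> n t" if t: "t \<in> I" for t
  proof -
    obtain N where N: "\<And>n. n \<ge> N \<Longrightarrow> dist (\<sigma> n 0) (\<sigma> n t) = \<bar>t\<bar>" using iso[OF assms(1) t] by auto
    have "\<tau> n t = \<sigma> n t" if "n \<ge> N" for n
      using N[OF that] bound[of n] dist_triangle[of bp "\<sigma> n t" "\<sigma> n 0"] unfolding \<tau>_def by simp
    then show ?thesis by blast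
  qed
  have D: "0 \<le> D" using bound[of 0] by (meson dual_order.trans zero_le_dist)
  let ?K = "PiE UNIV (\<lambda>t::real. cball bp (D + \<bar>t\<bar>))"
  have "compactin (product_topology (\<lambda>_. euclidean) UNIV) ?K"
    unfolding compactin_PiE using proper by (auto simp: proper_space_def)
  then have K: "compact ?K" by (simp add: euclidean_product_topology)
  let ?F = "filtermap \<tau> sequentially"
  have "eventually (\<lambda>f. f \<in> ?K) ?F"
    unfolding eventually_filtermap using D by (intro always_eventually) (auto simp: \<tau>_def)
  then obtain \<gamma> where \<gamma>: "\<gamma> \<in> ?K" "inf (nhds \<gamma>) ?F \<noteq> bot"
    using K unfolding compact_filter by (metis filtermap_bot_iff trivial_limit_sequentially)
  have cl: "\<exists>n\<ge>N. dist (\<gamma> s) (\<tau> n s) < e \<and> dist (\<gamma> t) (\<tau> n t) < e" if "e > 0" for s t e N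
  proof (rule ccontr)
    assume no: "\<not> ?thesis"
    have cont: "continuous_on UNIV (\<lambda>f::real \<Rightarrow> 'a. f t)" for t
      by (rule continuous_on_product_coordinates)
    let ?U = "((\<lambda>f::real \<Rightarrow> 'a. f s) -` ball (\<gamma> s) e) \<inter> ((\<lambda>f. f t) -` ball (\<gamma> t) e)"
    have "open ?U" by (intro open_Int open_vimage open_ball cont)
    moreover have "\<gamma> \<in> ?U" using that by simp
    ultimately have "eventually (\<lambda>f. f \<in> ?U) (nhds \<gamma>)" using eventually_nhds by blast
    moreover have "eventually (\<lambda>f. f \<notin> ?U) ?F"
      unfolding eventually_filtermap eventually_sequentially using no by auto
    ultimately have "eventually (\<lambda>f. False) (inf (nhds \<gamma>) ?F)"
      unfolding eventually_inf by (metis (mono_tags, lifting))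
    then show False using \<gamma>(2) by (simp add: trivial_limit_def)
  qed
  have near: "\<exists>n\<ge>N. dist (\<gamma> s) (\<sigma> n s) < e \<and> dist (\<gamma> t) (\<sigma> n t) < e"
    if st: "s \<in> I" "t \<in> I" "e > 0" for s t e N
  proof -
    obtain N1 N2 where N: "\<And>n. n \<ge> N1 \<Longrightarrow> \<tau> n s = \<sigma> n s" "\<And>n. n \<ge> N2 \<Longrightarrow> \<tau> n t = \<sigma> n t"
      using \<tau>_eq[OF st(1)] \<tau>_eq[OF st(2)] by blast
    obtain n where "n \<ge> max N (max N1 N2)" "dist (\<gamma> s) (\<tau> n s) < e \<and> dist (\<gamma> t) (\<tau> n t) < e"
      using cl[OF st(3)] by blast
    then show ?thesis using N[of n] by auto
  qed
  have "dist (\<gamma> s) (\<gamma> t) = \<bar>s - t\<bar>" if st: "s \<in> I" "t \<in> I" for s t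
  proof (rule ccontr)
    assume ne: "dist (\<gamma> s) (\<gamma> t) \<noteq> \<bar>s - t\<bar>"
    define e where "e = \<bar>dist (\<gamma> s) (\<gamma> t) - \<bar>s - t\<bar>\<bar>"
    obtain N where N: "\<And>n. n \<ge> N \<Longrightarrow> dist (\<sigma> n s) (\<sigma> n t) = \<bar>s - t\<bar>" using iso[OF st] by blast
    have "0 < e / 2" using ne by (simp add: e_def)
    then obtain n where n: "n \<ge> N" "dist (\<gamma> s) (\<sigma> n s) < e / 2" "dist (\<gamma> t) (\<sigma> n t) < e / 2"
      using near[OF st] by blast
    have "\<bar>dist (\<gamma> s) (\<gamma> t) - dist (\<sigma> n s) (\<sigma> n t)\<bar> \<le> dist (\<gamma> s) (\<sigma> n s) + dist (\<gamma> t) (\<sigma> n t)"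
      using dist_triangle[of "\<gamma> s" "\<gamma> t" "\<sigma> n s"] dist_triangle[of "\<sigma> n s" "\<gamma> t" "\<sigma> n t"]
        dist_triangle[of "\<sigma> n s" "\<sigma> n t" "\<gamma> s"] dist_triangle[of "\<gamma> s" "\<sigma> n t" "\<gamma> t"]
      by (simp add: dist_commute abs_le_iff)
    then have "e \<le> dist (\<gamma> s) (\<sigma> n s) + dist (\<gamma> t) (\<sigma> n t)" unfolding e_def N[OF n(1)] .
    then show False using n(2,3) by linarith
  qed
  moreover have "\<exists>n\<ge>N. dist (\<gamma> s) (\<sigma> n s) < e" if "s \<in> I" "e > 0" for s e N
    using near[OF that(1,1,2)] by blast
  ultimately show ?thesis by blast
qed

text \<open>A cluster point of the segments from \<open>bp\<close> to \<open>x n\<close>. Each of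
  its points is within 1 of segments to arbitrarily late \<open>x m\<close>, hence has a large
  product with those \<open>x m\<close>.\<close>

lemma ray_exists:
  assumes "\<xi> \<in> bdry bp"
  shows "\<exists>\<gamma>. geodesic_ray \<gamma> \<and> \<gamma> 0 = bp \<and> (\<lambda>n. \<gamma> (real n)) \<in> \<xi>"
proof -
  obtain x where x: "x \<in> \<xi>" using bdry_nonempty[OF assms] by blast
  have cx: "conv_inf bp x" using bdry_conv[OF assms x] .
  have "\<exists>c. c 0 = bp \<and> c (dist bp (x n)) = x n \<and>
    (\<forall>s\<in>{0..dist bp (x n)}. \<forall>t\<in>{0..dist bp (x n)}. dist (c s) (c t) = \<bar>s - t\<bar>)" for n
    using geodesicE[of bp "x n"] by metis
  then obtain \<sigma> where \<sigma>: "\<And>n. \<sigma> n 0 = bp" "\<And>n. \<sigma> n (dist bp (x n)) = x n"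
    "\<And>n s t. s \<in> {0..dist bp (x n)} \<Longrightarrow> t \<in> {0..dist bp (x n)} \<Longrightarrow> dist (\<sigma> n s) (\<sigma> n t) = \<bar>s - t\<bar>"
    by metis
  have iso: "\<exists>N. \<forall>n\<ge>N. dist (\<sigma> n s) (\<sigma> n t) = \<bar>s - t\<bar>" if "s \<in> {0..}" "t \<in> {0..}" for s t
    using bdry_dist_tendsto[OF cx, of "max s t"] \<sigma>(3)[of s _ t] that by auto
  obtain \<gamma> where \<gamma>: "\<And>s t. s \<ge> 0 \<Longrightarrow> t \<ge> 0 \<Longrightarrow> dist (\<gamma> s) (\<gamma> t) = \<bar>s - t\<bar>"
    "\<And>s e N. s \<ge> 0 \<Longrightarrow> e > 0 \<Longrightarrow> \<exists>n\<ge>N. dist (\<gamma> s) (\<sigma> n s) < e"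
    using geodesic_cluster[of "{0..}" \<sigma> 0, OF _ _ iso] \<sigma>(1) by (simp add: Ball_def) metis
  have g0: "\<gamma> 0 = bp"
  proof (rule ccontr)
    assume "\<gamma> 0 \<noteq> bp"
    then show False using \<gamma>(2)[of 0 "dist (\<gamma> 0) bp" 0] \<sigma>(1) by auto
  qed
  have "(\<lambda>n. \<gamma> (real n)) \<in> \<xi>"
  proof (rule bdry_limit_mem[OF assms x])
    fix M :: real
    obtain N :: nat where N: "M + 1 \<le> real N" using real_arch_simple by blast
    have "\<exists>m\<ge>K. M \<le> gp bp (\<gamma> (real n)) (x m)" if "n \<ge> N" for n K
    proof -
      obtain L where L: "\<And>m. m \<ge> L \<Longrightarrow> real n \<le> dist bp (x m)" using bdry_dist_tendsto[OF cx] by blast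
      obtain m where m: "m \<ge> max K L" "dist (\<gamma> (real n)) (\<sigma> m (real n)) < 1"
        using \<gamma>(2)[of "real n" 1 "max K L"] by auto
      have "dist bp (\<sigma> m (real n)) = real n" "dist (\<sigma> m (real n)) (x m) = dist bp (x m) - real n"
        using \<sigma>(3)[of 0 m "real n"] \<sigma>(3)[of "real n" m "dist bp (x m)"] \<sigma>(1,2)[of m] L[of m] m by auto
      then have "gp bp (\<sigma> m (real n)) (x m) = real n" by (simp add: gromov_prod_def)
      then have "M \<le> gp bp (\<gamma> (real n)) (x m)"
        using gp_lipschitz_left[of bp "\<sigma> m (real n)" "x m" "\<gamma> (real n)"] m(2) N that by (simp add: dist_commute)
      then show ?thesis using m by auto
    qed
    then show "\<exists>N. \<forall>n\<ge>N. \<forall>K. \<exists>m\<ge>K. M \<le> gp bp (\<gamma> (real n)) (x m)" by blast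
  qed
  then show ?thesis using \<gamma>(1) g0 unfolding geodesic_ray_def by blast
qed

lemma bigeodesic_exists:
  assumes "\<xi> \<in> bdry bp" "\<eta> \<in> bdry bp" "\<xi> \<noteq> \<eta>"
  shows "\<exists>\<gamma>. bigeodesic \<gamma> \<and> (\<lambda>n. \<gamma> (- real n)) \<in> \<xi> \<and> (\<lambda>n. \<gamma> (real n)) \<in> \<eta>"
proof -
  obtain x where x: "x \<in> \<xi>" using bdry_nonempty assms by blast
  obtain y where y: "y \<in> \<eta>" using bdry_nonempty assms by blast
  have cx: "conv_inf bp x" and cy: "conv_inf bp y" using bdry_conv assms x y by blast+
  obtain D N0 where D: "\<And>m n. m \<ge> N0 \<Longrightarrow> n \<ge> N0 \<Longrightarrow> gp bp (x m) (y n) \<le> D"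
    using not_equiv_bound[OF cx cy] bdry_eqI[OF assms(1,2) x y] assms(3) by metis
  have "\<exists>c. c 0 = x n \<and> c (dist (x n) (y n)) = y n \<and>
    (\<forall>s\<in>{0..dist (x n) (y n)}. \<forall>t\<in>{0..dist (x n) (y n)}. dist (c s) (c t) = \<bar>s - t\<bar>)" for n
    using geodesicE[of "x n" "y n"] by metis
  then obtain c where c: "\<And>n. c n 0 = x n" "\<And>n. c n (dist (x n) (y n)) = y n"
    "\<And>n s t. s \<in> {0..dist (x n) (y n)} \<Longrightarrow> t \<in> {0..dist (x n) (y n)} \<Longrightarrow> dist (c n s) (c n t) = \<bar>s - t\<bar>"
    by metis
  \<comment> \<open>\<open>r n\<close> and \<open>l n\<close> are the distances from
    \<open>x n\<close> and \<open>y n\<close> to the branch point of the tripod of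
    \<open>bp\<close>, \<open>x n\<close>, \<open>y n\<close>. Both tend to infinity, and counting
    time from that point keeps time 0 in a bounded ball.\<close>
  define r where "r n = gp (x n) bp (y n)" for n
  define l where "l n = gp (y n) bp (x n)" for n
  have rl: "dist (x n) (y n) = r n + l n" "0 \<le> r n" "0 \<le> l n"
    "r n = dist bp (x n) - gp bp (x n) (y n)" "l n = dist bp (y n) - gp bp (x n) (y n)" for n
    unfolding r_def l_def by (auto simp: gp_nonneg) (auto simp: gromov_prod_def dist_commute field_simps)
  have big: "\<exists>N. \<forall>n\<ge>N. M \<le> r n \<and> M \<le> l n" for M
  proof -
    obtain N1 where N1: "\<And>n. n \<ge> N1 \<Longrightarrow> M + D \<le> dist bp (x n)" using bdry_dist_tendsto[OF cx] by blast
    obtain N2 where N2: "\<And>n. n \<ge> N2 \<Longrightarrow> M + D \<le> dist bp (y n)" using bdry_dist_tendsto[OF cy] by blast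
    have "M \<le> r n \<and> M \<le> l n" if "n \<ge> max N0 (max N1 N2)" for n
      using N1[of n] N2[of n] D[of n n] that rl(4,5)[of n] by auto
    then show ?thesis by blast
  qed
  \<comment> \<open>The shift by \<open>N0\<close> makes the bound \<open>D\<close> valid from the
    first index on, as \<open>geodesic_cluster\<close> requires.\<close>
  define \<sigma> where "\<sigma> n t = c (n + N0) (r (n + N0) + t)" for n t
  have iso0: "dist (\<sigma> n s) (\<sigma> n t) = \<bar>s - t\<bar>"
    if "\<bar>s\<bar> \<le> r (n + N0)" "\<bar>s\<bar> \<le> l (n + N0)" "\<bar>t\<bar> \<le> r (n + N0)" "\<bar>t\<bar> \<le> l (n + N0)" for n s t
  proof -
    have "r (n + N0) + s \<in> {0..dist (x (n + N0)) (y (n + N0))}" "r (n + N0) + t \<in> {0..dist (x (n + N0)) (y (n + N0))}"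
      using that rl(1)[of "n + N0"] by (auto simp: abs_le_iff)
    from c(3)[OF this] show ?thesis unfolding \<sigma>_def by simp
  qed
  have big': "\<exists>N. \<forall>n\<ge>N. M \<le> r (n + N0) \<and> M \<le> l (n + N0)" for M
    using big[of M] by (metis trans_le_add1)
  have iso: "\<exists>N. \<forall>n\<ge>N. dist (\<sigma> n s) (\<sigma> n t) = \<bar>s - t\<bar>" for s t
  proof -
    obtain N where "\<And>n. n \<ge> N \<Longrightarrow> max \<bar>s\<bar> \<bar>t\<bar> \<le> r (n + N0) \<and> max \<bar>s\<bar> \<bar>t\<bar> \<le> l (n + N0)"
      using big' by blast
    then show ?thesis using iso0 by (metis max.bounded_iff)
  qed
  define D' where "D' = D + 2 * \<delta>"
  have ends: "dist (\<sigma> n t) (x (n + N0)) = r (n + N0) + t" "dist (\<sigma> n t) (y (n + N0)) = l (n + N0) - t"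
    if "\<bar>t\<bar> \<le> r (n + N0)" "\<bar>t\<bar> \<le> l (n + N0)" for n t
    using c(3)[of "r (n + N0) + t" "n + N0" 0] c(3)[of "r (n + N0) + t" "n + N0" "dist (x (n + N0)) (y (n + N0))"]
      that rl(1-3)[of "n + N0"] c(1,2)[of "n + N0"] unfolding \<sigma>_def by (auto simp: abs_le_iff)
  have base: "dist bp (\<sigma> n 0) \<le> D'" for n
  proof -
    have "dist bp (\<sigma> n 0) \<le> gp bp (x (n + N0)) (y (n + N0)) + 2 * \<delta>"
      using ends[of 0 n] rl(1-3)[of "n + N0"]
      by (intro dist_geodesic_le) (auto simp: dist_commute r_def[symmetric])
    then show ?thesis using D[of "n + N0" "n + N0"] D'_def by simp
  qed
  obtain \<gamma> where \<gamma>: "\<And>s t. dist (\<gamma> s) (\<gamma> t) = \<bar>s - t\<bar>"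
    "\<And>s e N. e > 0 \<Longrightarrow> \<exists>n\<ge>N. dist (\<gamma> s) (\<sigma> n s) < e"
    using geodesic_cluster[of UNIV \<sigma> D', OF UNIV_I base iso] by blast
  have side: "\<exists>m\<ge>K. \<bar>t\<bar> - D' - 1 \<le> gp bp (\<gamma> t) (if t < 0 then x m else y m)" for t K
  proof -
    obtain L where L: "\<And>n. n \<ge> L \<Longrightarrow> \<bar>t\<bar> \<le> r (n + N0) \<and> \<bar>t\<bar> \<le> l (n + N0)" using big' by blast
    obtain m where m: "m \<ge> max K L" "dist (\<gamma> t) (\<sigma> m t) < 1"
      using \<gamma>(2)[of 1 "max K L" t] by auto
    have t: "\<bar>t\<bar> \<le> r (m + N0)" "\<bar>t\<bar> \<le> l (m + N0)" using L[of m] m by auto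
    have d0: "dist (\<sigma> m 0) (\<sigma> m t) = \<bar>t\<bar>" using iso0[of 0 m t] t by (simp add: rl)
    have "\<bar>t\<bar> - D' \<le> gp bp (\<sigma> m t) (if t < 0 then x (m + N0) else y (m + N0))"
    proof (cases "t < 0")
      case True
      show ?thesis
        using gp_between[OF base d0, of "x (m + N0)" "r (m + N0)"] ends[OF t] ends[of 0 m] True rl(2,3)[of "m + N0"] by simp
    next
      case False
      show ?thesis
        using gp_between[OF base d0, of "y (m + N0)" "l (m + N0)"] ends[OF t] ends[of 0 m] False rl(2,3)[of "m + N0"] by simp
    qed
    then have "\<bar>t\<bar> - D' - 1 \<le> gp bp (\<gamma> t) (if t < 0 then x (m + N0) else y (m + N0))"
      using gp_lipschitz_left[of bp "\<sigma> m t" "if t < 0 then x (m + N0) else y (m + N0)" "\<gamma> t"] m(2)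
      by (simp add: dist_commute)
    then show ?thesis using m(1) by (intro exI[of _ "m + N0"]) auto
  qed
  have "(\<lambda>n. \<gamma> (- real n)) \<in> \<xi>"
  proof (rule bdry_limit_mem[OF assms(1) x])
    fix M :: real
    obtain N :: nat where N: "max 1 (M + D' + 1) \<le> real N" using real_arch_simple by blast
    have "\<exists>m\<ge>K. M \<le> gp bp (\<gamma> (- real n)) (x m)" if "n \<ge> N" for n K
    proof -
      have n: "- real n < 0" "M + D' + 1 \<le> real n" using N of_nat_mono[OF that, where 'a=real] by linarith+
      obtain m where "m \<ge> K" "real n - D' - 1 \<le> gp bp (\<gamma> (- real n)) (x m)"
        using side[of K "- real n"] n(1) by auto
      then show ?thesis using n(2) by (intro exI[of _ m]) auto
    qed
    then show "\<exists>N. \<forall>n\<ge>N. \<forall>K. \<exists>m\<ge>K. M \<le> gp bp (\<gamma> (- real n)) (x m)" by blast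
  qed
  moreover have "(\<lambda>n. \<gamma> (real n)) \<in> \<eta>"
  proof (rule bdry_limit_mem[OF assms(2) y])
    fix M :: real
    obtain N :: nat where N: "max 1 (M + D' + 1) \<le> real N" using real_arch_simple by blast
    have "\<exists>m\<ge>K. M \<le> gp bp (\<gamma> (real n)) (y m)" if "n \<ge> N" for n K
    proof -
      have n: "\<not> real n < 0" "M + D' + 1 \<le> real n" using N of_nat_mono[OF that, where 'a=real] by linarith+
      obtain m where "m \<ge> K" "real n - D' - 1 \<le> gp bp (\<gamma> (real n)) (y m)"
        using side[of K "real n"] n(1) by auto
      then show ?thesis using n(2) by (intro exI[of _ m]) auto
    qed
    then show "\<exists>N. \<forall>n\<ge>N. \<forall>K. \<exists>m\<ge>K. M \<le> gp bp (\<gamma> (real n)) (y m)" by blast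
  qed
  ultimately show ?thesis using \<gamma>(1) unfolding bigeodesic_def by blast
qed

text \<open>The constants do not depend on the geodesic, so the infimum in
  \<open>dist_to_geod\<close> and the choice of sequences cost only additive constants. The lower
  bound uses the tripod point on a long segment of \<open>\<gamma>\<close>, the upper bound an
  almost nearest point, whence the 1.\<close>

lemma infdist_bigeodesic_gp:
  assumes "\<xi> \<in> bdry bp" "\<eta> \<in> bdry bp" "x \<in> \<xi>" "y \<in> \<eta>"
    and "bigeodesic \<gamma>" "(\<lambda>n. \<gamma> (- real n)) \<in> \<xi>" "(\<lambda>n. \<gamma> (real n)) \<in> \<eta>"
  shows "\<exists>N. \<forall>m\<ge>N. \<forall>n\<ge>N. infdist bp (range \<gamma>) - 4 * \<delta> \<le> gp bp (x m) (y n) \<and>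
      gp bp (x m) (y n) \<le> infdist bp (range \<gamma>) + 1 + 2 * \<delta>"
proof -
  let ?d = "infdist bp (range \<gamma>)"
  have \<gamma>: "dist (\<gamma> s) (\<gamma> t) = \<bar>s - t\<bar>" for s t using assms(5) by (simp add: bigeodesic_def)
  have low: "?d - 2 * \<delta> \<le> gp bp (\<gamma> (- real k)) (\<gamma> (real k))" for k
  proof -
    let ?p = "\<gamma> (- real k)" and ?q = "\<gamma> (real k)"
    let ?r = "gp ?p bp ?q"
    have r: "0 \<le> ?r" "?r \<le> dist ?p ?q" by (auto simp: gp_nonneg gp_le_dist)
    have "dist bp (\<gamma> (?r - real k)) \<le> gp bp ?p ?q + 2 * \<delta>"
      by (rule dist_geodesic_le) (use r in \<open>auto simp: \<gamma>\<close>)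
    moreover have "?d \<le> dist bp (\<gamma> (?r - real k))" by (rule infdist_le) simp
    ultimately show ?thesis by linarith
  qed
  obtain t where t: "dist bp (\<gamma> t) < ?d + 1"
  proof -
    have "(INF a\<in>range \<gamma>. dist bp a) < ?d + 1" by (simp add: infdist_def)
    then show ?thesis using that by (subst (asm) cINF_less_iff) auto
  qed
  have up: "gp bp (\<gamma> (- real k)) (\<gamma> (real k)) \<le> ?d + 1" if "\<bar>t\<bar> \<le> real k" for k
  proof -
    have "dist (\<gamma> (- real k)) (\<gamma> (real k)) = dist (\<gamma> (- real k)) (\<gamma> t) + dist (\<gamma> t) (\<gamma> (real k))"
      using that by (simp add: \<gamma>)
    then have "gp bp (\<gamma> (- real k)) (\<gamma> (real k)) \<le> dist bp (\<gamma> t)"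
      using dist_triangle[of bp "\<gamma> (- real k)" "\<gamma> t"] dist_triangle[of bp "\<gamma> (real k)" "\<gamma> t"]
      unfolding gromov_prod_def by (simp add: dist_commute)
    then show ?thesis using t by linarith
  qed
  obtain N1 where N1: "\<And>m n. m \<ge> N1 \<Longrightarrow> n \<ge> N1 \<Longrightarrow> ?d + 2 + 2 * \<delta> \<le> gp bp (x m) (\<gamma> (- real n))"
    using seq_equivD[OF bdry_equiv[OF assms(1,3,6)]] by blast
  obtain N2 where N2: "\<And>m n. m \<ge> N2 \<Longrightarrow> n \<ge> N2 \<Longrightarrow> ?d + 2 + 2 * \<delta> \<le> gp bp (y m) (\<gamma> (real n))"
    using seq_equivD[OF bdry_equiv[OF assms(2,4,7)]] by blast
  obtain k where k: "k \<ge> max N1 N2" "\<bar>t\<bar> \<le> real k"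
    by (meson max.bounded_iff nle_le of_nat_le_iff order_trans real_arch_simple)
  have "?d - 4 * \<delta> \<le> gp bp (x m) (y n) \<and> gp bp (x m) (y n) \<le> ?d + 1 + 2 * \<delta>"
    if "m \<ge> max N1 N2" "n \<ge> max N1 N2" for m n
  proof -
    have 1: "?d + 2 + 2 * \<delta> \<le> gp bp (x m) (\<gamma> (- real k))" "?d + 2 + 2 * \<delta> \<le> gp bp (y n) (\<gamma> (real k))"
      using N1 N2 that k by auto
    have "?d - 2 * \<delta> - 2 * \<delta> \<le> gp bp (x m) (y n)"
      using hyp3[of "?d - 2 * \<delta>" bp "x m" "\<gamma> (- real k)" "\<gamma> (real k)" "y n"] 1 low[of k] \<delta>_nonneg
      by (simp add: gp_commute)
    moreover have "gp bp (x m) (y n) \<le> ?d + 1 + 2 * \<delta>"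
    proof (rule ccontr)
      assume no: "\<not> ?thesis"
      then have "min (gp bp (x m) (y n)) (?d + 2 + 2 * \<delta>) - 2 * \<delta> \<le> gp bp (\<gamma> (- real k)) (\<gamma> (real k))"
        using hyp3[of "min (gp bp (x m) (y n)) (?d + 2 + 2 * \<delta>)" bp "\<gamma> (- real k)" "x m" "y n" "\<gamma> (real k)"] 1
        by (simp add: gp_commute)
      then show False using up[OF k(2)] no by linarith
    qed
    ultimately show ?thesis by simp
  qed
  then show ?thesis by blast
qed

text \<open>A bound at arbitrarily late pairs is enough, since all late products agree with the
  distance to a connecting geodesic up to a constant.\<close>

lemma dist_to_geod_le:
  assumes "\<xi> \<in> bdry bp" "\<eta> \<in> bdry bp" "\<xi> \<noteq> \<eta>" "x \<in> \<xi>" "y \<in> \<eta>"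
    and "\<And>N. \<exists>m\<ge>N. \<exists>n\<ge>N. gp bp (x m) (y n) \<le> D"
  shows "dist_to_geod bp \<xi> \<eta> \<le> D + 4 * \<delta>"
proof -
  obtain \<gamma> where \<gamma>: "bigeodesic \<gamma>" "(\<lambda>n. \<gamma> (- real n)) \<in> \<xi>" "(\<lambda>n. \<gamma> (real n)) \<in> \<eta>"
    using bigeodesic_exists[OF assms(1-3)] by blast
  have "infdist bp (range \<gamma>) \<le> D + 4 * \<delta>"
  proof -
    obtain N where "\<And>m n. m \<ge> N \<Longrightarrow> n \<ge> N \<Longrightarrow> infdist bp (range \<gamma>) - 4 * \<delta> \<le> gp bp (x m) (y n)"
      using infdist_bigeodesic_gp[OF assms(1,2,4,5) \<gamma>] by blast
    moreover obtain m n where "m \<ge> N" "n \<ge> N" "gp bp (x m) (y n) \<le> D" using assms(6) by blast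
    ultimately show ?thesis by force
  qed
  moreover have "dist_to_geod bp \<xi> \<eta> \<le> infdist bp (range \<gamma>)"
    unfolding dist_to_geod_def
    by (rule cInf_lower) (use \<gamma> infdist_nonneg in \<open>auto intro!: bdd_belowI[of _ 0]\<close>)
  ultimately show ?thesis by linarith
qed

lemma dist_to_geod_ge:
  assumes "\<xi> \<in> bdry bp" "\<eta> \<in> bdry bp" "\<xi> \<noteq> \<eta>" "x \<in> \<xi>" "y \<in> \<eta>"
    and "\<And>N. \<exists>m\<ge>N. \<exists>n\<ge>N. D \<le> gp bp (x m) (y n)"
  shows "D - 1 - 2 * \<delta> \<le> dist_to_geod bp \<xi> \<eta>"
  unfolding dist_to_geod_def
proof (rule cInf_greatest)
  show "{infdist bp (range \<gamma>) |\<gamma>. bigeodesic \<gamma> \<and> (\<lambda>n. \<gamma> (- real n)) \<in> \<xi> \<and> (\<lambda>n. \<gamma> (real n)) \<in> \<eta>} \<noteq> {}"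
    using bigeodesic_exists[OF assms(1-3)] by blast
next
  fix d assume "d \<in> {infdist bp (range \<gamma>) |\<gamma>. bigeodesic \<gamma> \<and> (\<lambda>n. \<gamma> (- real n)) \<in> \<xi> \<and> (\<lambda>n. \<gamma> (real n)) \<in> \<eta>}"
  then obtain \<gamma> where d: "d = infdist bp (range \<gamma>)" and
    \<gamma>: "bigeodesic \<gamma>" "(\<lambda>n. \<gamma> (- real n)) \<in> \<xi>" "(\<lambda>n. \<gamma> (real n)) \<in> \<eta>" by blast
  obtain N where "\<And>m n. m \<ge> N \<Longrightarrow> n \<ge> N \<Longrightarrow> gp bp (x m) (y n) \<le> infdist bp (range \<gamma>) + 1 + 2 * \<delta>"
    using infdist_bigeodesic_gp[OF assms(1,2,4,5) \<gamma>] by blast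
  moreover obtain m n where "m \<ge> N" "n \<ge> N" "D \<le> gp bp (x m) (y n)" using assms(6) by blast
  ultimately show "D - 1 - 2 * \<delta> \<le> d" unfolding d by force
qed

text \<open>The comparison point on the ray has the same distance from \<open>bp\<close> as
  \<open>p\<close>, so their distance can be read off from the single product
  \<open>gp bp p ?z\<close>, which is almost \<open>dist bp p\<close>.\<close>

lemma ray_near:
  assumes "\<xi> \<in> bdry bp" "x \<in> \<xi>" "geodesic_ray \<gamma>" "\<gamma> 0 = bp" "(\<lambda>n. \<gamma> (real n)) \<in> \<xi>"
    and p: "\<And>N. \<exists>m\<ge>N. dist bp p - c \<le> gp bp p (x m)" and "0 \<le> c"
  shows "dist p (\<gamma> (dist bp p)) \<le> 2 * c + 4 * \<delta>"
proof -
  have \<gamma>: "dist (\<gamma> s) (\<gamma> t) = \<bar>s - t\<bar>" if "s \<ge> 0" "t \<ge> 0" for s t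
    using assms(3) that by (simp add: geodesic_ray_def)
  let ?z = "\<gamma> (dist bp p)"
  obtain N where N: "\<And>m n. m \<ge> N \<Longrightarrow> n \<ge> N \<Longrightarrow> dist bp p \<le> gp bp (x m) (\<gamma> (real n))"
    using seq_equivD[OF bdry_equiv[OF assms(1,2,5)]] by blast
  obtain k :: nat where k: "k \<ge> N" "dist bp p \<le> real k"
    by (meson nle_le of_nat_le_iff order_trans real_arch_simple)
  obtain m where m: "m \<ge> N" "dist bp p - c \<le> gp bp p (x m)" using p by blast
  have z: "dist bp ?z = dist bp p" using \<gamma>[of 0 "dist bp p"] assms(4) by simp
  have "gp bp (\<gamma> (real k)) ?z = dist bp p"
    using \<gamma>[of 0 "real k"] \<gamma>[of "real k" "dist bp p"] k z assms(4) by (simp add: gromov_prod_def)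
  then have "dist bp p - c - 2 * \<delta> \<le> gp bp p ?z"
    using hyp3[OF m(2), of "\<gamma> (real k)" ?z] N[OF m(1) k(1)] assms(7) by simp
  then show ?thesis using z dist_eq_gp[of p ?z bp] by linarith
qed

end

section \<open>Visual metrics in terms of Gromov products\<close>

locale visual_space = gromov_space +
  fixes \<epsilon> :: real and \<rho> :: "(nat \<Rightarrow> 'a) set \<Rightarrow> (nat \<Rightarrow> 'a) set \<Rightarrow> real"
  assumes \<epsilon>_pos: "\<epsilon> > 0" and visual: "visual_metric bp \<epsilon> \<rho>"
begin

text \<open>The spelled-out quantifiers keep one \<open>C\<close> for all boundary points,
  representatives and \<open>D\<close>; the additive error of \<open>dist_to_geod_le\<close> becomes
  a factor.\<close>

lemma rho_lower:
  "\<exists>C>0. \<forall>\<xi>\<in>bdry bp. \<forall>\<eta>\<in>bdry bp. \<forall>x\<in>\<xi>. \<forall>y\<in>\<eta>. \<forall>D. \<xi> \<noteq> \<eta> \<longrightarrow>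
     (\<forall>N. \<exists>m\<ge>N. \<exists>n\<ge>N. gp bp (x m) (y n) \<le> D) \<longrightarrow> C * exp (- \<epsilon> * D) \<le> \<rho> \<xi> \<eta>"
proof -
  obtain C where C: "C \<ge> 1" "\<And>\<xi> \<eta>. \<xi> \<in> bdry bp \<Longrightarrow> \<eta> \<in> bdry bp \<Longrightarrow> \<xi> \<noteq> \<eta> \<Longrightarrow>
      exp (- \<epsilon> * dist_to_geod bp \<xi> \<eta>) / C \<le> \<rho> \<xi> \<eta>"
    using visual unfolding visual_metric_def by metis
  have "exp (- \<epsilon> * (4 * \<delta>)) / C * exp (- \<epsilon> * D) \<le> \<rho> \<xi> \<eta>"
    if "\<xi> \<in> bdry bp" "\<eta> \<in> bdry bp" "x \<in> \<xi>" "y \<in> \<eta>" "\<xi> \<noteq> \<eta>" "\<forall>N. \<exists>m\<ge>N. \<exists>n\<ge>N. gp bp (x m) (y n) \<le> D"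
    for \<xi> \<eta> x y D
  proof -
    have "dist_to_geod bp \<xi> \<eta> \<le> D + 4 * \<delta>"
      by (rule dist_to_geod_le) (use that in auto)
    then have "\<epsilon> * dist_to_geod bp \<xi> \<eta> \<le> \<epsilon> * (D + 4 * \<delta>)" using \<epsilon>_pos by simp
    then have "exp (- \<epsilon> * (4 * \<delta>)) * exp (- \<epsilon> * D) \<le> exp (- \<epsilon> * dist_to_geod bp \<xi> \<eta>)"
      by (simp add: exp_add[symmetric] algebra_simps)
    then have "exp (- \<epsilon> * (4 * \<delta>)) * exp (- \<epsilon> * D) / C \<le> exp (- \<epsilon> * dist_to_geod bp \<xi> \<eta>) / C"
      using C(1) by (intro divide_right_mono) auto
    also have "\<dots> \<le> \<rho> \<xi> \<eta>" using C(2) that by blast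
    finally show ?thesis by simp
  qed
  moreover have "exp (- \<epsilon> * (4 * \<delta>)) / C > 0" using C(1) by simp
  ultimately show ?thesis by blast
qed

lemma rho_upper:
  "\<exists>C>0. \<forall>\<xi>\<in>bdry bp. \<forall>\<eta>\<in>bdry bp. \<forall>x\<in>\<xi>. \<forall>y\<in>\<eta>. \<forall>D.
     (\<forall>N. \<exists>m\<ge>N. \<exists>n\<ge>N. D \<le> gp bp (x m) (y n)) \<longrightarrow> \<rho> \<xi> \<eta> \<le> C * exp (- \<epsilon> * D)"
proof -
  obtain C where C: "C \<ge> 1" "\<And>\<xi> \<eta>. \<xi> \<in> bdry bp \<Longrightarrow> \<eta> \<in> bdry bp \<Longrightarrow> \<xi> \<noteq> \<eta> \<Longrightarrow>
      \<rho> \<xi> \<eta> \<le> C * exp (- \<epsilon> * dist_to_geod bp \<xi> \<eta>)"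
    using visual unfolding visual_metric_def by metis
  have "\<rho> \<xi> \<eta> \<le> C * exp (\<epsilon> * (1 + 2 * \<delta>)) * exp (- \<epsilon> * D)"
    if "\<xi> \<in> bdry bp" "\<eta> \<in> bdry bp" "x \<in> \<xi>" "y \<in> \<eta>" "\<forall>N. \<exists>m\<ge>N. \<exists>n\<ge>N. D \<le> gp bp (x m) (y n)"
    for \<xi> \<eta> x y D
  proof (cases "\<xi> = \<eta>")
    case True
    then have "\<rho> \<xi> \<eta> = 0" using visual that unfolding visual_metric_def by blast
    then show ?thesis using C(1) by simp
  next
    case False
    have "D - 1 - 2 * \<delta> \<le> dist_to_geod bp \<xi> \<eta>"
      by (rule dist_to_geod_ge) (use that False in auto)
    then have "\<epsilon> * (D - 1 - 2 * \<delta>) \<le> \<epsilon> * dist_to_geod bp \<xi> \<eta>" using \<epsilon>_pos by simp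
    then have "exp (- \<epsilon> * dist_to_geod bp \<xi> \<eta>) \<le> exp (\<epsilon> * (1 + 2 * \<delta>)) * exp (- \<epsilon> * D)"
      by (simp add: exp_add[symmetric] algebra_simps)
    then have "C * exp (- \<epsilon> * dist_to_geod bp \<xi> \<eta>) \<le> C * (exp (\<epsilon> * (1 + 2 * \<delta>)) * exp (- \<epsilon> * D))"
      using C(1) by (intro mult_left_mono) auto
    then show ?thesis using C(2)[OF that(1,2) False] by (simp add: mult.assoc)
  qed
  moreover have "C * exp (\<epsilon> * (1 + 2 * \<delta>)) > 0" using C(1) by simp
  ultimately show ?thesis by blast
qed

end

section \<open>Actions: limit points are not fixed\<close>

locale hyperbolic_action = gromov_space bp \<delta> + group G
  for bp :: "'a::metric_space" and \<delta> :: real and G (structure) +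
  fixes act :: "'b \<Rightarrow> 'a \<Rightarrow> 'a"
  assumes isometric: "isometric_action G act"
    and proper_act: "proper_action G act"
    and nonelementary: "non_elementary G act bp"
begin

section \<open>Lengths of group elements and the action on the boundary\<close>

lemma act_mult: "g \<in> carrier G \<Longrightarrow> h \<in> carrier G \<Longrightarrow> act (g \<otimes> h) x = act g (act h x)"
  using isometric by (simp add: isometric_action_def)

lemma act_one [simp]: "act \<one> x = x"
  using isometric by (simp add: isometric_action_def)

lemma act_inv [simp]: "g \<in> carrier G \<Longrightarrow> act (inv g) (act g x) = x" "g \<in> carrier G \<Longrightarrow> act g (act (inv g) x) = x"
  by (simp_all add: act_mult[symmetric])

lemma dist_act [simp]: "g \<in> carrier G \<Longrightarrow> dist (act g x) (act g y) = dist x y"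
  using isometric by (simp add: isometric_action_def)

lemma gp_act [simp]: "g \<in> carrier G \<Longrightarrow> gp (act g w) (act g x) (act g y) = gp w x y"
  by (simp add: gromov_prod_def)

definition len :: "'b \<Rightarrow> real" where "len g = dist bp (act g bp)"

lemma len_nonneg [simp]: "0 \<le> len g" by (simp add: len_def)

lemma len_inv [simp]: "g \<in> carrier G \<Longrightarrow> len (inv g) = len g"
  unfolding len_def using dist_act[of g bp "act (inv g) bp"] by (simp add: dist_commute)

lemma dist_act_bp: "g \<in> carrier G \<Longrightarrow> h \<in> carrier G \<Longrightarrow> dist (act g bp) (act h bp) = len (inv g \<otimes> h)"
  unfolding len_def using dist_act[of "inv g" "act g bp" "act h bp"] by (simp add: act_mult)

lemma dist_act_mult: "g \<in> carrier G \<Longrightarrow> h \<in> carrier G \<Longrightarrow> dist (act g bp) (act (g \<otimes> h) bp) = len h"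
  by (simp add: act_mult len_def)

lemma len_mult_le: "g \<in> carrier G \<Longrightarrow> h \<in> carrier G \<Longrightarrow> len (g \<otimes> h) \<le> len g + len h"
  using dist_triangle[of bp "act (g \<otimes> h) bp" "act g bp"] dist_act_mult[of g h] by (simp add: len_def)

lemma len_mult_ge:
  assumes "g \<in> carrier G" "h \<in> carrier G"
  shows "len h - len g \<le> len (g \<otimes> h)" "len g - len h \<le> len (g \<otimes> h)"
  using len_mult_le[of "inv g" "g \<otimes> h"] len_mult_le[of "g \<otimes> h" "inv h"] assms
  by (simp_all add: m_assoc[symmetric]) (simp add: m_assoc)

lemma gp_act_base_ge:
  assumes "g \<in> carrier G"
  shows "gp bp x y - len g \<le> gp bp (act g x) (act g y)"
proof -
  have "gp (act (inv g) bp) x y = gp bp (act g x) (act g y)"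
    using gp_act[of g "act (inv g) bp" x y] assms by simp
  then show ?thesis using gp_lipschitz_base[of bp x y "act (inv g) bp"] len_inv[OF assms]
    by (simp add: len_def)
qed

lemma gp_act_base_le: "g \<in> carrier G \<Longrightarrow> gp bp (act g x) (act g y) \<le> gp bp x y + len g"
  using gp_lipschitz_base[of bp "act g x" "act g y" "act g bp"] by (simp add: len_def)

lemma finite_ball: "finite {g \<in> carrier G. len g \<le> r}"
proof (cases "r \<ge> 0")
  case True
  have "{g \<in> carrier G. len g \<le> r} \<subseteq> {g \<in> carrier G. act g ` cball bp r \<inter> cball bp r \<noteq> {}}"
  proof clarify
    fix g assume g: "g \<in> carrier G" "len g \<le> r" "act g ` cball bp r \<inter> cball bp r = {}"
    have "act g bp \<in> act g ` cball bp r" using True by simp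
    moreover have "act g bp \<in> cball bp r" using g(2) by (simp add: len_def)
    ultimately show False using g(3) by blast
  qed
  moreover have "compact (cball bp r)" using proper by (simp add: proper_space_def)
  ultimately show ?thesis using proper_act unfolding proper_action_def by (meson finite_subset)
next
  case False
  then have "\<not> len g \<le> r" for g using len_nonneg[of g] by linarith
  then show ?thesis by simp
qed

lemma countable_carrier: "countable (carrier G)"
proof (rule countable_subset)
  show "carrier G \<subseteq> (\<Union>n::nat. {g \<in> carrier G. len g \<le> real n})"
    using real_arch_simple by fastforce
  show "countable (\<Union>n::nat. {g \<in> carrier G. len g \<le> real n})"
    by (rule countable_UN[OF countableI_type countable_finite[OF finite_ball]])
qed

lemma seq_equiv_act:
  assumes "g \<in> carrier G" "seq_equiv bp x y"
  shows "seq_equiv bp (\<lambda>n. act g (x n)) (\<lambda>n. act g (y n))"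
  unfolding seq_equiv_def
proof
  fix M
  obtain N where "\<And>m n. m \<ge> N \<Longrightarrow> n \<ge> N \<Longrightarrow> M + len g \<le> gp bp (x m) (y n)"
    using seq_equivD[OF assms(2)] by blast
  then show "\<exists>N. \<forall>m\<ge>N. \<forall>n\<ge>N. M \<le> gp bp (act g (x m)) (act g (y n))"
    using gp_act_base_ge[OF assms(1)] by (meson add_le_imp_le_diff order_trans)
qed

lemma conv_inf_act: "g \<in> carrier G \<Longrightarrow> conv_inf bp x \<Longrightarrow> conv_inf bp (\<lambda>n. act g (x n))"
  unfolding conv_inf_iff_equiv by (rule seq_equiv_act)

lemma bdry_act_mem: "x \<in> \<xi> \<Longrightarrow> (\<lambda>n. act g (x n)) \<in> bdry_act act g \<xi>"
  unfolding bdry_act_def by (auto simp: o_def image_def intro!: bexI[of _ x])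

lemma bdry_act_in:
  assumes "g \<in> carrier G" "\<xi> \<in> bdry bp"
  shows "bdry_act act g \<xi> \<in> bdry bp"
proof -
  obtain x where x: "x \<in> \<xi>" using bdry_nonempty assms by blast
  let ?y = "\<lambda>n. act g (x n)"
  have cx: "conv_inf bp x" using bdry_conv assms x by blast
  have "bdry_act act g \<xi> = {z. conv_inf bp z \<and> seq_equiv bp ?y z}"
  proof (rule subset_antisym; rule subsetI)
    fix z assume "z \<in> bdry_act act g \<xi>"
    then obtain w where w: "w \<in> \<xi>" "z = (\<lambda>n. act g (w n))" by (auto simp: bdry_act_def o_def)
    show "z \<in> {z. conv_inf bp z \<and> seq_equiv bp ?y z}"
      unfolding w(2) using bdry_conv[OF assms(2) w(1)] bdry_equiv[OF assms(2) x w(1)]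
      by (auto intro: conv_inf_act seq_equiv_act assms(1))
  next
    fix z assume "z \<in> {z. conv_inf bp z \<and> seq_equiv bp ?y z}"
    then have z: "conv_inf bp z" "seq_equiv bp ?y z" by auto
    let ?w = "\<lambda>n. act (inv g) (z n)"
    have "seq_equiv bp (\<lambda>n. act (inv g) (?y n)) ?w" by (rule seq_equiv_act) (use z assms in auto)
    then have "?w \<in> \<xi>"
      by (intro bdry_mem[OF assms(2) x] conv_inf_act) (use z assms in auto)
    then have "(\<lambda>n. act g (?w n)) \<in> bdry_act act g \<xi>" by (rule bdry_act_mem)
    then show "z \<in> bdry_act act g \<xi>" using assms(1) by simp
  qed
  then show ?thesis unfolding bdry_def using conv_inf_act[OF assms(1) cx] by blast
qed

text \<open>If \<open>k\<close> fixes the limit of \<open>y\<close>, then \<open>k\<close> or its inverse must move the base point towards that limit.\<close>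
lemma fix_estimate:
  assumes "k \<in> carrier G" "seq_equiv bp (\<lambda>n. act k (y n)) y"
    and D: "\<forall>m\<ge>N. gp bp (act k bp) (y m) \<le> D"
  shows "\<exists>N. \<forall>m\<ge>N. len k - (D + \<delta>) \<le> gp bp (act (inv k) bp) (y m)"
proof -
  obtain N1 where N1: "\<And>m. m \<ge> N1 \<Longrightarrow> D + \<delta> + 1 \<le> gp bp (act k (y m)) (y m)"
    using seq_equivD[OF assms(2), of "D + \<delta> + 1"] by blast
  have "len k - (D + \<delta>) \<le> gp bp (act (inv k) bp) (y m)" if "m \<ge> max N N1" for m
  proof -
    have "gp bp (act k bp) (act k (y m)) \<le> D + \<delta>"
      using hyp_or_le[of bp "act k bp" "y m" D "act k (y m)"] D N1[of m] that by auto
    moreover have "gp bp (act (inv k) bp) (y m) = gp (act k bp) bp (act k (y m))"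
      using gp_act[of k bp "act (inv k) bp" "y m"] assms(1) by simp
    ultimately show ?thesis using gp_add[of "act k bp" bp "act k (y m)"] by (simp add: len_def)
  qed
  then show ?thesis by blast
qed

text \<open>\<open>z\<close> and \<open>w\<close> together belong to at most two of three distinct
  limit points. An orbit sequence converging to the remaining one has bounded products with
  both.\<close>

lemma limit_point_avoiding:
  assumes "conv_inf bp z" "conv_inf bp w"
  shows "\<exists>e D N. (\<forall>n. e n \<in> carrier G) \<and> conv_inf bp (\<lambda>n. act (e n) bp) \<and>
    (\<forall>m\<ge>N. \<forall>n\<ge>N. gp bp (act (e m) bp) (z n) \<le> D \<and> gp bp (act (e m) bp) (w n) \<le> D)"
proof -
  obtain a b c where abc: "{a, b, c} \<subseteq> limit_set G act bp" "a \<noteq> b" "b \<noteq> c" "a \<noteq> c"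
    using nonelementary unfolding non_elementary_def by blast
  have L: "limit_set G act bp \<subseteq> bdry bp" by (auto simp: limit_set_def)
  have uniq: "\<xi> = \<eta>" if "\<xi> \<in> limit_set G act bp" "\<eta> \<in> limit_set G act bp" "x \<in> \<xi>" "x \<in> \<eta>" for \<xi> \<eta> x
    using bdry_eqI[of \<xi> \<eta> x x] bdry_conv[of \<xi> x] that L conv_inf_iff_equiv by blast
  have "\<exists>\<xi>\<in>{a, b, c}. z \<notin> \<xi> \<and> w \<notin> \<xi>"
    using uniq[of a b z] uniq[of b c z] uniq[of a c z] uniq[of a b w] uniq[of b c w] uniq[of a c w] abc
    by auto
  then obtain \<xi> where \<xi>: "\<xi> \<in> limit_set G act bp" "z \<notin> \<xi>" "w \<notin> \<xi>" using abc(1) by blast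
  then obtain e where e: "\<And>n. e n \<in> carrier G" "(\<lambda>n. act (e n) bp) \<in> \<xi>"
    unfolding limit_set_def by blast
  have \<xi>b: "\<xi> \<in> bdry bp" using \<xi> L by blast
  have ce: "conv_inf bp (\<lambda>n. act (e n) bp)" using bdry_conv[OF \<xi>b e(2)] .
  obtain D1 N1 where 1: "\<And>m n. m \<ge> N1 \<Longrightarrow> n \<ge> N1 \<Longrightarrow> gp bp (act (e m) bp) (z n) \<le> D1"
    using not_equiv_bound[OF ce assms(1)] bdry_mem[OF \<xi>b e(2) assms(1)] \<xi>(2) by blast
  obtain D2 N2 where 2: "\<And>m n. m \<ge> N2 \<Longrightarrow> n \<ge> N2 \<Longrightarrow> gp bp (act (e m) bp) (w n) \<le> D2"
    using not_equiv_bound[OF ce assms(2)] bdry_mem[OF \<xi>b e(2) assms(2)] \<xi>(3) by blast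
  have "\<forall>m\<ge>max N1 N2. \<forall>n\<ge>max N1 N2. gp bp (act (e m) bp) (z n) \<le> max D1 D2 \<and> gp bp (act (e m) bp) (w n) \<le> max D1 D2"
    using 1 2 by (simp add: max.coboundedI1 max.coboundedI2)
  then show ?thesis using e(1) ce by blast
qed

text \<open>Every turn of the path of powers is a translate of the one at \<open>bp\<close> between
  \<open>inv h\<close> and \<open>h\<close>.\<close>

lemma broken_powers:
  assumes h: "h \<in> carrier G" and c: "gp bp (act (inv h) bp) (act h bp) \<le> c"
    and "2 * c + 4 * \<delta> + 1 \<le> len h"
  shows "broken c (\<lambda>n. act (h [^] (n::nat)) bp)"
  unfolding broken_def
proof (intro allI conjI)
  fix i :: nat
  let ?p = "h [^] Suc i"
  have p: "?p \<in> carrier G" using h by simp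
  have 1: "h [^] i = ?p \<otimes> inv h" using h by (simp add: m_assoc)
  have 2: "h [^] Suc (Suc i) = ?p \<otimes> h" by simp
  show "gp (act ?p bp) (act (h [^] i) bp) (act (h [^] Suc (Suc i)) bp) \<le> c"
    unfolding 1 2 using p h c by (subst (1 2) act_mult) auto
  show "2 * c + 4 * \<delta> + 1 \<le> dist (act (h [^] i) bp) (act (h [^] Suc i) bp)"
    using dist_act_mult[of "h [^] i" h] h assms(3) by simp
qed

text \<open>If all of \<open>G\<close> fixed the limit of \<open>y\<close>, some \<open>h\<close> would be loxodromic with powers converging to it.
  Properness bounds \<open>h\<^sup>n x h\<^sup>-\<^sup>n\<close>, so every \<open>x\<close> commutes with arbitrarily high powers of \<open>h\<close> and also fixes
  the other end of the axis; a third limit point then contradicts \<open>fix_estimate\<close>.\<close>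
lemma limit_point_not_fixed:
  assumes y: "conv_inf bp y"
  shows "\<exists>x\<in>carrier G. \<not> seq_equiv bp (\<lambda>n. act x (y n)) y"
proof (rule ccontr)
  assume "\<not> ?thesis"
  then have fixy: "seq_equiv bp (\<lambda>n. act x (y n)) y" if "x \<in> carrier G" for x using that by blast
  obtain k D N where k: "\<And>n. k n \<in> carrier G" "conv_inf bp (\<lambda>n. act (k n) bp)"
    "\<And>m n. m \<ge> N \<Longrightarrow> n \<ge> N \<Longrightarrow> gp bp (act (k m) bp) (y n) \<le> D"
    using limit_point_avoiding[OF y y] by blast
  have D0: "0 \<le> D" using k(3)[of N N] gp_nonneg order_trans by blast
  define c where "c = D + \<delta>"
  have c0: "0 \<le> c" using D0 \<delta>_nonneg by (simp add: c_def)
  obtain N1 where N1: "\<And>n. n \<ge> N1 \<Longrightarrow> 2 * c + 4 * \<delta> + 1 \<le> len (k n)"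
    using bdry_dist_tendsto[OF k(2)] unfolding len_def by blast
  \<comment> \<open>\<open>h\<close> points away from the limit of \<open>y\<close>. As it fixes
    that limit, \<open>fix_estimate\<close> makes \<open>inv h\<close> point towards it, so the turn
    at \<open>bp\<close> is at most \<open>c\<close> and the powers of \<open>h\<close> run along an
    axis.\<close>
  define h where "h = k (max N N1)"
  have h: "h \<in> carrier G" and hl: "2 * c + 4 * \<delta> + 1 \<le> len h" using k(1) N1 by (simp_all add: h_def)
  have hy: "\<forall>m\<ge>N. gp bp (act h bp) (y m) \<le> D" using k(3) by (simp add: h_def)
  obtain N2 where N2: "\<And>m. m \<ge> N2 \<Longrightarrow> len h - c \<le> gp bp (act (inv h) bp) (y m)"
    using fix_estimate[OF h fixy[OF h] hy] unfolding c_def by blast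
  have hh: "gp bp (act (inv h) bp) (act h bp) \<le> c"
  proof -
    have "gp bp (act (inv h) bp) (y (max N N2)) > c" using N2[of "max N N2"] hl c0 \<delta>_nonneg by simp
    then show ?thesis
      using hyp_or_le[of bp "act h bp" "y (max N N2)" D "act (inv h) bp"] hy
      by (simp add: c_def gp_commute)
  qed
  define p where "p n = h [^] (n::nat)" for n
  have p: "p n \<in> carrier G" for n using h by (simp add: p_def)
  have p_add: "p (m + n) = p m \<otimes> p n" for m n using h by (simp add: p_def nat_pow_mult)
  have bp: "broken c (\<lambda>n. act (p n) bp)" unfolding p_def by (rule broken_powers[OF h hh hl])
  have p0: "act (p 0) bp = bp" by (simp add: p_def)
  define z where "z n = act (inv (p n)) bp" for n
  have bz: "broken c z"
  proof -
    have "z = (\<lambda>n. act (inv h [^] n) bp)" using h by (simp add: fun_eq_iff z_def p_def nat_pow_inv)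
    then show ?thesis using broken_powers[of "inv h" c] h hh hl by (simp add: gp_commute)
  qed
  have z0: "z 0 = bp" by (simp add: z_def p_def)
  let ?c = "c + 2 * \<delta>"
  \<comment> \<open>The two half-axes diverge at \<open>bp\<close>: applying \<open>p m\<close>
    turns this product into the one at a vertex of the broken path of positive powers.\<close>
  have cross: "gp bp (z m) (act (p n) bp) \<le> ?c" for m n
  proof -
    have "gp (act (p m) bp) (act (p 0) bp) (act (p (m + n)) bp) \<le> ?c"
      using broken_gp[OF bp, of 0 m "m + n"] by simp
    moreover have "act (p m) (z m) = bp" using p by (simp add: z_def)
    ultimately show ?thesis using gp_act[OF p, of m bp "z m" "act (p n) bp"] p
      by (simp add: p_add act_mult p0 del: gp_act)
  qed
  have lenp: "real n \<le> len (p n)" for n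
    using broken_dist[OF bp, of n] by (simp add: p0 len_def)
  have cz: "conv_inf bp z" by (rule broken_conv_inf[OF bz z0])
  have cp: "conv_inf bp (\<lambda>n. act (p n) bp)" by (rule broken_conv_inf[OF bp p0])
  have z1: "z 1 = act (inv h) bp" using h by (simp add: z_def p_def)
  have zy: "\<exists>N. \<forall>m\<ge>N. len (p n) - (?c + \<delta> + \<delta>) \<le> gp bp (z n) (y m)" for n
  proof -
    have "gp bp (act (p n) bp) (y m) \<le> ?c + \<delta>" if "m \<ge> N2" for m
    proof -
      have 1: "gp bp (act (inv h) bp) (y m) > ?c + \<delta>" using N2[OF that] hl c0 \<delta>_nonneg by simp
      have "gp bp (act (p n) bp) (act (inv h) bp) \<le> ?c" using cross[of 1 n] z1 by (simp add: gp_commute)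
      from hyp_or_le[OF this, of "y m"] 1 show ?thesis by (simp add: gp_commute)
    qed
    then show ?thesis using fix_estimate[OF p fixy[OF p], of N2] unfolding z_def by blast
  qed
  have "seq_equiv bp y z"
  proof (rule equiv_limit(2)[OF y])
    fix M :: real
    obtain N :: nat where N: "M + (?c + \<delta> + \<delta>) \<le> real N" using real_arch_simple by blast
    have "\<exists>m\<ge>K. M \<le> gp bp (z n) (y m)" if "n \<ge> N" for n K
    proof -
      obtain N' where "\<And>m. m \<ge> N' \<Longrightarrow> len (p n) - (?c + \<delta> + \<delta>) \<le> gp bp (z n) (y m)" using zy by blast
      from this[of "max K N'"] have "M \<le> gp bp (z n) (y (max K N'))"
        using N lenp[of n] of_nat_mono[OF that, where 'a=real] by simp
      then show ?thesis by (intro exI[of _ "max K N'"]) simp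
    qed
    then show "\<exists>N. \<forall>n\<ge>N. \<forall>K. \<exists>m\<ge>K. M \<le> gp bp (z n) (y m)" by blast
  qed
  then have fixz: "seq_equiv bp (\<lambda>n. act x (z n)) z" if "x \<in> carrier G" for x
    using seq_equiv_trans[OF seq_equiv_trans[OF seq_equiv_act[OF that seq_equiv_sym] fixy[OF that]]] by blast
  have fixp: "seq_equiv bp (\<lambda>n. act x (act (p n) bp)) (\<lambda>n. act (p n) bp)" if x: "x \<in> carrier G" for x
  proof -
    \<comment> \<open>Since \<open>x\<close> fixes the end of the half-axis \<open>z\<close>, the
      points \<open>act x (z n)\<close> and \<open>z n\<close> have nearly equal distance from
      \<open>bp\<close> and a product close to it. So \<open>x\<close> moves \<open>z n\<close> by a
      bounded amount, and this displacement is the length of the conjugate by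
      \<open>p n\<close>.\<close>
    have bounded: "len (p n \<otimes> x \<otimes> inv (p n)) \<le> 2 * ?c + 3 * len x + 4 * \<delta>" for n
    proof -
      obtain N' where N': "\<And>m. m \<ge> N' \<Longrightarrow> len (p n) \<le> gp bp (act x (z m)) (z m)"
        using seq_equivD[OF fixz[OF x], of "len (p n)"] by blast
      let ?m = "max n N'"
      have dz: "dist bp (z n) = len (p n)" using p len_inv[of "p n"] by (simp add: z_def len_def)
      have a: "len (p n) - ?c \<le> gp bp (z n) (z ?m)"
        using broken_gp0[OF bz, of n ?m] by (simp add: z0 dz)
      have b: "len (p n) - ?c - len x \<le> gp bp (act x (z n)) (act x (z ?m))"
        using gp_act_base_ge[OF x, of "z n" "z ?m"] a by simp
      have d: "len (p n) - ?c - len x \<le> gp bp (act x (z ?m)) (z ?m)"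
        using N'[OF max.cobounded2, of n] c0 \<delta>_nonneg len_nonneg[of x] by linarith
      have "len (p n) - ?c - len x - 2 * \<delta> \<le> gp bp (act x (z n)) (z n)"
        using hyp3[OF b d, of "z n"] a len_nonneg[of x] gp_commute[of bp "z n" "z ?m"] by linarith
      moreover have "dist bp (act x (z n)) \<le> len x + len (p n)"
        using dist_triangle[of bp "act x (z n)" "act x bp"] x dz by (simp add: len_def)
      moreover have "dist (act x (z n)) (z n) = len (p n \<otimes> x \<otimes> inv (p n))"
        using dist_act[of "p n" "z n" "act x (z n)"] p x
        by (simp add: z_def len_def act_mult dist_commute)
      ultimately show ?thesis using dist_eq_gp[of "act x (z n)" "z n" bp] dz by argo
    qed
    let ?f = "\<lambda>n. p n \<otimes> x \<otimes> inv (p n)"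
    have "finite (range ?f)"
      by (rule finite_subset[OF _ finite_ball[of "2 * ?c + 3 * len x + 4 * \<delta>"]]) (use bounded p x in auto)
    then obtain m where q: "infinite {n. ?f n = ?f m}"
      using pigeonhole_infinite[of UNIV ?f] by auto
    \<comment> \<open>Equal conjugates by \<open>p n\<close> and \<open>p m\<close> mean that
      \<open>x\<close> commutes with the quotient \<open>p (n - m)\<close>.\<close>
    have comm: "x \<otimes> p (n - m) = p (n - m) \<otimes> x" if "?f n = ?f m" "n \<ge> m" for n
    proof -
      let ?r = "p (n - m)"
      have n: "p n = p m \<otimes> ?r" using p_add[of m "n - m"] that(2) by simp
      have "p m \<otimes> ?r \<otimes> x \<otimes> inv (p m \<otimes> ?r) = p m \<otimes> x \<otimes> inv (p m)" using that(1) unfolding n .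
      then have "p m \<otimes> (?r \<otimes> x \<otimes> inv ?r) \<otimes> inv (p m) = p m \<otimes> x \<otimes> inv (p m)"
        using p x by (simp add: inv_mult_group m_assoc)
      then have "p m \<otimes> (?r \<otimes> x \<otimes> inv ?r) = p m \<otimes> x"
        using right_cancel[of "inv (p m)" "p m \<otimes> (?r \<otimes> x \<otimes> inv ?r)" "p m \<otimes> x"] p x by blast
      then have "?r \<otimes> x \<otimes> inv ?r = x" using p x Units_l_cancel[of "p m" "?r \<otimes> x \<otimes> inv ?r" x] by simp
      then have "?r \<otimes> x \<otimes> inv ?r \<otimes> ?r = x \<otimes> ?r" by simp
      then show ?thesis using p x by (simp add: m_assoc)
    qed
    show ?thesis
    proof (rule seq_equiv_frequently[OF conv_inf_act[OF x cp] cp])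
      fix M :: real and K :: nat
      obtain N' :: nat where N': "M + len x \<le> real N'" using real_arch_simple by blast
      obtain n where n: "n > m + max K N'" "?f n = ?f m"
        using q unfolding infinite_nat_iff_unbounded by auto
      let ?r = "n - m"
      have r: "?r \<ge> K" "?r \<ge> N'" using n by auto
      \<comment> \<open>By commutation \<open>x\<close> moves these arbitrarily far points of the
        positive half-axis by exactly \<open>len x\<close>, hence it fixes that end too.\<close>
      have "act x (act (p ?r) bp) = act (p ?r) (act x bp)"
        using comm[of n] n p x by (simp add: act_mult[symmetric])
      then have "dist (act x (act (p ?r) bp)) (act (p ?r) bp) = len x" using p by (simp add: len_def dist_commute)
      then have "len (p ?r) - len x \<le> gp bp (act x (act (p ?r) bp)) (act (p ?r) bp)"
        using gp_lipschitz_left[of bp "act (p ?r) bp" "act (p ?r) bp" "act x (act (p ?r) bp)"]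
        by (simp add: len_def dist_commute)
      then have "M \<le> gp bp (act x (act (p ?r) bp)) (act (p ?r) bp)"
        using lenp[of ?r] N' r(2) of_nat_mono[OF r(2), where 'a=real] by linarith
      then show "\<exists>m\<ge>K. \<exists>n\<ge>K. M \<le> gp bp (act x (act (p m) bp)) (act (p n) bp)" using r by blast
    qed
  qed
  \<comment> \<open>Take a long element pointing to neither end of the axis. As both ends are fixed,
    \<open>fix_estimate\<close> makes its inverse point to both at once, which \<open>cross\<close>
    forbids.\<close>
  obtain e E N3 where e: "\<And>n. e n \<in> carrier G" "conv_inf bp (\<lambda>n. act (e n) bp)"
    "\<And>m n. m \<ge> N3 \<Longrightarrow> n \<ge> N3 \<Longrightarrow> gp bp (act (e m) bp) (z n) \<le> E \<and> gp bp (act (e m) bp) (act (p n) bp) \<le> E"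
    using limit_point_avoiding[OF cz cp] by blast
  obtain N4 where N4: "\<And>n. n \<ge> N4 \<Longrightarrow> ?c + 1 + (E + \<delta>) + \<delta> \<le> len (e n)"
    using bdry_dist_tendsto[OF e(2)] unfolding len_def by blast
  let ?n = "max N3 N4"
  have "\<forall>m\<ge>N3. gp bp (act (e ?n) bp) (z m) \<le> E" "\<forall>m\<ge>N3. gp bp (act (e ?n) bp) (act (p m) bp) \<le> E"
    using e(3) by auto
  then obtain N5 N6 where
    5: "\<And>m. m \<ge> N5 \<Longrightarrow> len (e ?n) - (E + \<delta>) \<le> gp bp (act (inv (e ?n)) bp) (z m)" and
    6: "\<And>m. m \<ge> N6 \<Longrightarrow> len (e ?n) - (E + \<delta>) \<le> gp bp (act (inv (e ?n)) bp) (act (p m) bp)"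
    using fix_estimate[OF e(1) fixz[OF e(1)]] fix_estimate[OF e(1) fixp[OF e(1)]] by metis
  have "len (e ?n) - (E + \<delta>) - \<delta> \<le> gp bp (z N5) (act (p N6) bp)"
    using hyp_le[of "len (e ?n) - (E + \<delta>)" bp "z N5" "act (inv (e ?n)) bp" "act (p N6) bp"] 5[of N5] 6[of N6]
    by (simp add: gp_commute)
  then show False using cross[of N5 N6] N4[of ?n] by simp
qed

end

section \<open>Hausdorff content and the upper bound\<close>

lemma hausdorff_content_mono: "A \<subseteq> B \<Longrightarrow> hausdorff_content \<rho> S s d A \<le> hausdorff_content \<rho> S s d B"
  unfolding hausdorff_content_def by (rule INF_superset_mono) auto

lemma rdiam_empty [simp]: "rdiam \<rho> {} = 0"
  by (simp add: rdiam_def bot_ennreal)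

lemma rdiam_le: "(\<And>x y. x \<in> U \<Longrightarrow> y \<in> U \<Longrightarrow> \<rho> x y \<le> c) \<Longrightarrow> rdiam \<rho> U \<le> ennreal c"
  unfolding rdiam_def by (rule SUP_least) (auto intro: ennreal_leI)

lemma hausdorff_content_le_single:
  assumes "U \<subseteq> S" "rdiam \<rho> U \<le> ennreal d"
  shows "hausdorff_content \<rho> S s d U \<le> ennreal (enn2real (rdiam \<rho> U) powr s)"
proof -
  let ?V = "\<lambda>i::nat. if i = 0 then U else {}"
  have "hausdorff_content \<rho> S s d U \<le> (\<Sum>i. ennreal (enn2real (rdiam \<rho> (?V i)) powr s))"
    unfolding hausdorff_content_def by (rule INF_lower) (use assms in \<open>auto split: if_splits\<close>)
  also have "\<dots> = (\<Sum>i\<in>{0}. ennreal (enn2real (rdiam \<rho> (?V i)) powr s))"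
    by (rule suminf_finite) auto
  finally show ?thesis by simp
qed

lemma hausdorff_content_empty: "hausdorff_content \<rho> S s d {} = 0"
  using hausdorff_content_le_single[of "{}" S \<rho> d s] by simp

lemma hausdorff_content_UN:
  "hausdorff_content \<rho> S s d (\<Union>i::nat. A i) \<le> (\<Sum>i. hausdorff_content \<rho> S s d (A i))"
proof (cases "\<exists>i. hausdorff_content \<rho> S s d (A i) = \<infinity>")
  case True
  then obtain i where "hausdorff_content \<rho> S s d (A i) = \<infinity>" ..
  moreover have "hausdorff_content \<rho> S s d (A i) \<le> (\<Sum>i. hausdorff_content \<rho> S s d (A i))"
    using sum_le_suminf[of "\<lambda>i. hausdorff_content \<rho> S s d (A i)" "{i}"] by simp
  ultimately show ?thesis by (simp add: top_unique)
next
  case False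
  let ?h = "hausdorff_content \<rho> S s d"
  let ?f = "\<lambda>U. ennreal (enn2real (rdiam \<rho> U) powr s)"
  show ?thesis
  proof (rule ennreal_le_epsilon)
    fix e :: real assume e: "e > 0"
    have "\<exists>U. A i \<subseteq> (\<Union>j. U j) \<and> (\<forall>j::nat. U j \<subseteq> S \<and> rdiam \<rho> (U j) \<le> ennreal d) \<and>
        (\<Sum>j. ?f (U j)) \<le> ?h (A i) + ennreal (e * (1/2) ^ Suc i)" for i
    proof -
      have "\<exists>U\<in>{U. A i \<subseteq> (\<Union>j. U j) \<and> (\<forall>j::nat. U j \<subseteq> S \<and> rdiam \<rho> (U j) \<le> ennreal d)}.
          (\<Sum>j. ?f (U j)) < ?h (A i) + ennreal (e * (1/2) ^ Suc i)"
        using False e by (intro INF_approx_ennreal) (auto simp: hausdorff_content_def)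
      then show ?thesis by (auto intro: less_imp_le)
    qed
    then obtain U where U: "\<And>i. A i \<subseteq> (\<Union>j. U i j)" "\<And>i j::nat. U i j \<subseteq> S \<and> rdiam \<rho> (U i j) \<le> ennreal d"
       "\<And>i. (\<Sum>j. ?f (U i j)) \<le> ?h (A i) + ennreal (e * (1/2) ^ Suc i)" by metis
    define V where "V n = (\<lambda>(i, j). U i j) (prod_decode n)" for n
    have "(\<Union>i. A i) \<subseteq> (\<Union>n. V n)"
    proof
      fix a assume "a \<in> (\<Union>i. A i)"
      then obtain i j where "a \<in> U i j" using U(1) by blast
      then have "a \<in> V (prod_encode (i, j))" by (simp add: V_def)
      then show "a \<in> (\<Union>n. V n)" by blast
    qed
    then have "V \<in> {W. (\<Union>i. A i) \<subseteq> (\<Union>n. W n) \<and> (\<forall>n. W n \<subseteq> S \<and> rdiam \<rho> (W n) \<le> ennreal d)}"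
      using U(2) by (auto simp: V_def case_prod_beta)
    then have "?h (\<Union>i. A i) \<le> (\<Sum>n. ?f (V n))"
      unfolding hausdorff_content_def by (rule INF_lower)
    also have "\<dots> = (\<Sum>n. (\<lambda>(i, j). ?f (U i j)) (prod_decode n))" by (simp add: V_def case_prod_beta)
    also have "\<dots> = (\<Sum>i. \<Sum>j. ?f (U i j))" by (rule suminf_ennreal_2dimen) auto
    also have "\<dots> \<le> (\<Sum>i. ?h (A i) + ennreal (e * (1/2) ^ Suc i))" by (intro suminf_le U) auto
    also have "\<dots> = (\<Sum>i. ?h (A i)) + (\<Sum>i. ennreal (e * (1/2) ^ Suc i))" by (rule suminf_add[symmetric]) auto
    also have "(\<Sum>i. ennreal (e * (1/2) ^ Suc i)) = ennreal e"
      using sums_mult[OF power_half_series, of e] e by (intro suminf_ennreal_eq) auto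
    finally show "?h (\<Union>i. A i) \<le> (\<Sum>i. ?h (A i)) + ennreal e" .
  qed
qed

lemma hausdorff_content_Un:
  "hausdorff_content \<rho> S s d (A \<union> B) \<le> hausdorff_content \<rho> S s d A + hausdorff_content \<rho> S s d B"
proof -
  let ?V = "\<lambda>i::nat. if i = 0 then A else if i = 1 then B else {}"
  have "(\<Union>i. ?V i) = A \<union> B" by (auto split: if_splits)
  then have "hausdorff_content \<rho> S s d (A \<union> B) \<le> (\<Sum>i. hausdorff_content \<rho> S s d (?V i))"
    using hausdorff_content_UN[of \<rho> S s d ?V] by simp
  also have "\<dots> = (\<Sum>i\<in>{0, 1}. hausdorff_content \<rho> S s d (?V i))"
    by (rule suminf_finite) (auto simp: hausdorff_content_empty)
  finally show ?thesis by simp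
qed

lemma hausdorff_content_finite_UN:
  "finite I \<Longrightarrow> hausdorff_content \<rho> S s d (\<Union>i\<in>I. A i) \<le> (\<Sum>i\<in>I. hausdorff_content \<rho> S s d (A i))"
proof (induction I rule: finite_induct)
  case (insert i I)
  have "hausdorff_content \<rho> S s d (A i \<union> (\<Union>i\<in>I. A i)) \<le>
      hausdorff_content \<rho> S s d (A i) + hausdorff_content \<rho> S s d (\<Union>i\<in>I. A i)"
    by (rule hausdorff_content_Un)
  also have "\<dots> \<le> hausdorff_content \<rho> S s d (A i) + (\<Sum>i\<in>I. hausdorff_content \<rho> S s d (A i))"
    by (rule add_left_mono) (rule insert.IH)
  finally show ?case using insert by simp
qed (simp add: hausdorff_content_empty)

lemma hausdorff_dim_mono: "A \<subseteq> B \<Longrightarrow> hausdorff_dim \<rho> S A \<le> hausdorff_dim \<rho> S B"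
proof -
  assume "A \<subseteq> B"
  then have "hausdorff_measure \<rho> S s A \<le> hausdorff_measure \<rho> S s B" for s
    unfolding hausdorff_measure_def by (intro SUP_mono' hausdorff_content_mono)
  then show ?thesis unfolding hausdorff_dim_def
    by (intro INF_superset_mono) (auto, metis le_zero_eq)
qed

lemma hausdorff_dim_le:
  "0 \<le> s \<Longrightarrow> (\<And>d. d > 0 \<Longrightarrow> hausdorff_content \<rho> S s d A = 0) \<Longrightarrow> hausdorff_dim \<rho> S A \<le> ereal s"
  unfolding hausdorff_dim_def hausdorff_measure_def by (rule INF_lower) (auto intro!: SUP_eq_const)

text \<open>At scale 1 all diameters of a cover are at most 1, where larger exponents give smaller
  powers.\<close>

lemma hausdorff_content_antimono_exponent:
  assumes "t \<le> t'"
  shows "hausdorff_content \<rho> S t' 1 A \<le> hausdorff_content \<rho> S t 1 A"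
  unfolding hausdorff_content_def
proof (rule INF_mono)
  fix U assume U: "U \<in> {U. A \<subseteq> \<Union> (range U) \<and> (\<forall>i::nat. U i \<subseteq> S \<and> rdiam \<rho> (U i) \<le> ennreal 1)}"
  have "enn2real (rdiam \<rho> (U i)) powr t' \<le> enn2real (rdiam \<rho> (U i)) powr t" for i
    using U assms by (intro powr_mono') (auto intro: enn2real_leI)
  then have "(\<Sum>i. ennreal (enn2real (rdiam \<rho> (U i)) powr t')) \<le> (\<Sum>i. ennreal (enn2real (rdiam \<rho> (U i)) powr t))"
    by (intro suminf_le ennreal_leI) auto
  then show "\<exists>V\<in>{U. A \<subseteq> \<Union> (range U) \<and> (\<forall>i::nat. U i \<subseteq> S \<and> rdiam \<rho> (U i) \<le> ennreal 1)}.
      (\<Sum>i. ennreal (enn2real (rdiam \<rho> (V i)) powr t')) \<le> (\<Sum>i. ennreal (enn2real (rdiam \<rho> (U i)) powr t))"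
    using U by blast
qed

lemma hausdorff_dim_ge:
  assumes "\<And>t. 0 < t \<Longrightarrow> t < s \<Longrightarrow> 0 < hausdorff_content \<rho> S t 1 A"
  shows "ereal s \<le> hausdorff_dim \<rho> S A"
  unfolding hausdorff_dim_def
proof (rule INF_greatest)
  fix t assume "t \<in> {t. 0 \<le> t \<and> hausdorff_measure \<rho> S t A = 0}"
  then have t: "0 \<le> t" "hausdorff_measure \<rho> S t A = 0" by auto
  have "hausdorff_content \<rho> S t 1 A \<le> hausdorff_measure \<rho> S t A"
    unfolding hausdorff_measure_def by (rule SUP_upper) simp
  then have 0: "hausdorff_content \<rho> S t 1 A = 0" using t(2) by simp
  show "ereal s \<le> ereal t"
  proof (rule ccontr)
    assume "\<not> ereal s \<le> ereal t"
    \<comment> \<open>\<open>t\<close> may be 0, where the assumption says nothing; an exponent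
      strictly between \<open>t\<close> and \<open>s\<close> is positive.\<close>
    then obtain t' where t': "t < t'" "t' < s" using dense[of t s] by auto
    then show False
      using assms[of t'] t(1) 0 hausdorff_content_antimono_exponent[of t t' \<rho> S A] by simp
  qed
qed

section \<open>Annuli and shadows of orbit points\<close>

locale visual_action = visual_space bp \<delta> \<epsilon> \<rho> + hyperbolic_action bp \<delta> G act
  for bp :: "'a::metric_space" and \<delta> \<epsilon> \<rho> and G (structure) and act :: "'b \<Rightarrow> 'a \<Rightarrow> 'a"
begin

definition annulus :: "nat \<Rightarrow> 'b set" where
  "annulus j = {g \<in> carrier G. real j \<le> len g \<and> len g < real j + 1}"

lemma finite_annulus: "finite (annulus j)"
  by (rule finite_subset[OF _ finite_ball[of "real j + 1"]]) (auto simp: annulus_def)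

definition shadow :: "'b \<Rightarrow> real \<Rightarrow> (nat \<Rightarrow> 'a) set set" where
  "shadow g R = {\<xi> \<in> bdry bp. \<exists>\<gamma> s. geodesic_ray \<gamma> \<and> \<gamma> 0 = bp \<and> (\<lambda>n. \<gamma> (real n)) \<in> \<xi> \<and>
     0 \<le> s \<and> dist (act g bp) (\<gamma> s) \<le> R}"

text \<open>Two rays passing within \<open>R\<close> of \<open>act g bp\<close> have a product of at
  least \<open>len g - 2 * R\<close> there, and going further out along the rays loses at most
  \<open>2 * \<delta>\<close> of it.\<close>

lemma shadow_diam:
  assumes "0 \<le> R"
  shows "\<exists>K>0. \<forall>g. rdiam \<rho> (shadow g R) \<le> ennreal (K * exp (- \<epsilon> * len g))"
proof -
  obtain C where C: "C > 0" "\<forall>\<xi>\<in>bdry bp. \<forall>\<eta>\<in>bdry bp. \<forall>x\<in>\<xi>. \<forall>y\<in>\<eta>. \<forall>D.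
     (\<forall>N. \<exists>m\<ge>N. \<exists>n\<ge>N. D \<le> gp bp (x m) (y n)) \<longrightarrow> \<rho> \<xi> \<eta> \<le> C * exp (- \<epsilon> * D)"
    using rho_upper by blast
  have "\<rho> \<xi> \<eta> \<le> C * exp (\<epsilon> * (2 * R + 2 * \<delta>)) * exp (- \<epsilon> * len g)"
    if \<xi>: "\<xi> \<in> shadow g R" and \<eta>: "\<eta> \<in> shadow g R" for \<xi> \<eta> g
  proof -
    obtain \<gamma> s where g: "geodesic_ray \<gamma>" "\<gamma> 0 = bp" "(\<lambda>n. \<gamma> (real n)) \<in> \<xi>" "0 \<le> s" "dist (act g bp) (\<gamma> s) \<le> R"
      and \<xi>b: "\<xi> \<in> bdry bp" using \<xi> by (auto simp: shadow_def)
    obtain \<gamma>' s' where g': "geodesic_ray \<gamma>'" "\<gamma>' 0 = bp" "(\<lambda>n. \<gamma>' (real n)) \<in> \<eta>" "0 \<le> s'" "dist (act g bp) (\<gamma>' s') \<le> R"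
      and \<eta>b: "\<eta> \<in> bdry bp" using \<eta> by (auto simp: shadow_def)
    have r: "dist (\<gamma> a) (\<gamma> b) = \<bar>a - b\<bar>" "dist (\<gamma>' a) (\<gamma>' b) = \<bar>a - b\<bar>" if "0 \<le> a" "0 \<le> b" for a b
      using g(1) g'(1) that by (auto simp: geodesic_ray_def)
    have d: "dist bp (\<gamma> a) = a" "dist bp (\<gamma>' a) = a" if "0 \<le> a" for a
      using r[of 0 a] that g(2) g'(2) by auto
    have s: "len g - R \<le> s" "len g - R \<le> s'"
      using dist_triangle[of bp "act g bp" "\<gamma> s"] dist_triangle[of bp "act g bp" "\<gamma>' s'"] d g g'
      by (auto simp: len_def dist_commute)
    have mid: "len g - 2 * R \<le> gp bp (\<gamma> s) (\<gamma>' s')"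
      using s d[OF g(4)] d[OF g'(4)] g(5) g'(5) dist_triangle[of "\<gamma> s" "\<gamma>' s'" "act g bp"]
      by (simp add: gromov_prod_def dist_commute)
    have ext: "gp bp (\<gamma> (real n)) (\<gamma> s) = s" "gp bp (\<gamma>' s') (\<gamma>' (real m)) = s'"
      if "s \<le> real n" "s' \<le> real m" for n m
      using that g(4) g'(4) r d by (auto simp: gromov_prod_def)
    have "len g - 2 * R - 2 * \<delta> \<le> gp bp (\<gamma> (real n)) (\<gamma>' (real n))" if "max s s' \<le> real n" for n
      using hyp3[of "len g - 2 * R" bp "\<gamma> (real n)" "\<gamma> s" "\<gamma>' s'" "\<gamma>' (real n)"] mid ext[of n n] that s assms by auto
    moreover have "\<exists>n\<ge>N. max s s' \<le> real n" for N
      by (meson nle_le of_nat_le_iff order_trans real_arch_simple)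
    ultimately have "\<forall>N. \<exists>m\<ge>N. \<exists>n\<ge>N. len g - 2 * R - 2 * \<delta> \<le> gp bp (\<gamma> (real m)) (\<gamma>' (real n))" by blast
    then have "\<rho> \<xi> \<eta> \<le> C * exp (- \<epsilon> * (len g - 2 * R - 2 * \<delta>))"
      using C(2)[THEN bspec, OF \<xi>b, THEN bspec, OF \<eta>b, THEN bspec, OF g(3), THEN bspec, OF g'(3)] by blast
    also have "\<dots> = C * exp (\<epsilon> * (2 * R + 2 * \<delta>)) * exp (- \<epsilon> * len g)"
      by (simp add: exp_add[symmetric] algebra_simps)
    finally show ?thesis .
  qed
  then show ?thesis using C(1)
    by (intro exI[of _ "C * exp (\<epsilon> * (2 * R + 2 * \<delta>))"]) (auto intro!: rdiam_le)
qed

text \<open>Rounding the radius up to a natural number makes the union countable; the orbit points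
  near the ray have unbounded length because they converge to the boundary.\<close>

lemma conical_subset_shadows:
  "conical_limit_set G act bp \<subseteq> (\<Union>R::nat. {\<xi>. \<forall>n. \<exists>g\<in>carrier G. real n \<le> len g \<and> \<xi> \<in> shadow g (real R)})"
proof
  fix \<xi> assume "\<xi> \<in> conical_limit_set G act bp"
  then obtain g R \<gamma> where g: "\<And>n. g n \<in> carrier G" "geodesic_ray \<gamma>" "\<gamma> 0 = bp" "(\<lambda>n. \<gamma> (real n)) \<in> \<xi>"
    "(\<lambda>n. act (g n) bp) \<in> \<xi>" "\<And>n. infdist (act (g n) bp) (\<gamma> ` {0..}) \<le> R" and \<xi>: "\<xi> \<in> bdry bp"
    unfolding conical_limit_set_def limit_set_def by blast
  obtain R' :: nat where R': "R + 1 \<le> real R'" using real_arch_simple by blast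
  have "\<xi> \<in> shadow (g n) (real R')" for n
  proof -
    have "(INF a\<in>\<gamma> ` {0..}. dist (act (g n) bp) a) < R + 1"
      using g(6)[of n] by (simp add: infdist_def)
    then obtain s where "0 \<le> s" "dist (act (g n) bp) (\<gamma> s) < R + 1"
      by (subst (asm) cINF_less_iff) auto
    then show ?thesis using g \<xi> R' unfolding shadow_def by force
  qed
  moreover have "\<exists>m. real n \<le> len (g m)" for n
    using bdry_dist_tendsto[OF bdry_conv[OF \<xi> g(5)]] unfolding len_def by blast
  ultimately have "\<exists>h\<in>carrier G. real n \<le> len h \<and> \<xi> \<in> shadow h (real R')" for n
    using g(1) by metis
  then show "\<xi> \<in> (\<Union>R::nat. {\<xi>. \<forall>n. \<exists>g\<in>carrier G. real n \<le> len g \<and> \<xi> \<in> shadow g (real R)})"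
    by (intro UN_I[of R'] CollectI allI) auto
qed

lemma crit_exp_eq: "crit_exp G act bp = limsup (\<lambda>n. ereal (ln (real (card {g \<in> carrier G. len g \<le> real n})) / real n))"
  by (simp add: crit_exp_def len_def)

lemma card_ball_ge_1: "1 \<le> card {g \<in> carrier G. len g \<le> real n}"
proof -
  have "\<one> \<in> {g \<in> carrier G. len g \<le> real n}" by (simp add: len_def)
  then show ?thesis using finite_ball[of "real n"] by (metis Suc_leI card_gt_0_iff empty_iff One_nat_def)
qed

lemma crit_exp_nonneg: "0 \<le> crit_exp G act bp"
  unfolding crit_exp_eq
proof (rule le_Limsup)
  show "\<forall>\<^sub>F n in sequentially. 0 \<le> ereal (ln (real (card {g \<in> carrier G. len g \<le> real n})) / real n)"
    using card_ball_ge_1 by (intro always_eventually allI) (simp add: ln_ge_zero)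
qed simp

lemma annulus_growth:
  assumes "crit_exp G act bp < ereal s"
  shows "\<exists>N. \<forall>j\<ge>N. real (card (annulus j)) \<le> exp (s * (real j + 1))"
proof -
  have "eventually (\<lambda>n. ereal (ln (real (card {g \<in> carrier G. len g \<le> real n})) / real n) < ereal s) sequentially"
    using assms unfolding crit_exp_eq by (rule Limsup_lessD)
  then obtain N where N: "\<And>n. n \<ge> N \<Longrightarrow> ln (real (card {g \<in> carrier G. len g \<le> real n})) / real n < s"
    by (auto simp: eventually_sequentially)
  have "real (card (annulus j)) \<le> exp (s * (real j + 1))" if "j \<ge> N" for j
  proof -
    let ?B = "{g \<in> carrier G. len g \<le> real (Suc j)}"
    have 1: "card (annulus j) \<le> card ?B"
      by (rule card_mono[OF finite_ball]) (auto simp: annulus_def)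
    have 2: "ln (real (card ?B)) < s * real (Suc j)"
      using N[of "Suc j"] that by (simp add: divide_less_eq del: of_nat_Suc)
    have 3: "real (card ?B) = exp (ln (real (card ?B)))"
      using card_ball_ge_1[of "Suc j"] by simp
    have "exp (ln (real (card ?B))) \<le> exp (s * real (Suc j))" using 2 by (simp only: exp_le_cancel_iff)
    then have "real (card (annulus j)) \<le> exp (s * real (Suc j))"
      using of_nat_mono[OF 1, where 'a=real] 3 by linarith
    then show ?thesis by (simp add: add.commute)
  qed
  then show ?thesis by blast
qed

text \<open>A Borel-Cantelli argument. The shadows of annulus \<open>j\<close> contribute at most a
  constant times exp ((s - \<epsilon> t) j), and the set is covered by every tail of this convergent
  geometric series.\<close>

lemma content_shadows_zero:
  assumes "crit_exp G act bp < ereal s" "s < \<epsilon> * t" "0 < t" "0 \<le> R" "0 < d"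
  shows "hausdorff_content \<rho> (bdry bp) t d {\<xi>. \<forall>n. \<exists>g\<in>carrier G. real n \<le> len g \<and> \<xi> \<in> shadow g R} = 0"
proof -
  let ?h = "hausdorff_content \<rho> (bdry bp) t d"
  let ?A = "{\<xi>. \<forall>n. \<exists>g\<in>carrier G. real n \<le> len g \<and> \<xi> \<in> shadow g R}"
  obtain K where K: "K > 0" "\<And>g. rdiam \<rho> (shadow g R) \<le> ennreal (K * exp (- \<epsilon> * len g))"
    using shadow_diam[OF assms(4)] by blast
  obtain N1 where N1: "\<And>j. j \<ge> N1 \<Longrightarrow> real (card (annulus j)) \<le> exp (s * (real j + 1))"
    using annulus_growth[OF assms(1)] by blast
  have "(\<lambda>n. K * exp (- \<epsilon> * real n)) \<longlonglongrightarrow> 0" using \<epsilon>_pos by real_asymp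
  then have "eventually (\<lambda>n. K * exp (- \<epsilon> * real n) < d) sequentially"
    using assms(5) by (rule order_tendstoD)
  then obtain N2 where N2: "\<And>n. n \<ge> N2 \<Longrightarrow> K * exp (- \<epsilon> * real n) < d"
    by (auto simp: eventually_sequentially)
  define q where "q = exp (s - \<epsilon> * t)"
  have q: "0 < q" "q < 1" using assms(2) by (simp_all add: q_def)
  define f where "f j = K powr t * exp s * q ^ j" for j :: nat
  have sf: "summable f" unfolding f_def using q by (intro summable_mult summable_geometric) simp
  have f0: "0 \<le> f j" for j unfolding f_def using q by simp
  have ann: "?h (\<Union>g\<in>annulus j. shadow g R) \<le> ennreal (f j)" if j: "j \<ge> max N1 N2" for j
  proof -
    have "?h (shadow g R) \<le> ennreal ((K * exp (- \<epsilon> * real j)) powr t)" if g: "g \<in> annulus j" for g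
    proof -
      have le: "rdiam \<rho> (shadow g R) \<le> ennreal (K * exp (- \<epsilon> * real j))"
        using K(2)[of g] by (rule order_trans) (use g K(1) \<epsilon>_pos in \<open>auto simp: annulus_def intro!: ennreal_leI\<close>)
      also have "\<dots> \<le> ennreal d" using N2[of j] j by (intro ennreal_leI) auto
      finally have "?h (shadow g R) \<le> ennreal (enn2real (rdiam \<rho> (shadow g R)) powr t)"
        by (intro hausdorff_content_le_single) (auto simp: shadow_def)
      also have "\<dots> \<le> ennreal ((K * exp (- \<epsilon> * real j)) powr t)"
        using le K(1) assms(3) by (intro ennreal_leI powr_mono2 enn2real_leI) auto
      finally show ?thesis .
    qed
    then have "(\<Sum>g\<in>annulus j. ?h (shadow g R)) \<le> (\<Sum>g\<in>annulus j. ennreal ((K * exp (- \<epsilon> * real j)) powr t))"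
      by (rule sum_mono)
    also have "\<dots> = ennreal (real (card (annulus j)) * (K * exp (- \<epsilon> * real j)) powr t)"
      by (simp add: ennreal_of_nat_eq_real_of_nat ennreal_mult)
    also have "\<dots> \<le> ennreal (exp (s * (real j + 1)) * (K * exp (- \<epsilon> * real j)) powr t)"
      using N1[of j] j by (intro ennreal_leI mult_right_mono) auto
    also have "exp (s * (real j + 1)) * (K * exp (- \<epsilon> * real j)) powr t = f j"
    proof -
      have "(K * exp (- \<epsilon> * real j)) powr t = K powr t * exp (- \<epsilon> * real j * t)"
        using K(1) by (simp add: powr_mult) (simp add: powr_def mult.commute)
      moreover have "q ^ j = exp (real j * (s - \<epsilon> * t))" unfolding q_def by (rule exp_of_nat_mult[symmetric])
      ultimately show ?thesis unfolding f_def by (simp add: exp_add[symmetric] algebra_simps)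
    qed
    finally show ?thesis by (rule order_trans[OF hausdorff_content_finite_UN[OF finite_annulus]])
  qed
  have bound: "?h ?A \<le> ennreal (\<Sum>j. f (j + n))" if n: "n \<ge> max N1 N2" for n
  proof -
    have "?A \<subseteq> (\<Union>j. \<Union>g\<in>annulus (j + n). shadow g R)"
    proof
      fix \<xi> assume "\<xi> \<in> ?A"
      then obtain g where g: "g \<in> carrier G" "real n \<le> len g" "\<xi> \<in> shadow g R" by blast
      have "nat \<lfloor>len g\<rfloor> \<ge> n" using g(2) by (simp add: le_nat_floor)
      moreover have "g \<in> annulus (nat \<lfloor>len g\<rfloor>)"
        using g(1) len_nonneg[of g] unfolding annulus_def by auto
      ultimately have "g \<in> annulus ((nat \<lfloor>len g\<rfloor> - n) + n)" by simp
      then show "\<xi> \<in> (\<Union>j. \<Union>g\<in>annulus (j + n). shadow g R)" using g(3) by blast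
    qed
    then have "?h ?A \<le> ?h (\<Union>j. \<Union>g\<in>annulus (j + n). shadow g R)" by (rule hausdorff_content_mono)
    also have "\<dots> \<le> (\<Sum>j. ?h (\<Union>g\<in>annulus (j + n). shadow g R))" by (rule hausdorff_content_UN)
    also have "\<dots> \<le> (\<Sum>j. ennreal (f (j + n)))" using n by (intro suminf_le ann) auto
    also have "\<dots> = ennreal (\<Sum>j. f (j + n))"
      using sf f0 by (intro suminf_ennreal2) (auto simp: summable_iff_shift)
    finally show ?thesis .
  qed
  show ?thesis
  proof (rule ccontr)
    assume "?h ?A \<noteq> 0"
    then have pos: "0 < ?h ?A" by (simp add: zero_less_iff_neq_zero)
    have fin: "?h ?A < \<infinity>" using bound[OF order_refl] by (rule order_le_less_trans) simp
    have "0 < enn2real (?h ?A)" using pos fin by (simp add: enn2real_positive_iff)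
    then obtain M where M: "\<And>n. n \<ge> M \<Longrightarrow> norm (\<Sum>i. f (i + n)) < enn2real (?h ?A)"
      using suminf_exist_split[OF _ sf] by blast
    let ?n = "max M (max N1 N2)"
    have "enn2real (?h ?A) \<le> (\<Sum>j. f (j + ?n))"
      using bound[of ?n] f0 sf by (intro enn2real_leI suminf_nonneg) (auto simp: summable_iff_shift)
    then show False using M[of ?n] by auto
  qed
qed

lemma dim_conical_le:
  "hausdorff_dim \<rho> (bdry bp) (conical_limit_set G act bp) \<le> crit_exp G act bp / ereal \<epsilon>"
proof (rule dense_ge)
  fix z assume z: "crit_exp G act bp / ereal \<epsilon> < z"
  show "hausdorff_dim \<rho> (bdry bp) (conical_limit_set G act bp) \<le> z"
  proof (cases z)
    case (real t)
    have "crit_exp G act bp < ereal (t * \<epsilon>)"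
      using z \<epsilon>_pos ereal_divide_less_iff[of "ereal \<epsilon>" "crit_exp G act bp" z] unfolding real by simp
    then obtain s where s: "crit_exp G act bp < ereal s" "ereal s < ereal (t * \<epsilon>)"
      \<comment> \<open>An exponent strictly in between gives both the growth bound and a geometric
        series with ratio below 1.\<close>
      using ereal_dense2 by blast
    have s': "0 < s" using crit_exp_nonneg s(1) by (metis ereal_less(2) order_le_less_trans)
    then have "0 < t * \<epsilon>" using s(2) by simp
    then have t: "0 < t" using \<epsilon>_pos by (simp add: zero_less_mult_iff)
    have "hausdorff_content \<rho> (bdry bp) t d (conical_limit_set G act bp) = 0" if d: "d > 0" for d
    proof -
      let ?A = "\<lambda>R::nat. {\<xi>. \<forall>n. \<exists>g\<in>carrier G. real n \<le> len g \<and> \<xi> \<in> shadow g (real R)}"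
      have "hausdorff_content \<rho> (bdry bp) t d (conical_limit_set G act bp) \<le> hausdorff_content \<rho> (bdry bp) t d (\<Union>R. ?A R)"
        by (rule hausdorff_content_mono[OF conical_subset_shadows])
      also have "\<dots> \<le> (\<Sum>R. hausdorff_content \<rho> (bdry bp) t d (?A R))" by (rule hausdorff_content_UN)
      also have "\<dots> = 0"
        using content_shadows_zero[OF s(1) _ t _ d] s(2) by (simp add: mult.commute)
      finally show ?thesis by simp
    qed
    then show ?thesis unfolding real using t by (intro hausdorff_dim_le) auto
  qed (use z in auto)
qed

end

section \<open>Myrberg points are conical; growth and directions\<close>

context visual_action
begin

text \<open>The definitions of the conical sets ask for a positive radius, hence
  \<open>R + 1\<close>.\<close>

lemma conicalI:
  assumes \<xi>: "\<xi> \<in> bdry bp" and q: "\<And>n. q n \<in> carrier G" "(\<lambda>n. act (q n) bp) \<in> \<xi>"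
    and \<gamma>: "geodesic_ray \<gamma>" "\<gamma> 0 = bp" "(\<lambda>n. \<gamma> (real n)) \<in> \<xi>"
    and R: "\<And>n. dist (act (q n) bp) (\<gamma> (len (q n))) \<le> R"
  shows "\<xi> \<in> limit_set G act bp" "0 < R + 1" "infdist (act (q n) bp) (\<gamma> ` {0..}) \<le> R + 1"
proof -
  show "\<xi> \<in> limit_set G act bp" using \<xi> q unfolding limit_set_def by blast
  have "0 \<le> R" using R zero_le_dist order_trans by blast
  then show "0 < R + 1" by simp
  have "infdist (act (q n) bp) (\<gamma> ` {0..}) \<le> dist (act (q n) bp) (\<gamma> (len (q n)))"
    by (rule infdist_le) simp
  then show "infdist (act (q n) bp) (\<gamma> ` {0..}) \<le> R + 1" using R[of n] by linarith
qed

lemma myrberg_subset_conical: "myrberg_limit_set G act bp \<rho> \<subseteq> conical_limit_set G act bp"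
proof
  fix \<xi> assume \<xi>m: "\<xi> \<in> myrberg_limit_set G act bp \<rho>"
  then have \<xi>: "\<xi> \<in> bdry bp" by (auto simp: myrberg_limit_set_def limit_set_def)
  obtain a b where ab: "a \<in> limit_set G act bp" "b \<in> limit_set G act bp" "a \<noteq> b"
    using nonelementary unfolding non_elementary_def by blast
  then have abb: "a \<in> bdry bp" "b \<in> bdry bp" by (auto simp: limit_set_def)
  obtain g where g: "\<And>n. g n \<in> carrier G" "(\<lambda>n. act (g n) bp) \<in> a"
    "(\<lambda>n. \<rho> (bdry_act act (g n) \<xi>) b) \<longlonglongrightarrow> 0"
    using \<xi>m ab unfolding myrberg_limit_set_def by blast
  obtain x where x: "x \<in> \<xi>" using bdry_nonempty \<xi> by blast
  obtain y where y: "y \<in> b" using bdry_nonempty abb by blast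
  have cg: "conv_inf bp (\<lambda>n. act (g n) bp)" using bdry_conv abb(1) g(2) by blast
  have cy: "conv_inf bp y" using bdry_conv abb(2) y by blast
  obtain \<gamma> where \<gamma>: "geodesic_ray \<gamma>" "\<gamma> 0 = bp" "(\<lambda>n. \<gamma> (real n)) \<in> \<xi>" using ray_exists[OF \<xi>] by blast
  obtain D N0 where D: "\<And>m n. m \<ge> N0 \<Longrightarrow> n \<ge> N0 \<Longrightarrow> gp bp (act (g m) bp) (y n) \<le> D"
    using not_equiv_bound[OF cg cy] bdry_eqI[OF abb g(2) y] ab(3) by blast
  have D0: "0 \<le> D" using D[of N0 N0] gp_nonneg order_trans by blast
  define c where "c = D + \<delta>"
  have c0: "0 \<le> c" using D0 \<delta>_nonneg by (simp add: c_def)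
  from rho_lower obtain C where C': "0 < C \<and> (\<forall>\<xi>\<in>bdry bp. \<forall>\<eta>\<in>bdry bp. \<forall>x\<in>\<xi>. \<forall>y\<in>\<eta>. \<forall>D. \<xi> \<noteq> \<eta> \<longrightarrow>
     (\<forall>N. \<exists>m\<ge>N. \<exists>n\<ge>N. gp bp (x m) (y n) \<le> D) \<longrightarrow> C * exp (- \<epsilon> * D) \<le> \<rho> \<xi> \<eta>)" ..
  note C = C'[THEN conjunct1] C'[THEN conjunct2]
  \<comment> \<open>Below this threshold \<open>rho_lower\<close> rules out arbitrarily late
    products of size at most \<open>c + 1\<close>, so from \<open>N1\<close> on the translates of
    \<open>x\<close> point towards \<open>b\<close>.\<close>
  have "0 < C * exp (- \<epsilon> * (c + 1))" using C(1) by simp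
  then have "eventually (\<lambda>n. \<rho> (bdry_act act (g n) \<xi>) b < C * exp (- \<epsilon> * (c + 1))) sequentially"
    using order_tendstoD(2)[OF g(3)] by blast
  then obtain N1 where N1: "\<And>n. n \<ge> N1 \<Longrightarrow> \<rho> (bdry_act act (g n) \<xi>) b < C * exp (- \<epsilon> * (c + 1))"
    by (auto simp: eventually_sequentially)
  define q where "q n = inv (g (n + max N0 N1))" for n
  have qG: "q n \<in> carrier G" for n using g(1) by (simp add: q_def)
  have far: "\<exists>M. \<forall>m\<ge>M. c + 1 < gp bp (act (g n) (x m)) (y m)" if n: "n \<ge> N1" for n
  proof -
    have gx: "(\<lambda>m. act (g n) (x m)) \<in> bdry_act act (g n) \<xi>" by (rule bdry_act_mem[OF x])
    have gb: "bdry_act act (g n) \<xi> \<in> bdry bp" by (rule bdry_act_in[OF g(1) \<xi>])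
    show ?thesis
    proof (cases "bdry_act act (g n) \<xi> = b")
      case True
      then show ?thesis
        using seq_equivD[OF bdry_equiv[OF abb(2) _ y], of "\<lambda>m. act (g n) (x m)" "c + 2"] gx
        by (metis add_strict_left_mono one_less_numeral_iff order_less_le_trans semiring_norm(76))
    next
      case False
      show ?thesis
      proof (rule ccontr)
        assume "\<not> ?thesis"
        then have "\<forall>N. \<exists>m\<ge>N. \<exists>k\<ge>N. gp bp (act (g n) (x m)) (y k) \<le> c + 1" by (meson not_le_imp_less)
        then have "C * exp (- \<epsilon> * (c + 1)) \<le> \<rho> (bdry_act act (g n) \<xi>) b"
          using C(2)[THEN bspec, OF gb, THEN bspec, OF abb(2), THEN bspec, OF gx, THEN bspec, OF y] False by blast
        then show False using N1[OF n] by linarith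
      qed
    qed
  qed
  \<comment> \<open>\<open>act ?k bp\<close> is transverse to \<open>b\<close>, hence to the
    translate of \<open>x\<close> by \<open>?k\<close>. Translating back by \<open>q n\<close>, the
    inverse of \<open>?k\<close>, places \<open>act (q n) bp\<close> almost on the way to
    \<xi>.\<close>
  have near: "\<exists>M. \<forall>m\<ge>M. len (q n) - c \<le> gp bp (act (q n) bp) (x m)" for n
  proof -
    let ?k = "g (n + max N0 N1)"
    obtain M where M: "\<And>m. m \<ge> M \<Longrightarrow> c + 1 < gp bp (act ?k (x m)) (y m)"
      using far[of "n + max N0 N1"] by (meson max.cobounded2 trans_le_add2)
    have "len (q n) - c \<le> gp bp (act (q n) bp) (x m)" if m: "m \<ge> max M N0" for m
    proof -
      have "gp bp (act ?k bp) (y m) \<le> D" using D m by auto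
      then have 1: "gp bp (act ?k bp) (act ?k (x m)) \<le> c"
        using hyp_or_le[of bp "act ?k bp" "y m" D "act ?k (x m)"] M[of m] m by (auto simp: c_def)
      have "gp bp (act (q n) bp) (x m) = gp (act ?k bp) bp (act ?k (x m))"
        using gp_act[of ?k bp "act (q n) bp" "x m"] g(1) by (simp add: q_def del: gp_act)
      moreover have "len (q n) = len ?k" using g(1) by (simp add: q_def)
      ultimately show ?thesis using gp_add[of "act ?k bp" bp "act ?k (x m)"] 1 by (simp add: len_def)
    qed
    then show ?thesis by blast
  qed
  have R: "dist (act (q n) bp) (\<gamma> (len (q n))) \<le> 2 * c + 4 * \<delta>" for n
  proof -
    have "\<exists>m\<ge>N. dist bp (act (q n) bp) - c \<le> gp bp (act (q n) bp) (x m)" for N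
      using near[of n] unfolding len_def by (meson nat_le_linear order_trans)
    then show ?thesis using ray_near[OF \<xi> x \<gamma> _ c0] unfolding len_def by blast
  qed
  have q\<xi>: "(\<lambda>n. act (q n) bp) \<in> \<xi>"
  proof (rule bdry_limit_mem[OF \<xi> x])
    fix M :: real
    obtain N2 where N2: "\<And>n. n \<ge> N2 \<Longrightarrow> M + c \<le> len (g n)"
      using bdry_dist_tendsto[OF cg] unfolding len_def by blast
    have "\<exists>m\<ge>K. M \<le> gp bp (act (q n) bp) (x m)" if "n \<ge> N2" for n K
    proof -
      obtain M' where M': "\<And>m. m \<ge> M' \<Longrightarrow> len (q n) - c \<le> gp bp (act (q n) bp) (x m)" using near by blast
      have "M + c \<le> len (q n)" using N2[of "n + max N0 N1"] that g(1) by (simp add: q_def)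
      then have "M \<le> gp bp (act (q n) bp) (x (max K M'))" using M'[of "max K M'"] by simp
      then show ?thesis by (intro exI[of _ "max K M'"]) simp
    qed
    then show "\<exists>N. \<forall>n\<ge>N. \<forall>K. \<exists>m\<ge>K. M \<le> gp bp (act (q n) bp) (x m)" by blast
  qed
  show "\<xi> \<in> conical_limit_set G act bp"
    unfolding conical_limit_set_def
    using conicalI[OF \<xi> qG q\<xi> \<gamma> R] qG q\<xi> \<gamma> by blast
qed

lemma unif_conical_subset_conical: "unif_conical_limit_set G act bp \<subseteq> conical_limit_set G act bp"
  unfolding unif_conical_limit_set_def conical_limit_set_def by blast

text \<open>The negation says that the annuli of \<open>N\<close> have O(exp (s n)) elements.
  Quantifying over every \<open>C\<close> makes the notion stable under operations that lose
  constant factors, without lowering \<open>s\<close>.\<close>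

definition big :: "real \<Rightarrow> 'b set \<Rightarrow> bool" where
  "big s N \<longleftrightarrow> (\<forall>C. \<exists>n. C * exp (s * real n) \<le> real (card (annulus n \<inter> N)))"

lemma not_bigE:
  assumes "\<not> big s N"
  obtains C where "0 < C" "\<And>n. real (card (annulus n \<inter> N)) \<le> C * exp (s * real n)"
proof -
  obtain C where C: "\<And>n. real (card (annulus n \<inter> N)) < C * exp (s * real n)"
    using assms unfolding big_def by (meson not_le_imp_less)
  have "0 < C * exp (s * real 0)" using C[of 0] by (rule order_le_less_trans[OF of_nat_0_le_iff])
  then show ?thesis using that[of C] C less_imp_le by fastforce
qed

lemma big_bounded_absurd:
  assumes "big s N" "\<And>n. real (card (annulus n \<inter> N)) \<le> C * exp (s * real n)"
  shows False
proof -
  obtain n where "(C + 1) * exp (s * real n) \<le> real (card (annulus n \<inter> N))" using assms(1) unfolding big_def by blast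
  then have "(C + 1) * exp (s * real n) \<le> C * exp (s * real n)" using assms(2) order_trans by blast
  then show False by simp
qed

lemma big_Union:
  assumes "finite \<P>" "big s (\<Union>\<P>)"
  shows "\<exists>P\<in>\<P>. big s P"
proof (rule ccontr)
  assume "\<not> ?thesis"
  then have "\<forall>P\<in>\<P>. \<exists>C. \<forall>n. real (card (annulus n \<inter> P)) \<le> C * exp (s * real n)" using not_bigE by metis
  then obtain C where C: "\<And>P n. P \<in> \<P> \<Longrightarrow> real (card (annulus n \<inter> P)) \<le> C P * exp (s * real n)" by metis
  have "real (card (annulus n \<inter> \<Union>\<P>)) \<le> (\<Sum>P\<in>\<P>. C P) * exp (s * real n)" for n
  proof -
    have "annulus n \<inter> \<Union>\<P> = (\<Union>P\<in>\<P>. annulus n \<inter> P)" by blast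
    then have le: "card (annulus n \<inter> \<Union>\<P>) \<le> (\<Sum>P\<in>\<P>. card (annulus n \<inter> P))"
      using card_UN_le[OF assms(1)] by metis
    have "real (card (annulus n \<inter> \<Union>\<P>)) \<le> (\<Sum>P\<in>\<P>. real (card (annulus n \<inter> P)))"
      using of_nat_mono[OF le, where 'a=real] by simp
    also have "\<dots> \<le> (\<Sum>P\<in>\<P>. C P * exp (s * real n))" by (rule sum_mono) (rule C)
    finally show ?thesis by (simp add: sum_distrib_right)
  qed
  with assms(2) show False by (rule big_bounded_absurd)
qed

text \<open>Otherwise the ball of radius \<open>n\<close> has at most C (n + 1) exp (s n) elements,
  and the linear factor disappears in the limsup.\<close>

lemma big_carrier:
  assumes "0 \<le> s" "ereal s < crit_exp G act bp"
  shows "big s (carrier G)"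
proof (rule ccontr)
  assume "\<not> ?thesis"
  then obtain C where C: "0 < C" "\<And>n. real (card (annulus n \<inter> carrier G)) \<le> C * exp (s * real n)"
    by (rule not_bigE) blast
  have ball: "real (card {g \<in> carrier G. len g \<le> real n}) \<le> C * (real n + 1) * exp (s * real n)" for n
  proof -
    have "{g \<in> carrier G. len g \<le> real n} \<subseteq> (\<Union>j\<in>{..n}. annulus j \<inter> carrier G)"
    proof
      fix g assume g: "g \<in> {g \<in> carrier G. len g \<le> real n}"
      have "g \<in> annulus (nat \<lfloor>len g\<rfloor>)" using g len_nonneg[of g] unfolding annulus_def by auto
      moreover have "nat \<lfloor>len g\<rfloor> \<le> n" using g by (simp add: nat_le_iff floor_le_iff) 
      ultimately show "g \<in> (\<Union>j\<in>{..n}. annulus j \<inter> carrier G)" using g by blast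
    qed
    then have "card {g \<in> carrier G. len g \<le> real n} \<le> card (\<Union>j\<in>{..n}. annulus j \<inter> carrier G)"
      by (intro card_mono) (auto intro: finite_annulus)
    also have "\<dots> \<le> (\<Sum>j\<in>{..n}. card (annulus j \<inter> carrier G))" by (rule card_UN_le) simp
    finally have le: "card {g \<in> carrier G. len g \<le> real n} \<le> (\<Sum>j\<in>{..n}. card (annulus j \<inter> carrier G))" .
    have "real (card {g \<in> carrier G. len g \<le> real n}) \<le> (\<Sum>j\<in>{..n}. real (card (annulus j \<inter> carrier G)))"
      using of_nat_mono[OF le, where 'a=real] by simp
    also have "\<dots> \<le> (\<Sum>j\<in>{..n}. C * exp (s * real n))"
    proof (rule sum_mono)
      fix j assume "j \<in> {..n}"
      then have "s * real j \<le> s * real n" using assms(1) by (intro mult_left_mono) auto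
      then have "C * exp (s * real j) \<le> C * exp (s * real n)" using C(1) by simp
      then show "real (card (annulus j \<inter> carrier G)) \<le> C * exp (s * real n)" using C(2)[of j] by linarith
    qed
    finally show ?thesis by (simp add: algebra_simps)
  qed
  let ?f = "\<lambda>n. (ln (C * (real n + 1)) + s * real n) / real n"
  have "?f \<longlonglongrightarrow> s" using C(1) by real_asymp
  then have "limsup (\<lambda>n. ereal (?f n)) = ereal s" by (intro lim_imp_Limsup) auto
  moreover have "crit_exp G act bp \<le> limsup (\<lambda>n. ereal (?f n))"
    unfolding crit_exp_eq
  proof (intro Limsup_mono always_eventually allI)
    fix n
    have "ln (real (card {g \<in> carrier G. len g \<le> real n})) \<le> ln (C * (real n + 1) * exp (s * real n))"
      using ball[of n] card_ball_ge_1[of n] by (intro ln_mono) auto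
    also have "\<dots> = ln (C * (real n + 1)) + s * real n" using C(1) by (simp add: ln_mult)
    finally show "ereal (ln (real (card {g \<in> carrier G. len g \<le> real n})) / real n) \<le> ereal (?f n)"
      by (simp add: divide_right_mono)
  qed
  ultimately show False using assms(2) by simp
qed

text \<open>Lengths change by at most \<open>len f\<close>, so an annulus is spread over at most
  \<open>2 * L + 1\<close> annuli and its count over these grows only by a constant factor.\<close>

lemma big_translate:
  assumes "0 \<le> s" "big s N" "N \<subseteq> carrier G" "f \<in> carrier G"
  shows "big s ((\<lambda>g. f \<otimes> g) ` N)"
proof (rule ccontr)
  assume "\<not> ?thesis"
  then obtain C where C: "0 < C" "\<And>n. real (card (annulus n \<inter> (\<lambda>g. f \<otimes> g) ` N)) \<le> C * exp (s * real n)"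
    by (rule not_bigE) blast
  obtain L :: nat where L: "len f + 1 \<le> real L" using real_arch_simple by blast
  have "real (card (annulus n \<inter> N)) \<le> (real (2 * L + 1) * (C * exp (s * real L))) * exp (s * real n)" for n
  proof -
    let ?J = "{n - L..n + L}"
    have inj: "inj_on (\<lambda>g. f \<otimes> g) (annulus n \<inter> N)"
      using assms(3,4) by (auto simp: inj_on_def subset_iff)
    have "(\<lambda>g. f \<otimes> g) ` (annulus n \<inter> N) \<subseteq> (\<Union>j\<in>?J. annulus j \<inter> (\<lambda>g. f \<otimes> g) ` N)"
    proof
      fix h assume "h \<in> (\<lambda>g. f \<otimes> g) ` (annulus n \<inter> N)"
      then obtain g where g: "h = f \<otimes> g" "g \<in> N" "g \<in> annulus n" by blast
      have gG: "g \<in> carrier G" using g assms(3) by blast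
      have h: "h \<in> carrier G" using g gG assms(4) by simp
      have l: "len g - len f \<le> len h" "len h \<le> len f + len g"
        using len_mult_ge(1)[OF assms(4) gG] len_mult_le[OF assms(4) gG] by (simp_all add: g(1))
      have n: "real n \<le> len g" "len g < real n + 1" using g(3) by (auto simp: annulus_def)
      have 1: "h \<in> annulus (nat \<lfloor>len h\<rfloor>)" using h len_nonneg[of h] unfolding annulus_def by auto
      have "real n < real (nat \<lfloor>len h\<rfloor> + L + 1)" "real (nat \<lfloor>len h\<rfloor>) < real (n + L + 1)"
        using l n L len_nonneg[of h] by (auto, linarith+)
      then have "nat \<lfloor>len h\<rfloor> \<in> ?J" by auto
      with 1 g show "h \<in> (\<Union>j\<in>?J. annulus j \<inter> (\<lambda>g. f \<otimes> g) ` N)" by blast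
    qed
    then have "card ((\<lambda>g. f \<otimes> g) ` (annulus n \<inter> N)) \<le> card (\<Union>j\<in>?J. annulus j \<inter> (\<lambda>g. f \<otimes> g) ` N)"
      by (intro card_mono) (auto intro: finite_annulus)
    also have "\<dots> \<le> (\<Sum>j\<in>?J. card (annulus j \<inter> (\<lambda>g. f \<otimes> g) ` N))" by (rule card_UN_le) simp
    finally have le: "card (annulus n \<inter> N) \<le> (\<Sum>j\<in>?J. card (annulus j \<inter> (\<lambda>g. f \<otimes> g) ` N))"
      unfolding card_image[OF inj] .
    have "real (card (annulus n \<inter> N)) \<le> (\<Sum>j\<in>?J. real (card (annulus j \<inter> (\<lambda>g. f \<otimes> g) ` N)))"
      using of_nat_mono[OF le, where 'a=real] by simp
    also have "\<dots> \<le> (\<Sum>j\<in>?J. C * exp (s * real (n + L)))"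
    proof (rule sum_mono)
      fix j assume "j \<in> ?J"
      then have "s * real j \<le> s * real (n + L)" using assms(1) by (intro mult_left_mono of_nat_mono) auto
      then have "C * exp (s * real j) \<le> C * exp (s * real (n + L))" using C(1) by simp
      then show "real (card (annulus j \<inter> (\<lambda>g. f \<otimes> g) ` N)) \<le> C * exp (s * real (n + L))" using C(2)[of j] by linarith
    qed
    also have "\<dots> = real (card ?J) * (C * exp (s * real (n + L)))" by simp
    also have "\<dots> \<le> real (2 * L + 1) * (C * exp (s * real (n + L)))"
      using C(1) by (intro mult_right_mono of_nat_mono) auto
    also have "C * exp (s * real (n + L)) = C * exp (s * real L) * exp (s * real n)"
      by (simp add: exp_add[symmetric] algebra_simps)
    finally show ?thesis by (simp add: mult.assoc)
  qed
  with assms(2) show False by (rule big_bounded_absurd)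
qed

lemma not_big_finite: "0 \<le> s \<Longrightarrow> finite N \<Longrightarrow> \<not> big s N"
proof
  assume "0 \<le> s" "finite N" "big s N"
  have "real (card (annulus n \<inter> N)) \<le> real (card N) * exp (s * real n)" for n
  proof -
    have "real (card (annulus n \<inter> N)) \<le> real (card N)" using \<open>finite N\<close> by (intro of_nat_mono card_mono) auto
    also have "\<dots> \<le> real (card N) * exp (s * real n)"
      using mult_left_mono[of 1 "exp (s * real n)" "real (card N)"] \<open>0 \<le> s\<close> by simp
    finally show ?thesis .
  qed
  with \<open>big s N\<close> show False by (rule big_bounded_absurd)
qed

text \<open>The cells record where a geodesic from \<open>bp\<close> crosses the sphere of radius
  \<open>M\<close>. Crossings in a common ball of radius 1/2 are less than 1 apart, which costs less
  than 1 in the product.\<close>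

lemma sphere_cover:
  assumes "0 \<le> M"
  shows "\<exists>\<P>. finite \<P> \<and> {x. M \<le> dist bp x} \<subseteq> \<Union>\<P> \<and> (\<forall>P\<in>\<P>. \<forall>x\<in>P. \<forall>y\<in>P. M - 1 \<le> gp bp x y)"
proof -
  have K: "compact (cball bp M)" using proper by (simp add: proper_space_def)
  have "cball bp M \<subseteq> (\<Union>t\<in>cball bp M. ball t (1/2))"
  proof
    fix z assume "z \<in> cball bp M"
    then show "z \<in> (\<Union>t\<in>cball bp M. ball t (1/2))" by (rule UN_I) simp
  qed
  with K obtain T where T: "T \<subseteq> cball bp M" "finite T" "cball bp M \<subseteq> (\<Union>t\<in>T. ball t (1/2))"
    by (rule compactE_image[OF _ open_ball]) blast
  let ?P = "\<lambda>t. {x. \<exists>z\<in>ball t (1/2). dist z x = dist bp x - M}"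
  have "{x. M \<le> dist bp x} \<subseteq> \<Union>(?P ` T)"
  proof
    fix x assume "x \<in> {x. M \<le> dist bp x}"
    then have x: "M \<le> dist bp x" by simp
    obtain c where c: "c 0 = bp" "c (dist bp x) = x"
      "\<And>s t. s \<in> {0..dist bp x} \<Longrightarrow> t \<in> {0..dist bp x} \<Longrightarrow> dist (c s) (c t) = \<bar>s - t\<bar>"
      using geodesicE by metis
    have cM: "dist bp (c M) = M" "dist (c M) x = dist bp x - M"
      using c(3)[of 0 M] c(3)[of M "dist bp x"] c(1,2) x assms by auto
    then have "c M \<in> cball bp M" by simp
    then obtain t where "t \<in> T" "c M \<in> ball t (1/2)" using T(3) by blast
    then show "x \<in> \<Union>(?P ` T)" using cM(2) by blast
  qed
  moreover have "M - 1 \<le> gp bp x y" if xy: "x \<in> ?P t" "y \<in> ?P t" for x y t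
  proof -
    obtain z where z: "dist t z < 1/2" "dist z x = dist bp x - M" using xy(1) by auto
    obtain w where w: "dist t w < 1/2" "dist w y = dist bp y - M" using xy(2) by auto
    have "dist x y \<le> dist z x + dist t z + dist t w + dist w y"
      using dist_triangle[of x y z] dist_triangle[of z y t] dist_triangle[of t y w] by (simp add: dist_commute)
    then show ?thesis using z w unfolding gromov_prod_def by simp
  qed
  then have "\<forall>P\<in>?P ` T. \<forall>x\<in>P. \<forall>y\<in>P. M - 1 \<le> gp bp x y" by blast
  ultimately show ?thesis using T(2) by (intro exI[of _ "?P ` T"] conjI finite_imageI)
qed

text \<open>Pigeonhole over pairs of cells, one for the orbit point and one for that of the inverse.
  Elements too short for the cover form one more class, which is finite and so not big.\<close>

lemma big_refine:
  assumes s: "0 \<le> s" and N: "big s N" "N \<subseteq> carrier G" and M: "0 \<le> M"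
  shows "\<exists>N'\<subseteq>N. big s N' \<and> (\<forall>g\<in>N'. \<forall>h\<in>N'. M \<le> gp bp (act g bp) (act h bp) \<and>
      M \<le> gp bp (act (inv g) bp) (act (inv h) bp))"
proof -
  obtain \<P> where P: "finite \<P>" "{x. M + 1 \<le> dist bp x} \<subseteq> \<Union>\<P>"
    "\<And>P x y. P \<in> \<P> \<Longrightarrow> x \<in> P \<Longrightarrow> y \<in> P \<Longrightarrow> M \<le> gp bp x y"
    using sphere_cover[of "M + 1"] M by auto
  define Q where "Q = (\<lambda>(P, P'). {g \<in> N. act g bp \<in> P \<and> act (inv g) bp \<in> P'})"
  let ?\<Q> = "insert {g \<in> N. len g < M + 1} (Q ` (\<P> \<times> \<P>))"
  have "N \<subseteq> \<Union>?\<Q>"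
  proof
    fix g assume g: "g \<in> N"
    show "g \<in> \<Union>?\<Q>"
    proof (cases "len g < M + 1")
      case False
      then have "M + 1 \<le> dist bp (act g bp)" "M + 1 \<le> dist bp (act (inv g) bp)"
        using g N(2) len_inv[of g] by (auto simp: len_def)
      then have "act g bp \<in> {x. M + 1 \<le> dist bp x}" "act (inv g) bp \<in> {x. M + 1 \<le> dist bp x}" by simp_all
      then have "act g bp \<in> \<Union>\<P>" "act (inv g) bp \<in> \<Union>\<P>" using subsetD[OF P(2)] by blast+
      then obtain P P' where "P \<in> \<P>" "act g bp \<in> P" "P' \<in> \<P>" "act (inv g) bp \<in> P'" by auto
      then have "g \<in> Q (P, P')" "(P, P') \<in> \<P> \<times> \<P>" using g by (auto simp: Q_def)
      then show ?thesis by blast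
    qed (use g in auto)
  qed
  moreover have "\<Union>?\<Q> \<subseteq> N" by (auto simp: Q_def)
  ultimately have "big s (\<Union>?\<Q>)" using N(1) by (metis subset_antisym)
  then obtain N' where N': "N' \<in> ?\<Q>" "big s N'" using big_Union[of ?\<Q> s] P(1) by auto
  have "finite {g \<in> N. len g < M + 1}"
    by (rule finite_subset[OF _ finite_ball[of "M + 1"]]) (use N(2) in auto)
  then have "N' \<noteq> {g \<in> N. len g < M + 1}" using not_big_finite[OF s] N'(2) by blast
  then obtain P P' where "P \<in> \<P>" "P' \<in> \<P>" "N' = Q (P, P')" using N'(1) by auto
  then show ?thesis using N'(2) P(3) by (intro exI[of _ N']) (auto simp: Q_def)
qed

lemma big_nonempty: "0 \<le> s \<Longrightarrow> big s N \<Longrightarrow> N \<noteq> {}"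
  using not_big_finite[of s "{}"] by auto

text \<open>Each set is refined inside the preceding one, so all levels share their limiting
  directions; the diagonal choice \<open>g\<close> represents these directions by sequences.\<close>

lemma big_directions:
  assumes s: "0 \<le> s" "ereal s < crit_exp G act bp"
  shows "\<exists>N g. (\<forall>j. N j \<subseteq> carrier G \<and> big s (N j) \<and> g j \<in> N j) \<and> (\<forall>i j. i \<le> j \<longrightarrow> N j \<subseteq> N i) \<and>
    (\<forall>j. \<forall>a\<in>N j. \<forall>b\<in>N j. real j \<le> gp bp (act a bp) (act b bp) \<and> real j \<le> gp bp (act (inv a) bp) (act (inv b) bp))"
proof -
  have "\<exists>N. \<forall>j. (N j \<subseteq> carrier G \<and> big s (N j) \<and>
     (\<forall>a\<in>N j. \<forall>b\<in>N j. real j \<le> gp bp (act a bp) (act b bp) \<and> real j \<le> gp bp (act (inv a) bp) (act (inv b) bp)))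
     \<and> N (Suc j) \<subseteq> N j"
  proof (rule dependent_nat_choice)
    show "\<exists>x. x \<subseteq> carrier G \<and> big s x \<and>
       (\<forall>a\<in>x. \<forall>b\<in>x. real 0 \<le> gp bp (act a bp) (act b bp) \<and> real 0 \<le> gp bp (act (inv a) bp) (act (inv b) bp))"
      using big_carrier[OF s] gp_nonneg by auto
  next
    fix x n assume "x \<subseteq> carrier G \<and> big s x \<and>
       (\<forall>a\<in>x. \<forall>b\<in>x. real n \<le> gp bp (act a bp) (act b bp) \<and> real n \<le> gp bp (act (inv a) bp) (act (inv b) bp))"
    then show "\<exists>y. (y \<subseteq> carrier G \<and> big s y \<and>
       (\<forall>a\<in>y. \<forall>b\<in>y. real (Suc n) \<le> gp bp (act a bp) (act b bp) \<and> real (Suc n) \<le> gp bp (act (inv a) bp) (act (inv b) bp))) \<and> y \<subseteq> x"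
      using big_refine[OF s(1), of x "real (Suc n)"] by (meson of_nat_0_le_iff subset_trans)
  qed
  then obtain N where N: "\<And>j. N j \<subseteq> carrier G" "\<And>j. big s (N j)" "\<And>j. N (Suc j) \<subseteq> N j"
    "\<And>j. \<forall>a\<in>N j. \<forall>b\<in>N j. real j \<le> gp bp (act a bp) (act b bp) \<and> real j \<le> gp bp (act (inv a) bp) (act (inv b) bp)"
    by blast
  have "\<exists>a. a \<in> N j" for j using big_nonempty[OF s(1) N(2)] by blast
  then obtain g where "\<And>j. g j \<in> N j" by metis
  moreover have "i \<le> j \<Longrightarrow> N j \<subseteq> N i" for i j using N(3) lift_Suc_antimono_le by metis
  ultimately show ?thesis using N by blast
qed

text \<open>\<open>A\<close> supplies letters any two of which may follow each other.
  \<open>F\<close> allows an arbitrary \<open>k\<close> to be inserted between such letters at the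
  price of two factors from a fixed finite set.\<close>

lemma big_transverse:
  assumes s: "0 \<le> s" "ereal s < crit_exp G act bp"
  shows "\<exists>A F c. A \<subseteq> carrier G \<and> big s A \<and> finite F \<and> F \<subseteq> carrier G \<and>
    (\<forall>a\<in>A. \<forall>b\<in>A. gp bp (act (inv a) bp) (act b bp) \<le> c) \<and>
    (\<forall>k\<in>carrier G. \<exists>f1\<in>F. \<exists>f2\<in>F. \<forall>a\<in>A. gp bp (act (inv a) bp) (act (f1 \<otimes> k \<otimes> f2) bp) \<le> c \<and>
        gp bp (act (inv (f1 \<otimes> k \<otimes> f2)) bp) (act a bp) \<le> c)"
proof -
  obtain N g where N: "\<And>j. N j \<subseteq> carrier G" "\<And>j. big s (N j)" "\<And>j. g j \<in> N j" "\<And>i j. i \<le> j \<Longrightarrow> N j \<subseteq> N i"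
    "\<And>j a b. a \<in> N j \<Longrightarrow> b \<in> N j \<Longrightarrow> real j \<le> gp bp (act a bp) (act b bp)"
    "\<And>j a b. a \<in> N j \<Longrightarrow> b \<in> N j \<Longrightarrow> real j \<le> gp bp (act (inv a) bp) (act (inv b) bp)"
    using big_directions[OF s] by metis
  have g: "g j \<in> carrier G" for j using N(1,3) by blast
  define x where "x i = act (g i) bp" for i
  define y where "y i = act (inv (g i)) bp" for i
  have cx: "conv_inf bp x" and cy: "conv_inf bp y"
  proof -
    have "real (min i j) \<le> gp bp (x i) (x j) \<and> real (min i j) \<le> gp bp (y i) (y j)" for i j
      unfolding x_def y_def using N(5,6)[of "g i" "min i j" "g j"] N(3,4) by (meson min.cobounded1 min.cobounded2 subsetD)
    then have *: "M \<le> gp bp (x i) (x j) \<and> M \<le> gp bp (y i) (y j)"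
      if "M \<le> real K" "i \<ge> K" "j \<ge> K" for M K i j
      using that of_nat_mono[of K "min i j", where 'a=real] by (meson min.boundedI order_trans)
    have "\<exists>K. \<forall>i\<ge>K. \<forall>j\<ge>K. M \<le> gp bp (x i) (x j) \<and> M \<le> gp bp (y i) (y j)" for M
    proof -
      obtain K :: nat where "M \<le> real K" using real_arch_simple by blast
      from *[OF this] show ?thesis by (intro exI[of _ K]) simp
    qed
    then show "conv_inf bp x" "conv_inf bp y"
      unfolding conv_inf_def by meson+
  qed
  \<comment> \<open>Forward and backward directions may coincide. A left factor moving the common
    limit separates them, and it displaces the orbit points of inverses only by
    \<open>len f0\<close>.\<close>
  obtain f0 where f0: "f0 \<in> carrier G" "\<not> seq_equiv bp (\<lambda>n. act f0 (x n)) y"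
  proof (cases "seq_equiv bp x y")
    case True
    obtain h where h: "h \<in> carrier G" "\<not> seq_equiv bp (\<lambda>n. act h (x n)) x" using limit_point_not_fixed[OF cx] by blast
    then have "\<not> seq_equiv bp (\<lambda>n. act h (x n)) y" using seq_equiv_trans[OF _ seq_equiv_sym[OF True]] by blast
    then show ?thesis using that h by blast
  next
    case False
    then show ?thesis using that[of \<one>] by simp
  qed
  define X where "X i = act f0 (x i)" for i
  have cX: "conv_inf bp X" unfolding X_def by (rule conv_inf_act[OF f0(1) cx])
  obtain D0 n0 where D0: "\<And>i j. i \<ge> n0 \<Longrightarrow> j \<ge> n0 \<Longrightarrow> gp bp (X i) (y j) \<le> D0"
    using not_equiv_bound[OF cX cy] f0(2) unfolding X_def by blast
  obtain h1 where h1: "h1 \<in> carrier G" "\<not> seq_equiv bp (\<lambda>n. act h1 (y n)) y" using limit_point_not_fixed[OF cy] by blast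
  obtain D1 n1 where D1: "\<And>i j. i \<ge> n1 \<Longrightarrow> j \<ge> n1 \<Longrightarrow> gp bp (act h1 (y i)) (y j) \<le> D1"
    using not_equiv_bound[OF conv_inf_act[OF h1(1) cy] cy h1(2)] by blast
  obtain h2 where h2: "h2 \<in> carrier G" "\<not> seq_equiv bp (\<lambda>n. act h2 (X n)) X" using limit_point_not_fixed[OF cX] by blast
  obtain D2 n2 where D2: "\<And>i j. i \<ge> n2 \<Longrightarrow> j \<ge> n2 \<Longrightarrow> gp bp (act h2 (X i)) (X j) \<le> D2"
    using not_equiv_bound[OF conv_inf_act[OF h2(1) cX] cX h2(2)] by blast
  have Dp: "0 \<le> D0" "0 \<le> D1" "0 \<le> D2"
    using D0[of n0 n0] D1[of n1 n1] D2[of n2 n2] gp_nonneg order_trans by blast+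
  define L where "L = len f0 + len h1 + len h2"
  have L: "0 \<le> L" "len f0 \<le> L" "len h1 \<le> L" "len h2 \<le> L" by (auto simp: L_def)
  \<comment> \<open>\<open>c1\<close> bounds a product after the correction at one end of
    \<open>k\<close>; \<open>c\<close> adds the displacement \<open>L\<close> caused by the factor
    at the other end and one four-point loss.\<close>
  define c1 where "c1 = D0 + D1 + D2 + \<delta> + L"
  define c where "c = c1 + L + \<delta>"
  obtain i0 :: nat where i0: "c + L + \<delta> + 1 \<le> real i0" using real_arch_simple by blast
  \<comment> \<open>The level is fixed only after \<open>c\<close>: it is deep enough that, after
    the loss \<open>L\<close> from translating by \<open>f0\<close>, the letters still agree with
    the reference points beyond \<open>c + \<delta>\<close>.\<close>
  define i where "i = max i0 (max n0 (max n1 n2))"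
  have i: "c + L + \<delta> < real i" "i \<ge> n0" "i \<ge> n1" "i \<ge> n2"
    using i0 of_nat_mono[of i0 i, where 'a=real] by (auto simp: i_def)
  \<comment> \<open>Elements of \<open>A\<close> point towards \<open>?P\<close> and their inverses towards \<open>?Q\<close>; \<open>h1\<close> and \<open>h2\<close> move any other
    point away from these two directions.\<close>
  let ?P = "X i" and ?Q = "y i"
  define A where "A = (\<lambda>a. f0 \<otimes> a) ` N i"
  have AG: "A \<subseteq> carrier G" using N(1) f0(1) by (auto simp: A_def)
  have bigA: "big s A" unfolding A_def by (rule big_translate[OF s(1) N(2) N(1) f0(1)])
  have aP: "c + \<delta> < gp bp (act a bp) ?P" and aQ: "c + \<delta> < gp bp (act (inv a) bp) ?Q" if a: "a \<in> A" for a
  proof -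
    obtain b where b: "b \<in> N i" "a = f0 \<otimes> b" using a by (auto simp: A_def)
    have bG: "b \<in> carrier G" using b N(1) by blast
    have "real i \<le> gp bp (act b bp) (x i)" using N(5)[OF b(1) N(3)] by (simp add: x_def)
    then have "real i - L \<le> gp bp (act a bp) ?P"
      using gp_act_base_ge[OF f0(1), of "act b bp" "x i"] L(2) f0(1) bG by (simp add: X_def b(2) act_mult)
    then show "c + \<delta> < gp bp (act a bp) ?P" using i(1) by linarith
    have 1: "real i \<le> gp bp (act (inv b) bp) ?Q" using N(6)[OF b(1) N(3)] by (simp add: y_def)
    have "dist (act (inv b) bp) (act (inv a) bp) = len f0"
      using dist_act_mult[of "inv b" "inv f0"] bG f0(1) by (simp add: b(2) inv_mult_group)
    then have "real i - L \<le> gp bp (act (inv a) bp) ?Q"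
      using 1 L(2) gp_lipschitz_left[of bp "act (inv b) bp" ?Q "act (inv a) bp"] by linarith
    then show "c + \<delta> < gp bp (act (inv a) bp) ?Q" using i(1) by linarith
  qed
  have c_ge: "D0 + 2 * \<delta> \<le> c" "D1 + \<delta> \<le> c1" "D2 + \<delta> \<le> c1" "D1 + \<delta> + L \<le> c1" "D2 + \<delta> + L \<le> c1" "c1 + L + \<delta> \<le> c"
    using Dp L(1) \<delta>_nonneg by (auto simp: c_def c1_def)
  have AA: "gp bp (act (inv a) bp) (act b bp) \<le> c" if "a \<in> A" "b \<in> A" for a b
  proof -
    have "gp bp ?P ?Q \<le> D0" using D0[OF i(2) i(2)] .
    from hyp_or_le[OF this, of "act b bp"] have "gp bp (act b bp) ?Q \<le> D0 + \<delta>"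
      using aP[OF that(2)] c_ge(1) \<delta>_nonneg by (auto simp: gp_commute)
    from hyp_or_le[OF this, of "act (inv a) bp"] have "gp bp (act b bp) (act (inv a) bp) \<le> D0 + \<delta> + \<delta>"
      using aQ[OF that(1)] c_ge(1) \<delta>_nonneg by (auto simp: gp_commute)
    then show ?thesis using c_ge(1) by (simp add: gp_commute)
  qed
  \<comment> \<open>\<open>z\<close> cannot point towards both \<open>w\<close> and
    \<open>act h w\<close>. If it avoids \<open>w\<close>, take \<open>\<one>\<close>; if it avoids
    \<open>act h w\<close>, then \<open>inv h\<close> carries this to avoidance of
    \<open>w\<close>.\<close>
  have move: "\<exists>f\<in>{\<one>, inv h}. gp bp (act f z) w \<le> c1"
    if h: "h \<in> carrier G" "len h \<le> L" and D: "gp bp (act h w) w \<le> D" "D + \<delta> + L \<le> c1" for h w z D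
  proof -
    from hyp_or_le[OF D(1), of z] consider "gp bp z w \<le> D + \<delta>" | "gp bp (act h w) z \<le> D + \<delta>" by blast
    then show ?thesis
    proof cases
      case 1
      then show ?thesis using D(2) L(1) by (intro bexI[of _ \<one>]) auto
    next
      case 2
      then have "gp bp (act (inv h) z) (act (inv h) (act h w)) \<le> D + \<delta> + len h"
        using gp_act_base_le[of "inv h" z "act h w"] h(1) by (simp add: gp_commute)
      then show ?thesis using D(2) h by (intro bexI[of _ "inv h"]) auto
    qed
  qed
  let ?F = "{\<one>, inv h1, h2}"
  have FG: "?F \<subseteq> carrier G" using h1 h2 by auto
  have FL: "len f \<le> L" if "f \<in> ?F" for f using that L h1 by (auto simp: len_def[of \<one>])
  have ins: "\<exists>f1\<in>?F. \<exists>f2\<in>?F. \<forall>a\<in>A. gp bp (act (inv a) bp) (act (f1 \<otimes> k \<otimes> f2) bp) \<le> c \<and>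
        gp bp (act (inv (f1 \<otimes> k \<otimes> f2)) bp) (act a bp) \<le> c" if k: "k \<in> carrier G" for k
  proof -
    obtain f1 where f1: "f1 \<in> {\<one>, inv h1}" "gp bp (act f1 (act k bp)) ?Q \<le> c1"
      using move[OF h1(1) L(3) D1[OF i(3) i(3)] c_ge(4)] by blast
    obtain f2' where f2': "f2' \<in> {\<one>, inv h2}" "gp bp (act f2' (act (inv k) bp)) ?P \<le> c1"
      using move[OF h2(1) L(4) D2[OF i(4) i(4)] c_ge(5)] by blast
    \<comment> \<open>The correction at the far end multiplies \<open>inv k\<close> from the left,
      so its inverse multiplies \<open>k\<close> from the right.\<close>
    define f2 where "f2 = inv f2'"
    have f2: "f2 \<in> {\<one>, h2}" "inv f2 = f2'" using f2'(1) h2(1) by (auto simp: f2_def)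
    have G: "f1 \<in> carrier G" "f2 \<in> carrier G" "f2' \<in> carrier G" using f1(1) f2(1) f2'(1) h1 h2 by auto
    have l: "len f1 \<le> L" "len f2 \<le> L" using FL f1(1) f2(1) by auto
    let ?u = "act (f1 \<otimes> k \<otimes> f2) bp" and ?v = "act (inv (f1 \<otimes> k \<otimes> f2)) bp"
    have "dist (act f1 (act k bp)) ?u = len f2"
      using dist_act_mult[of "f1 \<otimes> k" f2] G k by (simp add: act_mult)
    then have u: "gp bp ?u ?Q \<le> c1 + L"
      using f1(2) l(2) gp_lipschitz_left[of bp ?u ?Q "act f1 (act k bp)"] by (simp add: dist_commute)
    have "dist (act f2' (act (inv k) bp)) ?v = len f1"
      using dist_act_mult[of "inv f2 \<otimes> inv k" "inv f1"] G k f2(2) by (simp add: act_mult inv_mult_group m_assoc)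
    then have v: "gp bp ?v ?P \<le> c1 + L"
      using f2'(2) l(1) gp_lipschitz_left[of bp ?v ?P "act f2' (act (inv k) bp)"] by (simp add: dist_commute)
    have "gp bp (act (inv a) bp) ?u \<le> c \<and> gp bp ?v (act a bp) \<le> c" if a: "a \<in> A" for a
      using hyp_or_le[OF u, of "act (inv a) bp"] hyp_or_le[OF v, of "act a bp"] aP[OF a] aQ[OF a] c_ge(6) \<delta>_nonneg
      by (auto simp: gp_commute)
    then show ?thesis using f1(1) f2(1) by blast
  qed
  show ?thesis using AG bigA FG AA ins by (intro exI[of _ A] exI[of _ ?F] exI[of _ c]) auto
qed

end

section \<open>Trees of broken geodesics\<close>

text \<open>The summands bound the cylinder measures for the product of the uniform measures, whose
  total mass is 1. Intersecting with \<open>S j\<close> admits prescribed letters outside the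
  alphabet, for which the cylinder is null.\<close>

lemma cylinder_cover:
  fixes S :: "nat \<Rightarrow> 'b set" and v :: "nat \<Rightarrow> nat \<Rightarrow> 'b" and n :: "nat \<Rightarrow> nat"
  assumes S: "\<And>i. finite (S i)" "\<And>i. S i \<noteq> {}"
    and cov: "{w. \<forall>i. w i \<in> S i} \<subseteq> (\<Union>i. {w. \<forall>j<n i. w j = v i j})"
  shows "1 \<le> (\<Sum>i. ennreal (1 / (\<Prod>j<n i. real (card (S j)))))"
proof -
  define M where "M i = uniform_count_measure (S i)" for i
  have sp: "space (M i) = S i" "sets (M i) = Pow (S i)" for i
    by (simp_all add: M_def space_uniform_count_measure sets_uniform_count_measure)
  have "prob_space (M i)" for i unfolding M_def using S by (rule prob_space_uniform_count_measure)
  then interpret product_prob_space M UNIV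
    by (rule product_prob_spaceI)
  let ?P = "PiM UNIV M"
  define C where "C i = prod_emb UNIV M {..<n i} (PiE {..<n i} (\<lambda>j. {v i j} \<inter> S j))" for i
  have C_sets: "C i \<in> sets ?P" for i
    unfolding C_def by (intro sets_PiM_I) (auto simp: sp)
  have C_le: "emeasure ?P (C i) \<le> ennreal (1 / (\<Prod>j<n i. real (card (S j))))" for i
  proof -
    have "emeasure ?P (C i) = (\<Prod>j<n i. emeasure (M j) ({v i j} \<inter> S j))"
      unfolding C_def by (rule emeasure_PiM_emb) (auto simp: sp)
    also have "\<dots> \<le> (\<Prod>j<n i. ennreal (1 / real (card (S j))))"
    proof (rule prod_mono_ennreal)
      fix j
      have "card ({v i j} \<inter> S j) \<le> 1" using card_mono[of "{v i j}" "{v i j} \<inter> S j"] by simp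
      then have "real (card ({v i j} \<inter> S j)) / real (card (S j)) \<le> 1 / real (card (S j))"
        by (intro divide_right_mono) auto
      moreover have "emeasure (M j) ({v i j} \<inter> S j) = ennreal (real (card ({v i j} \<inter> S j)) / real (card (S j)))"
        unfolding M_def by (subst emeasure_uniform_count_measure) (use S in auto)
      ultimately show "emeasure (M j) ({v i j} \<inter> S j) \<le> ennreal (1 / real (card (S j)))"
        by (simp add: ennreal_leI)
    qed
    also have "\<dots> = ennreal (\<Prod>j<n i. 1 / real (card (S j)))" by (rule prod_ennreal) simp
    finally show ?thesis by (simp add: prod_dividef)
  qed
  have "space ?P \<subseteq> (\<Union>i. C i)"
  proof
    fix w assume w: "w \<in> space ?P"
    then have wS: "w j \<in> S j" for j by (auto simp: space_PiM PiE_iff sp)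
    then obtain i where "\<And>j. j < n i \<Longrightarrow> w j = v i j" using cov by blast
    then have "\<And>j. j < n i \<Longrightarrow> v i j \<in> S j" using wS by metis
    then have "w \<in> C i" using w wS \<open>\<And>j. j < n i \<Longrightarrow> w j = v i j\<close>
      by (auto simp: C_def prod_emb_def space_PiM PiE_iff sp)
    then show "w \<in> (\<Union>i. C i)" by blast
  qed
  then have "emeasure ?P (space ?P) \<le> emeasure ?P (\<Union>i. C i)" by (rule emeasure_mono) (use C_sets in auto)
  also have "\<dots> \<le> (\<Sum>i. emeasure ?P (C i))" by (rule emeasure_subadditive_countably) (use C_sets in auto)
  also have "\<dots> \<le> (\<Sum>i. ennreal (1 / (\<Prod>j<n i. real (card (S j)))))" by (intro suminf_le C_le) auto
  finally show ?thesis by (simp add: emeasure_space_1)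
qed

section \<open>Coding boundary points by infinite words\<close>

context visual_action
begin

primrec prefix :: "(nat \<Rightarrow> 'b) \<Rightarrow> nat \<Rightarrow> 'b" where
  "prefix w 0 = \<one>"
| "prefix w (Suc n) = prefix w n \<otimes> w n"

text \<open>The gap between letters is the sum of \<open>2 * c + 8 * \<delta>\<close>, lost when the
  products of two vertices are chained through points further out, and
  \<open>2 * c + 4 * \<delta>\<close>, lost at the turn in front of the letters; see
  \<open>branch_separation\<close>.\<close>

definition tree :: "real \<Rightarrow> (nat \<Rightarrow> 'b set) \<Rightarrow> bool" where
  "tree c S \<longleftrightarrow> (\<forall>i. finite (S i) \<and> S i \<noteq> {} \<and> S i \<subseteq> carrier G) \<and>
    (\<forall>i. \<forall>a\<in>S i. 2 * c + 4 * \<delta> + 1 \<le> len a) \<and>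
    (\<forall>i. \<forall>a\<in>S i. \<forall>b\<in>S (Suc i). gp bp (act (inv a) bp) (act b bp) \<le> c) \<and>
    (\<forall>i. \<forall>a\<in>S i. \<forall>b\<in>S i. a \<noteq> b \<longrightarrow> \<bar>len a - len b\<bar> + 4 * c + 12 * \<delta> < dist (act a bp) (act b bp))"

definition branch :: "(nat \<Rightarrow> 'b) \<Rightarrow> nat \<Rightarrow> 'a" where
  "branch w n = act (prefix w n) bp"

lemma branch_0: "branch w 0 = bp"
  by (simp add: branch_def)

definition branch_end :: "(nat \<Rightarrow> 'b) \<Rightarrow> (nat \<Rightarrow> 'a) set" where
  "branch_end w = bdpt (branch w)"

lemma prefix_cong: "(\<And>i. i < n \<Longrightarrow> w i = w' i) \<Longrightarrow> prefix w n = prefix w' n"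
  by (induction n) auto

context
  fixes c S
  assumes tree: "tree c S"
begin

lemma letter_carrier: "a \<in> S i \<Longrightarrow> a \<in> carrier G"
  using tree by (auto simp: tree_def)

lemma letter_len: "a \<in> S i \<Longrightarrow> 2 * c + 4 * \<delta> + 1 \<le> len a"
  using tree by (simp add: tree_def)

lemma letter_gp: "a \<in> S i \<Longrightarrow> b \<in> S (Suc i) \<Longrightarrow> gp bp (act (inv a) bp) (act b bp) \<le> c"
  using tree by (simp add: tree_def)

lemma prefix_carrier:
  assumes "\<forall>i. w i \<in> S i"
  shows "prefix w n \<in> carrier G"
proof (induction n)
  case (Suc n)
  then show ?case using letter_carrier assms by auto
qed simp

lemma branch_broken:
  assumes w: "\<forall>i. w i \<in> S i"
  shows "broken c (branch w)"
  unfolding broken_def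
proof (intro allI conjI)
  fix i
  have G: "prefix w n \<in> carrier G" "w n \<in> carrier G" for n
    using prefix_carrier[OF w] letter_carrier w by blast+
  have "branch w i = act (prefix w (Suc i)) (act (inv (w i)) bp)"
    using G by (simp add: branch_def act_mult)
  moreover have "branch w (Suc (Suc i)) = act (prefix w (Suc i)) (act (w (Suc i)) bp)"
    using G by (simp add: branch_def act_mult)
  ultimately have "gp (branch w (Suc i)) (branch w i) (branch w (Suc (Suc i))) =
      gp bp (act (inv (w i)) bp) (act (w (Suc i)) bp)"
    unfolding branch_def[of w "Suc i"] by (simp only: gp_act[OF G(1)])
  then show "gp (branch w (Suc i)) (branch w i) (branch w (Suc (Suc i))) \<le> c"
    using letter_gp[of "w i" i "w (Suc i)"] w by simp
  show "2 * c + 4 * \<delta> + 1 \<le> dist (branch w i) (branch w (Suc i))"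
    using letter_len[of "w i" i] w dist_act_mult[OF G(1) G(2), of i i] unfolding branch_def by simp
qed

lemma branch_end:
  assumes "\<forall>i. w i \<in> S i"
  shows "branch_end w \<in> bdry bp" "branch w \<in> branch_end w" "branch_end w \<in> limit_set G act bp"
proof -
  have "conv_inf bp (branch w)" using broken_conv_inf[OF branch_broken[OF assms]] branch_0 by blast
  then show *: "branch_end w \<in> bdry bp" "branch w \<in> branch_end w"
    unfolding branch_end_def by (rule bdpt_in)+
  show "branch_end w \<in> limit_set G act bp"
    unfolding limit_set_def using * prefix_carrier[OF assms] unfolding branch_def by blast
qed

lemma branch_Suc_dist:
  assumes w: "\<forall>i. w i \<in> S i"
  shows "dist bp (branch w k) + len (w k) - 2 * (c + 2 * \<delta>) \<le> dist bp (branch w (Suc k))"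
    "dist bp (branch w (Suc k)) \<le> dist bp (branch w k) + len (w k)"
proof -
  have G: "prefix w k \<in> carrier G" "w k \<in> carrier G"
    using prefix_carrier[OF w] letter_carrier w by blast+
  let ?g = "gp (branch w k) bp (branch w (Suc k))"
  have "?g \<le> c + 2 * \<delta>" using broken_gp[OF branch_broken[OF w], of 0 k "Suc k"] by (simp add: branch_0)
  moreover have "0 \<le> ?g" by (rule gp_nonneg)
  moreover have "dist (branch w k) (branch w (Suc k)) = len (w k)"
    using dist_act_mult[OF G] by (simp add: branch_def)
  ultimately show "dist bp (branch w k) + len (w k) - 2 * (c + 2 * \<delta>) \<le> dist bp (branch w (Suc k))"
    "dist bp (branch w (Suc k)) \<le> dist bp (branch w k) + len (w k)"
    using dist_eq_gp[of bp "branch w (Suc k)" "branch w k"] by (simp_all add: dist_commute)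
qed

text \<open>If the branches stayed together past their first distinct letters, the two vertices
  after these letters would be nearly aligned as seen from \<open>bp\<close>. Their distance would
  then be the difference of the letter lengths up to the constant that \<open>tree\<close>
  excludes.\<close>

lemma branch_separation:
  assumes w: "\<forall>i. w i \<in> S i" "\<forall>i. w' i \<in> S i"
    and k: "\<And>i. i < k \<Longrightarrow> w i = w' i" "w k \<noteq> w' k" and n: "Suc k \<le> n"
  shows "gp bp (branch w n) (branch w' n) < max (dist bp (branch w (Suc k))) (dist bp (branch w' (Suc k)))"
proof (rule ccontr)
  let ?x = "branch w (Suc k)" and ?y = "branch w' (Suc k)"
  let ?m = "min (dist bp ?x) (dist bp ?y)"
  assume no: "\<not> ?thesis"
  have c0: "0 \<le> c" by (rule broken_nonneg[OF branch_broken[OF w(1)]])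
  have "dist bp ?x - (c + 2 * \<delta>) \<le> gp bp ?x (branch w n)" "dist bp ?y - (c + 2 * \<delta>) \<le> gp bp ?y (branch w' n)"
    using broken_gp0[OF branch_broken[OF w(1)] n] broken_gp0[OF branch_broken[OF w(2)] n] by (simp_all add: branch_0)
  then have "?m - (c + 2 * \<delta>) \<le> gp bp ?x (branch w n)" "?m - (c + 2 * \<delta>) \<le> gp bp (branch w' n) ?y"
    by (auto simp: gp_commute)
  moreover have "?m - (c + 2 * \<delta>) \<le> gp bp (branch w n) (branch w' n)"
    using no c0 \<delta>_nonneg by auto
  ultimately have gp: "?m - (c + 2 * \<delta>) - 2 * \<delta> \<le> gp bp ?x ?y" by (intro hyp3)
  have p: "prefix w k = prefix w' k" by (rule prefix_cong) (rule k)
  have G: "prefix w' k \<in> carrier G" "w k \<in> carrier G" "w' k \<in> carrier G"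
    using prefix_carrier[OF w(2)] letter_carrier w by blast+
  have "dist ?x ?y = dist (act (w k) bp) (act (w' k) bp)"
    using G by (simp add: branch_def p act_mult)
  moreover have "\<bar>len (w k) - len (w' k)\<bar> + 4 * c + 12 * \<delta> < dist (act (w k) bp) (act (w' k) bp)"
    using tree w k(2) unfolding tree_def by blast
  moreover have "branch w k = branch w' k" by (simp add: branch_def p)
  moreover have "\<bar>dist bp ?x - dist bp ?y\<bar> \<le> \<bar>len (w k) - len (w' k)\<bar> + 2 * (c + 2 * \<delta>)"
  proof (rule abs_leI)
    have "len (w k) - len (w' k) \<le> \<bar>len (w k) - len (w' k)\<bar>" "len (w' k) - len (w k) \<le> \<bar>len (w k) - len (w' k)\<bar>"
      by auto
    moreover note branch_Suc_dist[OF w(1), of k] branch_Suc_dist[OF w(2), of k, folded \<open>branch w k = branch w' k\<close>]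
    ultimately show "dist bp ?x - dist bp ?y \<le> \<bar>len (w k) - len (w' k)\<bar> + 2 * (c + 2 * \<delta>)"
      and "- (dist bp ?x - dist bp ?y) \<le> \<bar>len (w k) - len (w' k)\<bar> + 2 * (c + 2 * \<delta>)"
      by argo+
  qed
  moreover have "dist ?x ?y = dist bp ?x + dist bp ?y - 2 * gp bp ?x ?y" by (rule dist_eq_gp)
  moreover have "dist bp ?x + dist bp ?y - 2 * ?m = \<bar>dist bp ?x - dist bp ?y\<bar>" by (simp add: min_def abs_if)
  ultimately show False using gp by argo
qed

lemma branch_dist_le:
  assumes w: "\<forall>i. w i \<in> S i" and M: "\<And>i a. a \<in> S i \<Longrightarrow> len a \<le> M i"
  shows "dist bp (branch w n) \<le> (\<Sum>i<n. M i)"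
proof (induction n)
  case (Suc n)
  have "dist bp (branch w (Suc n)) \<le> dist bp (branch w n) + len (w n)"
    using len_mult_le[OF prefix_carrier[OF w] letter_carrier, of "w n" n n] w by (simp add: branch_def len_def)
  also have "\<dots> \<le> (\<Sum>i<n. M i) + M n" using Suc M w by (intro add_mono) auto
  finally show ?case by simp
qed (simp add: branch_0)

text \<open>The product of the two ends is bounded by the length of a prefix including the first
  distinct letter, hence the sum up to \<open>Suc k\<close>.\<close>

lemma branch_end_separation:
  assumes M: "\<And>i a. a \<in> S i \<Longrightarrow> len a \<le> M i"
  shows "\<exists>C>0. \<forall>w w' k. (\<forall>i. w i \<in> S i) \<longrightarrow> (\<forall>i. w' i \<in> S i) \<longrightarrow> (\<forall>i<k. w i = w' i) \<longrightarrow> w k \<noteq> w' k \<longrightarrow>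
    C * exp (- \<epsilon> * (\<Sum>i<Suc k. M i)) \<le> \<rho> (branch_end w) (branch_end w')"
proof -
  from rho_lower obtain C where C: "0 < C \<and> (\<forall>\<xi>\<in>bdry bp. \<forall>\<eta>\<in>bdry bp. \<forall>x\<in>\<xi>. \<forall>y\<in>\<eta>. \<forall>D. \<xi> \<noteq> \<eta> \<longrightarrow>
     (\<forall>N. \<exists>m\<ge>N. \<exists>n\<ge>N. gp bp (x m) (y n) \<le> D) \<longrightarrow> C * exp (- \<epsilon> * D) \<le> \<rho> \<xi> \<eta>)" ..
  have "C * exp (- \<epsilon> * (\<Sum>i<Suc k. M i)) \<le> \<rho> (branch_end w) (branch_end w')"
    if w: "\<forall>i. w i \<in> S i" "\<forall>i. w' i \<in> S i" and k: "\<forall>i<k. w i = w' i" "w k \<noteq> w' k" for w w' k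
  proof -
    let ?D = "\<Sum>i<Suc k. M i"
    have lt: "gp bp (branch w n) (branch w' n) \<le> ?D" if "Suc k \<le> n" for n
      using branch_separation[OF w, of k n] k that branch_dist_le[OF w(1) M, where n="Suc k"]
        branch_dist_le[OF w(2) M, where n="Suc k"] by force
    have "branch_end w \<noteq> branch_end w'"
    proof
      assume eq: "branch_end w = branch_end w'"
      then obtain N where "\<And>m n. m \<ge> N \<Longrightarrow> n \<ge> N \<Longrightarrow> ?D + 1 \<le> gp bp (branch w m) (branch w' n)"
        using seq_equivD[OF bdry_equiv[OF branch_end(1)[OF w(2)] _ branch_end(2)[OF w(2)]], of "branch w" "?D + 1"]
          branch_end(2)[OF w(1)] by auto
      from this[of "max N (Suc k)" "max N (Suc k)"] lt[of "max N (Suc k)"] show False by simp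
    qed
    moreover have "\<forall>N. \<exists>m\<ge>N. \<exists>n\<ge>N. gp bp (branch w m) (branch w' n) \<le> ?D"
    proof
      fix N
      show "\<exists>m\<ge>N. \<exists>n\<ge>N. gp bp (branch w m) (branch w' n) \<le> ?D"
        by (rule exI[of _ "max N (Suc k)"], rule conjI, simp, rule exI[of _ "max N (Suc k)"], rule conjI, simp, rule lt, simp)
    qed
    ultimately show ?thesis
      using C[THEN conjunct2, THEN bspec, OF branch_end(1)[OF w(1)], THEN bspec, OF branch_end(1)[OF w(2)],
          THEN bspec, OF branch_end(2)[OF w(1)], THEN bspec, OF branch_end(2)[OF w(2)]] by blast
  qed
  then show ?thesis using C by blast
qed

text \<open>The mass distribution principle on words: a covering set is replaced by the cylinder of
  the common prefix of its words, whose weight its diameter controls. In \<open>growth\<close> the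
  sum has one term more than the product, because separation is measured after the first distinct
  letter while the cylinder fixes only the letters before it.\<close>

lemma content_branch_ends_pos:
  assumes M: "\<And>i a. a \<in> S i \<Longrightarrow> len a \<le> M i"
    and t: "0 < t" and \<kappa>: "0 < \<kappa>"
    and growth: "\<And>n. \<kappa> \<le> exp (- \<epsilon> * t * (\<Sum>i<Suc n. M i)) * (\<Prod>i<n. real (card (S i)))"
  shows "0 < hausdorff_content \<rho> (bdry bp) t d (branch_end ` {w. \<forall>i. w i \<in> S i})"
proof -
  let ?W = "{w. \<forall>i. w i \<in> S i}"
  let ?\<Pi> = "\<lambda>n. \<Prod>i<n. real (card (S i))"
  have S: "finite (S i)" "S i \<noteq> {}" for i using tree by (auto simp: tree_def)
  have card_pos: "0 < real (card (S i))" for i using S by (simp add: card_gt_0_iff)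
  have \<Pi>_pos: "0 < ?\<Pi> n" for n by (intro prod_pos) (use card_pos in auto)
  have M1: "1 \<le> M i" for i
  proof -
    obtain a where a: "a \<in> S i" using S(2) by blast
    have "\<forall>i. \<exists>a. a \<in> S i" using S(2) by blast
    then obtain w where w: "\<forall>i. w i \<in> S i" by metis
    have "0 \<le> c" by (rule broken_nonneg[OF branch_broken[OF w]])
    moreover have "2 * c + 4 * \<delta> + 1 \<le> len a" by (rule letter_len[OF a])
    ultimately show ?thesis using M[OF a] \<delta>_nonneg by linarith
  qed
  \<comment> \<open>Letters have length at least 1, so by \<open>growth\<close> the weights of long
    cylinders tend to 0.\<close>
  have \<Pi>_large: "\<exists>n. 1 / ?\<Pi> n \<le> e" if e: "e > 0" for e
  proof -
    have "(\<lambda>n. exp (- \<epsilon> * t * real n) / \<kappa>) \<longlonglongrightarrow> 0" using \<epsilon>_pos t \<kappa> by real_asymp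
    then have "eventually (\<lambda>n. exp (- \<epsilon> * t * real n) / \<kappa> < e) sequentially" using e by (rule order_tendstoD)
    then obtain n where n: "exp (- \<epsilon> * t * real n) / \<kappa> < e" by (auto simp: eventually_sequentially)
    have "real n \<le> (\<Sum>i<Suc n. M i)"
      using sum_mono[of "{..<Suc n}" "\<lambda>_. 1" M] M1 by simp
    then have "exp (- \<epsilon> * t * (\<Sum>i<Suc n. M i)) \<le> exp (- \<epsilon> * t * real n)"
      using \<epsilon>_pos t by (simp del: sum.lessThan_Suc)
    then have "\<kappa> \<le> exp (- \<epsilon> * t * real n) * ?\<Pi> n"
      using growth[of n] mult_right_mono[OF _ less_imp_le[OF \<Pi>_pos[of n]]] by (meson order_trans)
    then have "1 / ?\<Pi> n \<le> exp (- \<epsilon> * t * real n) / \<kappa>" using \<Pi>_pos[of n] \<kappa> by (simp add: field_simps)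
    then show ?thesis using n by (intro exI[of _ n]) linarith
  qed
  obtain C where C: "C > 0" "\<And>w w' k. \<forall>i. w i \<in> S i \<Longrightarrow> \<forall>i. w' i \<in> S i \<Longrightarrow> \<forall>i<k. w i = w' i \<Longrightarrow> w k \<noteq> w' k \<Longrightarrow>
    C * exp (- \<epsilon> * (\<Sum>i<Suc k. M i)) \<le> \<rho> (branch_end w) (branch_end w')"
    using branch_end_separation[of M, OF M] by metis
  \<comment> \<open>\<open>K\<close> is the factor that converts the \<open>t\<close>-th power of a
    diameter into the weight of a cylinder.\<close>
  define K where "K = 1 / (C powr t * \<kappa>)"
  have K: "0 < K" using C(1) \<kappa> by (simp add: K_def)
  have "ennreal (1 / (2 * K)) \<le> hausdorff_content \<rho> (bdry bp) t d (branch_end ` ?W)"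
    unfolding hausdorff_content_def
  proof (rule INF_greatest)
    fix U assume "U \<in> {U. branch_end ` ?W \<subseteq> (\<Union>i::nat. U i) \<and> (\<forall>i. U i \<subseteq> bdry bp \<and> rdiam \<rho> (U i) \<le> ennreal d)}"
    then have U: "branch_end ` ?W \<subseteq> (\<Union>i. U i)" "\<And>i. rdiam \<rho> (U i) \<le> ennreal d" by auto
    let ?r = "\<lambda>i. enn2real (rdiam \<rho> (U i)) powr t"
    define V where "V i = {w. (\<forall>j. w j \<in> S j) \<and> branch_end w \<in> U i}" for i
    have r: "\<rho> \<xi> \<eta> \<le> enn2real (rdiam \<rho> (U i))" if "\<xi> \<in> U i" "\<eta> \<in> U i" for \<xi> \<eta> i
    proof -
      have "ennreal (\<rho> \<xi> \<eta>) \<le> rdiam \<rho> (U i)"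
        unfolding rdiam_def by (rule SUP_upper2[of "(\<xi>, \<eta>)"]) (use that in auto)
      moreover have "rdiam \<rho> (U i) < \<infinity>" using U(2)[of i] by (rule order_le_less_trans) simp
      ultimately have "enn2real (ennreal (\<rho> \<xi> \<eta>)) \<le> enn2real (rdiam \<rho> (U i))"
        by (intro enn2real_mono) (simp_all add: infinity_ennreal_def)
      then show ?thesis by (cases "0 \<le> \<rho> \<xi> \<eta>") (auto intro: order_trans[of _ 0])
    qed
    \<comment> \<open>The last summand is slack for covering sets that contain at most one coded end
      and may have diameter 0. Over all \<open>i\<close> it adds up to 1/2, which leaves half of the
      total mass for the diameters.\<close>
    define P where "P i v n \<longleftrightarrow> V i \<subseteq> {w. \<forall>j<n. w j = v j} \<and>
      1 / ?\<Pi> n \<le> K * ?r i + (1/2) * (1/2) ^ Suc i" for i v n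
    have "\<exists>v n. V i \<subseteq> {w. \<forall>j<n. w j = v j} \<and> 1 / ?\<Pi> n \<le> K * ?r i + (1/2) * (1/2) ^ Suc i" for i
    proof (cases "\<exists>k. \<exists>w\<in>V i. \<exists>w'\<in>V i. w k \<noteq> w' k")
      case True
      \<comment> \<open>At the first position where two words of \<open>V i\<close> differ, all
        words of \<open>V i\<close> still share the letters before it, and these two ends bound the
        diameter of \<open>U i\<close> from below.\<close>
      define k where "k = (LEAST k. \<exists>w\<in>V i. \<exists>w'\<in>V i. w k \<noteq> w' k)"
      obtain w w' where w: "w \<in> V i" "w' \<in> V i" "w k \<noteq> w' k" using LeastI_ex[OF True] unfolding k_def[symmetric] by blast
      have below: "u j = u' j" if "u \<in> V i" "u' \<in> V i" "j < k" for u u' j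
        using not_less_Least[of j "\<lambda>k. \<exists>w\<in>V i. \<exists>w'\<in>V i. w k \<noteq> w' k"] that unfolding k_def[symmetric] by blast
      have "C * exp (- \<epsilon> * (\<Sum>i<Suc k. M i)) \<le> \<rho> (branch_end w) (branch_end w')"
        by (rule C(2)) (use w below in \<open>auto simp: V_def\<close>)
      also have "\<dots> \<le> enn2real (rdiam \<rho> (U i))" by (rule r) (use w in \<open>auto simp: V_def\<close>)
      finally have "(C * exp (- \<epsilon> * (\<Sum>i<Suc k. M i))) powr t \<le> ?r i"
        using C(1) t by (intro powr_mono2) auto
      moreover have "(C * exp (- \<epsilon> * (\<Sum>i<Suc k. M i))) powr t = C powr t * exp (- \<epsilon> * t * (\<Sum>i<Suc k. M i))"
        using C(1) by (simp add: powr_mult del: sum.lessThan_Suc) (simp add: powr_def algebra_simps del: sum.lessThan_Suc)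
      moreover have "\<kappa> / ?\<Pi> k \<le> exp (- \<epsilon> * t * (\<Sum>i<Suc k. M i))"
        using growth[of k] \<Pi>_pos[of k] by (simp add: divide_le_eq del: sum.lessThan_Suc)
      then have "C powr t * (\<kappa> / ?\<Pi> k) \<le> C powr t * exp (- \<epsilon> * t * (\<Sum>i<Suc k. M i))"
        by (intro mult_left_mono) auto
      ultimately have "C powr t * (\<kappa> / ?\<Pi> k) \<le> ?r i" by linarith
      then have "K * (C powr t * (\<kappa> / ?\<Pi> k)) \<le> K * ?r i" using K by (intro mult_left_mono) auto
      moreover have "K * (C powr t * (\<kappa> / ?\<Pi> k)) = 1 / ?\<Pi> k" using C(1) \<kappa> by (simp add: K_def)
      moreover have "0 \<le> (1/2::real) * (1/2) ^ Suc i" by simp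
      ultimately have "1 / ?\<Pi> k \<le> K * ?r i + (1/2) * (1/2) ^ Suc i" by linarith
      then show ?thesis using below[OF _ w(1)] by (intro exI[of _ w] exI[of _ k]) auto
    next
      case False
      obtain n where n: "1 / ?\<Pi> n \<le> (1/2) * (1/2) ^ Suc i" using \<Pi>_large[of "(1/2) * (1/2) ^ Suc i"] by auto
      have "0 \<le> K * ?r i" using K by simp
      with n have "1 / ?\<Pi> n \<le> K * ?r i + (1/2) * (1/2) ^ Suc i" by linarith
      moreover have "\<exists>v. V i \<subseteq> {w. \<forall>j<n. w j = v j}"
      proof (cases "V i = {}")
        case False
        then obtain v where "v \<in> V i" by blast
        then show ?thesis using \<open>\<not> (\<exists>k. \<exists>w\<in>V i. \<exists>w'\<in>V i. w k \<noteq> w' k)\<close> by blast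
      qed simp
      ultimately show ?thesis by blast
    qed
    then have "\<exists>v n. P i v n" for i unfolding P_def .
    then obtain v n where "\<And>i. P i (v i) (n i)" by metis
    then have vn: "\<And>i. V i \<subseteq> {w. \<forall>j<n i. w j = v i j}"
      "\<And>i. 1 / ?\<Pi> (n i) \<le> K * ?r i + (1/2) * (1/2) ^ Suc i" unfolding P_def by blast+
    have "?W \<subseteq> (\<Union>i. V i)" using U(1) by (auto simp: V_def)
    also have "\<dots> \<subseteq> (\<Union>i. {w. \<forall>j<n i. w j = v i j})" using vn(1) by blast
    finally have "1 \<le> (\<Sum>i. ennreal (1 / ?\<Pi> (n i)))" by (rule cylinder_cover[OF S])
    also have "\<dots> \<le> (\<Sum>i. ennreal K * ennreal (?r i) + ennreal ((1/2) * (1/2) ^ Suc i))"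
    proof (intro suminf_le allI)
      fix i
      show "ennreal (1 / ?\<Pi> (n i)) \<le> ennreal K * ennreal (?r i) + ennreal ((1/2) * (1/2) ^ Suc i)"
        using ennreal_leI[OF vn(2)[of i]] K by (simp add: ennreal_mult' ennreal_plus)
    qed auto
    also have "\<dots> = ennreal K * (\<Sum>i. ennreal (?r i)) + (\<Sum>i. ennreal ((1/2) * (1/2) ^ Suc i))"
      by (subst suminf_add[symmetric]) auto
    also have "(\<Sum>i. ennreal ((1/2) * (1/2) ^ Suc i)) = ennreal (1/2)"
      using sums_mult[OF power_half_series, of "1/2"] by (intro suminf_ennreal_eq) auto
    finally have le: "1 \<le> ennreal K * (\<Sum>i. ennreal (?r i)) + ennreal (1/2)" .
    show "ennreal (1 / (2 * K)) \<le> (\<Sum>i. ennreal (?r i))"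
    proof (cases "\<Sum>i. ennreal (?r i)")
      case (real x)
      have "ennreal 1 \<le> ennreal (K * x + 1/2)" using le K real by (simp add: ennreal_mult' ennreal_plus)
      then have "1 \<le> K * x + 1/2" using K real by (subst (asm) ennreal_le_iff) auto
      then have "1 / (2 * K) \<le> x" using K by (simp add: field_simps)
      then show ?thesis unfolding real by (rule ennreal_leI)
    qed simp
  qed
  moreover have "0 < ennreal (1 / (2 * K))" using K by simp
  ultimately show ?thesis by (rule order_less_le_trans[rotated])
qed

lemma branch_near_ray:
  assumes w: "\<forall>i. w i \<in> S i" and \<gamma>: "geodesic_ray \<gamma>" "\<gamma> 0 = bp" "(\<lambda>n. \<gamma> (real n)) \<in> branch_end w"
  shows "dist (branch w n) (\<gamma> (dist bp (branch w n))) \<le> 2 * (c + 2 * \<delta>) + 4 * \<delta>"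
proof (rule ray_near[OF branch_end(1,2)[OF w] \<gamma>])
  show "\<exists>m\<ge>N. dist bp (branch w n) - (c + 2 * \<delta>) \<le> gp bp (branch w n) (branch w m)" for N
    using broken_gp0[OF branch_broken[OF w], of n "max N n"] by (intro exI[of _ "max N n"]) (simp add: branch_0)
  show "0 \<le> c + 2 * \<delta>" using broken_nonneg[OF branch_broken[OF w]] \<delta>_nonneg by simp
qed

text \<open>The orbit points of the prefixes follow the ray, and consecutive ones differ by one
  letter, of length at most \<open>B\<close>.\<close>

lemma branch_end_unif_conical:
  assumes w: "\<forall>i. w i \<in> S i" and B: "\<And>i a. a \<in> S i \<Longrightarrow> len a \<le> B"
  shows "branch_end w \<in> unif_conical_limit_set G act bp"
proof -
  note e = branch_end[OF w]
  obtain \<gamma> where \<gamma>: "geodesic_ray \<gamma>" "\<gamma> 0 = bp" "(\<lambda>n. \<gamma> (real n)) \<in> branch_end w" using ray_exists[OF e(1)] by blast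
  have q: "prefix w n \<in> carrier G" for n using prefix_carrier[OF w] .
  have near: "dist (act (prefix w n) bp) (\<gamma> (len (prefix w n))) \<le> 2 * (c + 2 * \<delta>) + 4 * \<delta>" for n
    using branch_near_ray[OF w \<gamma>, of n] by (simp add: branch_def len_def)
  have m: "(\<lambda>n. act (prefix w n) bp) \<in> branch_end w" using e(2) unfolding branch_def[abs_def] .
  have "dist (act (prefix w n) bp) (act (prefix w (Suc n)) bp) \<le> B" for n
    using dist_act_mult[OF q letter_carrier, of "w n" n n] w B[of "w n" n] by simp
  then show ?thesis
    unfolding unif_conical_limit_set_def
    using conicalI[OF e(1) q m \<gamma> near] q m \<gamma> by blast
qed

end

end

section \<open>Lower bounds\<close>

context visual_action
begin

text \<open>Greedy choice by induction on \<open>T\<close>. Every element of \<open>T\<close> lies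
  within \<open>r\<close> of a chosen one, and such a neighbourhood is contained in a translate of
  the ball of radius \<open>r\<close>.\<close>

lemma separated_subset:
  assumes "finite T" "T \<subseteq> carrier G" "0 \<le> r"
  shows "\<exists>S\<subseteq>T. (\<forall>a\<in>S. \<forall>b\<in>S. a \<noteq> b \<longrightarrow> r < dist (act a bp) (act b bp)) \<and>
    card T \<le> card {g \<in> carrier G. len g \<le> r} * card S"
proof -
  let ?N = "\<lambda>a. {b \<in> carrier G. dist (act a bp) (act b bp) \<le> r}"
  have "\<exists>S\<subseteq>T. (\<forall>a\<in>S. \<forall>b\<in>S. a \<noteq> b \<longrightarrow> r < dist (act a bp) (act b bp)) \<and> T \<subseteq> (\<Union>a\<in>S. ?N a)"
    using assms(1,2)
  proof (induction T rule: finite_induct)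
    case (insert x T)
    then obtain S where S: "S \<subseteq> T" "\<forall>a\<in>S. \<forall>b\<in>S. a \<noteq> b \<longrightarrow> r < dist (act a bp) (act b bp)"
      "T \<subseteq> (\<Union>a\<in>S. ?N a)" by auto
    show ?case
    proof (cases "x \<in> (\<Union>a\<in>S. ?N a)")
      case True
      then show ?thesis using S by (intro exI[of _ S]) auto
    next
      case False
      have x: "x \<in> carrier G" using insert by auto
      have far: "r < dist (act a bp) (act x bp)" if "a \<in> S" for a
        using False x that by auto
      have "\<forall>a\<in>insert x S. \<forall>b\<in>insert x S. a \<noteq> b \<longrightarrow> r < dist (act a bp) (act b bp)"
        using S(2) far by (auto simp: dist_commute)
      moreover have "insert x T \<subseteq> (\<Union>a\<in>insert x S. ?N a)"
        using S(3) x assms(3) by auto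
      ultimately show ?thesis using S(1) by (intro exI[of _ "insert x S"]) auto
    qed
  qed simp
  then obtain S where S: "S \<subseteq> T" "\<forall>a\<in>S. \<forall>b\<in>S. a \<noteq> b \<longrightarrow> r < dist (act a bp) (act b bp)"
      "T \<subseteq> (\<Union>a\<in>S. ?N a)" by blast
  have fin: "finite {g \<in> carrier G. len g \<le> r}" by (rule finite_ball)
  have N: "?N a \<subseteq> (\<lambda>h. a \<otimes> h) ` {g \<in> carrier G. len g \<le> r}" if a: "a \<in> carrier G" for a
  proof
    fix b assume b: "b \<in> ?N a"
    then have "inv a \<otimes> b \<in> {g \<in> carrier G. len g \<le> r}" using dist_act_bp[OF a, of b] a by auto
    moreover have "b = a \<otimes> (inv a \<otimes> b)" using a b by (simp add: m_assoc[symmetric])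
    ultimately show "b \<in> (\<lambda>h. a \<otimes> h) ` {g \<in> carrier G. len g \<le> r}" by blast
  qed
  have finS: "finite S" using S(1) assms(1) finite_subset by blast
  have SG: "S \<subseteq> carrier G" using S(1) assms(2) by blast
  have finN: "finite (?N a)" if "a \<in> S" for a
    using finite_subset[OF N finite_imageI[OF fin]] SG that by blast
  have "card T \<le> card (\<Union>a\<in>S. ?N a)"
    by (rule card_mono[OF _ S(3)]) (use finS finN in blast)
  also have "\<dots> \<le> (\<Sum>a\<in>S. card (?N a))" by (rule card_UN_le[OF finS])
  also have "\<dots> \<le> (\<Sum>a\<in>S. card {g \<in> carrier G. len g \<le> r})"
  proof (rule sum_mono)
    fix a assume "a \<in> S"
    then have "card (?N a) \<le> card ((\<lambda>h. a \<otimes> h) ` {g \<in> carrier G. len g \<le> r})"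
      using SG by (intro card_mono finite_imageI fin N) auto
    also have "\<dots> \<le> card {g \<in> carrier G. len g \<le> r}" by (rule card_image_le[OF fin])
    finally show "card (?N a) \<le> card {g \<in> carrier G. len g \<le> r}" .
  qed
  finally have "card T \<le> card {g \<in> carrier G. len g \<le> r} * card S" by (simp add: mult.commute)
  then show ?thesis using S by blast
qed

lemma base_letters:
  assumes s: "0 \<le> s" and A: "big s A" "A \<subseteq> carrier G" and C: "0 \<le> C"
  shows "\<exists>n S. S \<subseteq> A \<inter> annulus n \<and> L \<le> real n \<and>
    (\<forall>a\<in>S. \<forall>b\<in>S. a \<noteq> b \<longrightarrow> \<bar>len a - len b\<bar> + K < dist (act a bp) (act b bp)) \<and>
    C * exp (s * real n) \<le> real (card S)"
proof -
  \<comment> \<open>Lengths in one annulus differ by less than 1, so separation beyond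
    \<open>\<bar>K\<bar> + 1\<close> absorbs the difference of lengths.\<close>
  define r where "r = \<bar>K\<bar> + 1"
  let ?m = "card {g \<in> carrier G. len g \<le> r}" and ?B = "card {g \<in> carrier G. len g \<le> L + 1}"
  \<comment> \<open>The term with \<open>?m\<close> pays for thinning to a separated subset;
    \<open>?B + 1\<close> makes the annulus too populous to lie in the ball of radius
    \<open>L + 1\<close>, which forces \<open>L \<le> real n\<close>.\<close>
  obtain n where n: "(real ?m * C + real ?B + 1) * exp (s * real n) \<le> real (card (annulus n \<inter> A))"
    using A(1) unfolding big_def by blast
  have e1: "1 \<le> exp (s * real n)" using s by simp
  have mC: "0 \<le> real ?m * C" using C by simp
  have nL: "L \<le> real n"
  proof (rule ccontr)
    assume "\<not> L \<le> real n"
    then have "annulus n \<inter> A \<subseteq> {g \<in> carrier G. len g \<le> L + 1}" by (auto simp: annulus_def)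
    then have "card (annulus n \<inter> A) \<le> ?B" by (intro card_mono finite_ball)
    moreover have "real ?B + 1 \<le> (real ?m * C + real ?B + 1) * exp (s * real n)"
      using mult_mono[of "real ?B + 1" "real ?m * C + real ?B + 1" 1 "exp (s * real n)"] e1 mC by simp
    ultimately show False using n by linarith
  qed
  obtain S where S: "S \<subseteq> annulus n \<inter> A" "\<forall>a\<in>S. \<forall>b\<in>S. a \<noteq> b \<longrightarrow> r < dist (act a bp) (act b bp)"
    "card (annulus n \<inter> A) \<le> ?m * card S"
  proof -
    have "finite (annulus n \<inter> A)" "annulus n \<inter> A \<subseteq> carrier G" "0 \<le> r"
      using A(2) finite_annulus by (auto simp: r_def)
    from separated_subset[OF this] show ?thesis using that by blast
  qed
  have "?m \<noteq> 0"
  proof -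
    have "\<one> \<in> {g \<in> carrier G. len g \<le> r}" by (simp add: len_def r_def)
    then show ?thesis using finite_ball[of r] by (metis card_0_eq empty_iff)
  qed
  then have m: "0 < real ?m" by simp
  have "real ?m * (C * exp (s * real n)) \<le> (real ?m * C + real ?B + 1) * exp (s * real n)"
    by (simp add: algebra_simps)
  also have "\<dots> \<le> real ?m * real (card S)"
    using n of_nat_mono[OF S(3), where 'a=real] by simp
  finally have "C * exp (s * real n) \<le> real (card S)" using m by simp
  moreover have "\<bar>len a - len b\<bar> + K < dist (act a bp) (act b bp)" if "a \<in> S" "b \<in> S" "a \<noteq> b" for a b
  proof -
    have "a \<in> annulus n" "b \<in> annulus n" using S(1) that by auto
    then have "\<bar>len a - len b\<bar> < 1" by (simp add: annulus_def abs_less_iff)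
    moreover have "\<bar>K\<bar> + 1 < dist (act a bp) (act b bp)" using S(2) that by (auto simp: r_def)
    ultimately show ?thesis by linarith
  qed
  ultimately show ?thesis using S(1) nL by blast
qed

lemma dim_ge_crit_exp:
  assumes "\<And>t. 0 < t \<Longrightarrow> ereal (\<epsilon> * t) < crit_exp G act bp \<Longrightarrow> 0 < hausdorff_content \<rho> (bdry bp) t 1 X"
  shows "crit_exp G act bp / ereal \<epsilon> \<le> hausdorff_dim \<rho> (bdry bp) X"
proof (rule dense_le)
  fix z assume z: "z < crit_exp G act bp / ereal \<epsilon>"
  show "z \<le> hausdorff_dim \<rho> (bdry bp) X"
  proof (cases z)
    case (real u)
    have u: "ereal (u * \<epsilon>) < crit_exp G act bp"
      using z \<epsilon>_pos ereal_less_divide_iff[of "ereal \<epsilon>" z "crit_exp G act bp"] unfolding real by simp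
    show ?thesis unfolding real
    proof (rule hausdorff_dim_ge)
      fix t assume t: "0 < t" "t < u"
      then have "ereal (\<epsilon> * t) < ereal (u * \<epsilon>)" using \<epsilon>_pos by simp
      then show "0 < hausdorff_content \<rho> (bdry bp) t 1 X" using assms[OF t(1)] u by (meson less_trans)
    qed
  qed (use z in auto)
qed

lemma dim_unif_conical_ge:
  "crit_exp G act bp / ereal \<epsilon> \<le> hausdorff_dim \<rho> (bdry bp) (unif_conical_limit_set G act bp)"
proof (rule dim_ge_crit_exp)
  fix t assume t: "0 < t" "ereal (\<epsilon> * t) < crit_exp G act bp"
  define s where "s = \<epsilon> * t"
  have s: "0 \<le> s" "ereal s < crit_exp G act bp" using t \<epsilon>_pos by (auto simp: s_def)
  obtain A c where A: "A \<subseteq> carrier G" "big s A" "\<And>a b. a \<in> A \<Longrightarrow> b \<in> A \<Longrightarrow> gp bp (act (inv a) bp) (act b bp) \<le> c"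
    using big_transverse[OF s] by blast
  \<comment> \<open>The factor \<open>exp s\<close> raises the count to
    \<open>exp (s * (real n + 1))\<close>, which matches the length bound \<open>real n + 1\<close>
    of the letters.\<close>
  obtain n S where S: "S \<subseteq> A \<inter> annulus n" "2 * c + 4 * \<delta> + 1 \<le> real n"
    "\<And>a b. a \<in> S \<Longrightarrow> b \<in> S \<Longrightarrow> a \<noteq> b \<Longrightarrow> \<bar>len a - len b\<bar> + (4 * c + 12 * \<delta>) < dist (act a bp) (act b bp)"
    "exp s * exp (s * real n) \<le> real (card S)"
    using base_letters[OF s(1) A(2,1), of "exp s" "2 * c + 4 * \<delta> + 1" "4 * c + 12 * \<delta>"] by auto
  have cS: "exp (s * (real n + 1)) \<le> real (card S)"
    using S(4) by (simp add: exp_add[symmetric] algebra_simps)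
  then have "0 < real (card S)" by (rule order_less_le_trans[OF exp_gt_zero])
  then have Sne: "S \<noteq> {}" by auto
  have ann: "real n \<le> len a" "len a \<le> real n + 1" if "a \<in> S" for a
    using S(1) that by (auto simp: annulus_def)
  have tree: "tree c (\<lambda>_. S)"
    unfolding tree_def
  proof (intro conjI allI ballI impI)
    show "finite S" using finite_subset[OF S(1)] finite_annulus by blast
    show "S \<noteq> {}" by (rule Sne)
    show "S \<subseteq> carrier G" using S(1) A(1) by blast
    show "2 * c + 4 * \<delta> + 1 \<le> len a" if "a \<in> S" for a using ann(1)[OF that] S(2) by linarith
    show "gp bp (act (inv a) bp) (act b bp) \<le> c" if "a \<in> S" "b \<in> S" for a b
      using A(3)[of a b] S(1) that by auto
    show "\<bar>len a - len b\<bar> + 4 * c + 12 * \<delta> < dist (act a bp) (act b bp)" if "a \<in> S" "b \<in> S" "a \<noteq> b" for a b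
      using S(3)[OF that] by linarith
  qed
  \<comment> \<open>This \<open>\<kappa>\<close> is the cost of the one letter by which the sum in
    the growth condition exceeds the product.\<close>
  have pos: "0 < hausdorff_content \<rho> (bdry bp) t 1 (branch_end ` {w. \<forall>i::nat. w i \<in> S})"
  proof (rule content_branch_ends_pos[OF tree, where M = "\<lambda>_. real n + 1" and \<kappa> = "exp (- s * (real n + 1))"])
    show "exp (- s * (real n + 1)) \<le> exp (- \<epsilon> * t * (\<Sum>i<Suc m. real n + 1)) * (\<Prod>i<m. real (card S))" for m
    proof -
      have "exp (s * (real n + 1)) ^ m \<le> real (card S) ^ m" by (rule power_mono[OF cS]) simp
      then have "exp (real m * (s * (real n + 1))) \<le> real (card S) ^ m" by (simp only: exp_of_nat_mult)
      then have le: "exp (- \<epsilon> * t * (\<Sum>i<Suc m. real n + 1)) * exp (real m * (s * (real n + 1))) \<le>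
        exp (- \<epsilon> * t * (\<Sum>i<Suc m. real n + 1)) * real (card S) ^ m" by (intro mult_left_mono) auto
      have "exp (- s * (real n + 1)) = exp (- \<epsilon> * t * (\<Sum>i<Suc m. real n + 1)) * exp (real m * (s * (real n + 1)))"
        unfolding exp_add[symmetric] s_def by (simp add: algebra_simps)
      also note le
      finally show ?thesis by (simp only: prod_constant card_lessThan)
    qed
  qed (use t ann in auto)
  have sub: "branch_end ` {w. \<forall>i::nat. w i \<in> S} \<subseteq> unif_conical_limit_set G act bp"
    using branch_end_unif_conical[OF tree] ann(2) by blast
  show "0 < hausdorff_content \<rho> (bdry bp) t 1 (unif_conical_limit_set G act bp)"
    by (rule order_less_le_trans[OF pos hausdorff_content_mono[OF sub]])
qed

text \<open>A point is Myrberg as soon as its coding ray contains a translate of every long segment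
  \<open>[o, k o]\<close>: translating such a segment onto \<open>[\<alpha> n o, \<beta> n o]\<close> pushes the base point to \<open>a\<close> and the end to \<open>b\<close>.\<close>
lemma branch_end_myrberg:
  assumes tree: "tree c S" and w: "\<forall>i. w i \<in> S i"
    and ins: "\<And>k. k \<in> carrier G \<Longrightarrow> L \<le> len k \<Longrightarrow>
      \<exists>i f1 f2. f1 \<in> carrier G \<and> f2 \<in> carrier G \<and> len f1 \<le> F \<and> len f2 \<le> F \<and> w i = f1 \<otimes> k \<otimes> f2"
  shows "branch_end w \<in> myrberg_limit_set G act bp \<rho>"
proof -
  let ?\<xi> = "branch_end w"
  note \<xi> = branch_end[OF tree w]
  have "\<exists>g. (\<forall>n. g n \<in> carrier G) \<and> (\<lambda>n. act (g n) bp) \<in> a \<and> (\<lambda>n. \<rho> (bdry_act act (g n) ?\<xi>) b) \<longlonglongrightarrow> 0"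
    if ab: "a \<in> limit_set G act bp" "b \<in> limit_set G act bp" "a \<noteq> b" for a b
  proof -
    have abb: "a \<in> bdry bp" "b \<in> bdry bp" using ab by (auto simp: limit_set_def)
    obtain \<alpha> where \<alpha>: "\<And>n. \<alpha> n \<in> carrier G" "(\<lambda>n. act (\<alpha> n) bp) \<in> a" using ab(1) unfolding limit_set_def by blast
    obtain \<beta> where \<beta>: "\<And>n. \<beta> n \<in> carrier G" "(\<lambda>n. act (\<beta> n) bp) \<in> b" using ab(2) unfolding limit_set_def by blast
    have c\<alpha>: "conv_inf bp (\<lambda>n. act (\<alpha> n) bp)" using bdry_conv abb(1) \<alpha>(2) by blast
    have c\<beta>: "conv_inf bp (\<lambda>n. act (\<beta> n) bp)" using bdry_conv abb(2) \<beta>(2) by blast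
    obtain D N0 where D: "\<And>m n. m \<ge> N0 \<Longrightarrow> n \<ge> N0 \<Longrightarrow> gp bp (act (\<alpha> m) bp) (act (\<beta> n) bp) \<le> D"
      using not_equiv_bound[OF c\<alpha> c\<beta>] bdry_eqI[OF abb \<alpha>(2) \<beta>(2)] ab(3) by blast
    have D0: "0 \<le> D" using D[of N0 N0] gp_nonneg order_trans by blast
    \<comment> \<open>The ends of the translated segment are within \<open>F\<close> of consecutive
      vertices of the branch, so their turns are bounded by that of the branch plus \<open>F\<close>
      for each of the two vertices.\<close>
    define E where "E = c + 2 * \<delta> + 2 * F"
    \<comment> \<open>Long enough that \<open>inv (\<alpha> n) \<otimes> \<beta> n\<close> has
      length at least \<open>L\<close>, and that from either orbit point \<open>bp\<close> and the
      other one are seen under a product above \<open>E + \<delta>\<close>.\<close>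
    define B where "B = \<bar>L\<bar> + 2 * D + \<bar>E\<bar> + \<delta> + 1"
    obtain N1 where N1: "\<And>n. n \<ge> N1 \<Longrightarrow> B \<le> len (\<alpha> n)" using bdry_dist_tendsto[OF c\<alpha>] unfolding len_def by blast
    obtain N2 where N2: "\<And>n. n \<ge> N2 \<Longrightarrow> B \<le> len (\<beta> n)" using bdry_dist_tendsto[OF c\<beta>] unfolding len_def by blast
    let ?n0 = "max N0 (max N1 N2)"
    have key: "\<exists>g\<in>carrier G. len (\<alpha> n) - (E + \<delta>) \<le> gp bp (act g bp) (act (\<alpha> n) bp) \<and>
        (\<exists>K. \<forall>m\<ge>K. len (\<beta> n) - (E + \<delta>) \<le> gp bp (act g (branch w m)) (act (\<beta> n) bp))" if n: "n \<ge> ?n0" for n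
    proof -
      let ?a = "act (\<alpha> n) bp" and ?b = "act (\<beta> n) bp"
      have Dn: "gp bp ?a ?b \<le> D" and la: "B \<le> len (\<alpha> n)" and lb: "B \<le> len (\<beta> n)" using D N1 N2 n by auto
      define k where "k = inv (\<alpha> n) \<otimes> \<beta> n"
      have k: "k \<in> carrier G" using \<alpha> \<beta> by (simp add: k_def)
      have "len k = dist ?a ?b" using dist_act_bp[OF \<alpha>(1) \<beta>(1)] by (simp add: k_def)
      then have "L \<le> len k" using dist_eq_gp[of ?a ?b bp] Dn la lb D0 \<delta>_nonneg unfolding B_def len_def by linarith
      then obtain i f1 f2 where f: "f1 \<in> carrier G" "f2 \<in> carrier G" "len f1 \<le> F" "len f2 \<le> F" "w i = f1 \<otimes> k \<otimes> f2"
        using ins[OF k] by blast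
      define p where "p = prefix w i"
      have p: "p \<in> carrier G" using prefix_carrier[OF tree w] by (simp add: p_def)
      define u where "u = act (p \<otimes> f1) bp"
      define v where "v = act (p \<otimes> f1 \<otimes> k) bp"
      \<comment> \<open>\<open>g\<close> carries the segment from \<open>u\<close> to
        \<open>v\<close> inside the branch onto the one from \<open>?a\<close> to
        \<open>?b\<close>.\<close>
      define g where "g = \<alpha> n \<otimes> inv (p \<otimes> f1)"
      have g: "g \<in> carrier G" using \<alpha> p f by (simp add: g_def)
      have gu: "act g u = ?a" 
        using act_mult[of "\<alpha> n" "inv (p \<otimes> f1)" "act (p \<otimes> f1) bp"] act_inv(1)[of "p \<otimes> f1" bp] \<alpha>(1)[of n] p f(1)
        by (simp add: g_def u_def)
      have gv: "act g v = ?b"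
      proof -
        have x: "p \<otimes> f1 \<in> carrier G" using p f by simp
        have "inv (p \<otimes> f1) \<otimes> (p \<otimes> f1 \<otimes> k) = k"
          using m_assoc[of "inv (p \<otimes> f1)" "p \<otimes> f1" k] x k by (simp del: inv_mult_group)
        then have "g \<otimes> (p \<otimes> f1 \<otimes> k) = \<alpha> n \<otimes> k"
          unfolding g_def using m_assoc[of "\<alpha> n" "inv (p \<otimes> f1)" "p \<otimes> f1 \<otimes> k"] \<alpha>(1)[of n] x k by simp
        also have "\<dots> = \<beta> n" using \<alpha>(1)[of n] \<beta>(1)[of n] by (simp add: k_def m_assoc[symmetric])
        finally show ?thesis using act_mult[OF g, of "p \<otimes> f1 \<otimes> k" bp] p f k by (simp add: v_def)
      qed
      have du: "dist u (branch w i) \<le> F"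
        using dist_act_mult[OF p f(1)] f(3) by (simp add: u_def branch_def p_def dist_commute)
      have "prefix w (Suc i) = p \<otimes> f1 \<otimes> k \<otimes> f2" using p f k by (simp add: p_def m_assoc)
      then have dv: "dist v (branch w (Suc i)) \<le> F"
        using dist_act_mult[of "p \<otimes> f1 \<otimes> k" f2] p f k by (simp add: v_def branch_def)
      note bw = branch_broken[OF tree w]
      have "gp (branch w i) bp (branch w (Suc i)) \<le> c + 2 * \<delta>"
        using broken_gp[OF bw, of 0 i "Suc i"] by (simp add: branch_0)
      then have "gp u bp v \<le> E"
        using gp_lipschitz_base[of u bp v "branch w i"] gp_lipschitz_right[of "branch w i" bp v "branch w (Suc i)"]
          du dv unfolding E_def by linarith
      then have 1: "gp ?a (act g bp) ?b \<le> E" using gp_act[OF g, of u bp v] gu gv by simp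
      \<comment> \<open>From \<open>?a\<close>, the points \<open>bp\<close> and \<open>?b\<close>
        lie in one direction, whereas \<open>act g bp\<close> does not share that of
        \<open>?b\<close>. So the way from \<open>bp\<close> to \<open>act g bp\<close> passes near
        \<open>?a\<close>; the same argument at \<open>?b\<close> treats the far end.\<close>
      have "gp ?a bp ?b = len (\<alpha> n) - gp bp ?a ?b" using gp_add[of ?a bp ?b] by (simp add: len_def)
      then have "E + \<delta> < gp ?a bp ?b" using la Dn D0 \<delta>_nonneg unfolding B_def by linarith
      then have "gp ?a (act g bp) bp \<le> E + \<delta>" using hyp_or_le[OF 1, of bp] by linarith
      then have A: "len (\<alpha> n) - (E + \<delta>) \<le> gp bp (act g bp) ?a"
        using gp_add[of ?a bp "act g bp"] by (simp add: len_def gp_commute)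
      have "len (\<beta> n) - (E + \<delta>) \<le> gp bp (act g (branch w m)) ?b" if m: "m \<ge> Suc i" for m
      proof -
        have "gp (branch w (Suc i)) (branch w i) (branch w m) \<le> c + 2 * \<delta>"
          using broken_gp[OF bw, of i "Suc i" m] m by simp
        then have "gp v u (branch w m) \<le> E"
          using gp_lipschitz_base[of v u "branch w m" "branch w (Suc i)"]
            gp_lipschitz_left[of "branch w (Suc i)" u "branch w m" "branch w i"] du dv unfolding E_def by linarith
        then have 2: "gp ?b ?a (act g (branch w m)) \<le> E" using gp_act[OF g, of v u "branch w m"] gu gv by simp
        have "gp ?b ?a bp = len (\<beta> n) - gp bp ?a ?b" using gp_add[of ?b bp ?a] by (simp add: len_def gp_commute)
        then have "E + \<delta> < gp ?b ?a bp" using lb Dn D0 \<delta>_nonneg unfolding B_def by linarith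
        then have "gp ?b bp (act g (branch w m)) \<le> E + \<delta>" using hyp_or_le[OF 2, of bp] by linarith
        then show ?thesis using gp_add[of ?b bp "act g (branch w m)"] by (simp add: len_def gp_commute)
      qed
      then show ?thesis using A g by blast
    qed
    \<comment> \<open>The sequence needs group elements also before \<open>?n0\<close>;
      \<open>\<one>\<close> serves as default there.\<close>
    have "\<exists>g. g \<in> carrier G \<and> (n \<ge> ?n0 \<longrightarrow> len (\<alpha> n) - (E + \<delta>) \<le> gp bp (act g bp) (act (\<alpha> n) bp) \<and>
        (\<exists>K. \<forall>m\<ge>K. len (\<beta> n) - (E + \<delta>) \<le> gp bp (act g (branch w m)) (act (\<beta> n) bp)))" for n
      using key[of n] one_closed by (cases "n \<ge> ?n0") auto
    then obtain g where g: "\<And>n. g n \<in> carrier G"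
      and g\<alpha>: "\<And>n. n \<ge> ?n0 \<Longrightarrow> len (\<alpha> n) - (E + \<delta>) \<le> gp bp (act (g n) bp) (act (\<alpha> n) bp)"
      and g\<beta>: "\<And>n. n \<ge> ?n0 \<Longrightarrow> \<exists>K. \<forall>m\<ge>K. len (\<beta> n) - (E + \<delta>) \<le> gp bp (act (g n) (branch w m)) (act (\<beta> n) bp)"
      by metis
    have "(\<lambda>n. act (g n) bp) \<in> a"
    proof (rule bdry_limit_mem[OF abb(1) \<alpha>(2)])
      fix M :: real
      obtain N3 where N3: "\<And>m n. m \<ge> N3 \<Longrightarrow> n \<ge> N3 \<Longrightarrow> M + \<delta> \<le> gp bp (act (\<alpha> m) bp) (act (\<alpha> n) bp)"
        using conv_infD[OF c\<alpha>] by blast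
      obtain N4 where N4: "\<And>n. n \<ge> N4 \<Longrightarrow> M + \<delta> + (E + \<delta>) \<le> len (\<alpha> n)"
        using bdry_dist_tendsto[OF c\<alpha>] unfolding len_def by blast
      have "\<exists>m\<ge>K. M \<le> gp bp (act (g n) bp) (act (\<alpha> m) bp)" if n: "n \<ge> max ?n0 (max N3 N4)" for n K
      proof -
        have "M + \<delta> \<le> gp bp (act (g n) bp) (act (\<alpha> n) bp)" using g\<alpha>[of n] N4[of n] n by simp
        from hyp_le[OF this N3[of n "max K N3"]] show ?thesis using n by (intro exI[of _ "max K N3"]) auto
      qed
      then show "\<exists>N. \<forall>n\<ge>N. \<forall>K. \<exists>m\<ge>K. M \<le> gp bp (act (g n) bp) (act (\<alpha> m) bp)" by blast
    qed
    moreover have "(\<lambda>n. \<rho> (bdry_act act (g n) ?\<xi>) b) \<longlonglongrightarrow> 0"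
    proof (rule LIMSEQ_I)
      fix r :: real assume r: "r > 0"
      from rho_upper obtain C where C: "0 < C \<and> (\<forall>\<xi>\<in>bdry bp. \<forall>\<eta>\<in>bdry bp. \<forall>x\<in>\<xi>. \<forall>y\<in>\<eta>. \<forall>D.
         (\<forall>N. \<exists>m\<ge>N. \<exists>n\<ge>N. D \<le> gp bp (x m) (y n)) \<longrightarrow> \<rho> \<xi> \<eta> \<le> C * exp (- \<epsilon> * D))" ..
      have "(\<lambda>n. C * exp (- \<epsilon> * real n)) \<longlonglongrightarrow> 0" using \<epsilon>_pos by real_asymp
      then have "eventually (\<lambda>n. C * exp (- \<epsilon> * real n) < r) sequentially" using r by (rule order_tendstoD)
      then obtain q where q: "C * exp (- \<epsilon> * real q) < r" by (auto simp: eventually_sequentially)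
      obtain N3 where N3: "\<And>m n. m \<ge> N3 \<Longrightarrow> n \<ge> N3 \<Longrightarrow> real q + \<delta> \<le> gp bp (act (\<beta> m) bp) (act (\<beta> n) bp)"
        using conv_infD[OF c\<beta>] by blast
      obtain N4 where N4: "\<And>n. n \<ge> N4 \<Longrightarrow> real q + \<delta> + (E + \<delta>) \<le> len (\<beta> n)"
        using bdry_dist_tendsto[OF c\<beta>] unfolding len_def by blast
      have "norm (\<rho> (bdry_act act (g n) ?\<xi>) b - 0) < r" if n: "n \<ge> max ?n0 (max N3 N4)" for n
      proof -
        obtain K where K: "\<And>m. m \<ge> K \<Longrightarrow> len (\<beta> n) - (E + \<delta>) \<le> gp bp (act (g n) (branch w m)) (act (\<beta> n) bp)"
          using g\<beta>[of n] n by auto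
        have gx: "(\<lambda>m. act (g n) (branch w m)) \<in> bdry_act act (g n) ?\<xi>" by (rule bdry_act_mem[OF \<xi>(2)])
        have gb: "bdry_act act (g n) ?\<xi> \<in> bdry bp" by (rule bdry_act_in[OF g \<xi>(1)])
        have "\<exists>m\<ge>N. \<exists>j\<ge>N. real q \<le> gp bp (act (g n) (branch w m)) (act (\<beta> j) bp)" for N
        proof -
          have "real q + \<delta> \<le> gp bp (act (g n) (branch w (max K N))) (act (\<beta> n) bp)"
            using K[of "max K N"] N4[of n] n by simp
          from hyp_le[OF this N3[of n "max N N3"]] n
          have "real q \<le> gp bp (act (g n) (branch w (max K N))) (act (\<beta> (max N N3)) bp)" by simp
          then show ?thesis by (intro exI[of _ "max K N"] conjI exI[of _ "max N N3"]) auto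
        qed
        then have "\<rho> (bdry_act act (g n) ?\<xi>) b \<le> C * exp (- \<epsilon> * real q)"
          using C[THEN conjunct2, THEN bspec, OF gb, THEN bspec, OF abb(2), THEN bspec, OF gx, THEN bspec, OF \<beta>(2)] by blast
        moreover have "0 \<le> \<rho> (bdry_act act (g n) ?\<xi>) b"
          using visual gb abb(2) unfolding visual_metric_def by blast
        ultimately show ?thesis using q by simp
      qed
      then show "\<exists>no. \<forall>n\<ge>no. norm (\<rho> (bdry_act act (g n) ?\<xi>) b - 0) < r" by blast
    qed
    ultimately show ?thesis using g by blast
  qed
  then show ?thesis unfolding myrberg_limit_set_def using \<xi>(3) by blast
qed

end

text \<open>Only positions below \<open>n\<close> contribute. If \<open>pos k\<close> is the last of
  them, the contributions add up to at most \<open>pos k\<close>, which is below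
  \<open>n\<close>.\<close>

lemma sparse_sum_le:
  fixes pos :: "nat \<Rightarrow> nat" and f :: "nat \<Rightarrow> real" and r :: "nat \<Rightarrow> real"
  assumes f: "\<And>j. 0 \<le> f j" and pos: "\<And>j. (\<Sum>l\<le>j. f l) \<le> real (pos j)" "strict_mono pos"
    and r: "\<And>j. r (pos j) = f j" "\<And>i. i \<notin> range pos \<Longrightarrow> r i = 0"
  shows "(\<Sum>i<n. r i) \<le> real n"
proof -
  define J where "J = {j. pos j < n}"
  have inj: "inj pos" using pos(2) by (rule strict_mono_imp_inj_on)
  have "J \<subseteq> {..<n}" using strict_mono_imp_increasing[OF pos(2)] unfolding J_def by (auto intro: le_less_trans)
  then have fin: "finite J" using finite_subset by blast
  have "(\<Sum>i<n. r i) = (\<Sum>i\<in>pos ` J. r i)"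
    by (rule sum.mono_neutral_right) (auto simp: J_def intro!: r(2))
  also have "\<dots> = (\<Sum>j\<in>J. f j)" using inj by (subst sum.reindex) (auto simp: r(1) inj_on_def)
  also have "\<dots> \<le> real n"
  proof (cases "J = {}")
    case False
    let ?k = "Max J"
    have k: "?k \<in> J" using fin False by (rule Max_in)
    have "(\<Sum>j\<in>J. f j) \<le> (\<Sum>j\<le>?k. f j)"
      using fin f by (intro sum_mono2) auto
    also have "\<dots> \<le> real (pos ?k)" by (rule pos(1))
    also have "\<dots> \<le> real n" using k by (simp add: J_def)
    finally show ?thesis .
  qed simp
  finally show ?thesis .
qed

section \<open>Myrberg words by sparse insertion\<close>

context visual_action
begin

lemma dim_myrberg_ge:
  "crit_exp G act bp / ereal \<epsilon> \<le> hausdorff_dim \<rho> (bdry bp) (myrberg_limit_set G act bp \<rho>)"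
proof (rule dim_ge_crit_exp)
  fix t assume t: "0 < t" "ereal (\<epsilon> * t) < crit_exp G act bp"
  define s where "s = \<epsilon> * t"
  have s: "0 \<le> s" "ereal s < crit_exp G act bp" using t \<epsilon>_pos by (auto simp: s_def)
  obtain A F c where AF: "A \<subseteq> carrier G" "big s A" "finite F" "F \<subseteq> carrier G"
    "\<forall>a\<in>A. \<forall>b\<in>A. gp bp (act (inv a) bp) (act b bp) \<le> c"
    "\<forall>k\<in>carrier G. \<exists>f1\<in>F. \<exists>f2\<in>F. \<forall>a\<in>A. gp bp (act (inv a) bp) (act (f1 \<otimes> k \<otimes> f2) bp) \<le> c \<and>
        gp bp (act (inv (f1 \<otimes> k \<otimes> f2)) bp) (act a bp) \<le> c"
    using big_transverse[OF s] by blast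
  define Lf where "Lf = (\<Sum>f\<in>F. len f)"
  have Lf: "len f \<le> Lf" if "f \<in> F" for f
    unfolding Lf_def using AF(3) that by (intro member_le_sum) auto
  have Lf0: "0 \<le> Lf" unfolding Lf_def by (intro sum_nonneg) auto
  \<comment> \<open>Beyond the minimal length of a letter, \<open>2 * Lf\<close> makes up for what
    the two surrounding factors from \<open>F\<close> may cancel.\<close>
  define L where "L = 2 * c + 4 * \<delta> + 1 + 2 * Lf"
  \<comment> \<open>Of the factor \<open>exp (s + 1)\<close>, the part \<open>exp s\<close> matches
    the length bound \<open>real n0 + 1\<close>; the remaining factor e is the gain per base
    letter.\<close>
  have "\<exists>n S. S \<subseteq> A \<inter> annulus n \<and> L \<le> real n \<and>
    (\<forall>a\<in>S. \<forall>b\<in>S. a \<noteq> b \<longrightarrow> \<bar>len a - len b\<bar> + (4 * c + 12 * \<delta>) < dist (act a bp) (act b bp)) \<and>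
    exp (s + 1) * exp (s * real n) \<le> real (card S)"
    by (rule base_letters[OF s(1) AF(2,1)]) simp
  then obtain n0 S where S: "S \<subseteq> A \<inter> annulus n0" "L \<le> real n0"
    "\<forall>a\<in>S. \<forall>b\<in>S. a \<noteq> b \<longrightarrow> \<bar>len a - len b\<bar> + (4 * c + 12 * \<delta>) < dist (act a bp) (act b bp)"
    "exp (s + 1) * exp (s * real n0) \<le> real (card S)" by blast
  have cS: "exp (s * (real n0 + 1) + 1) \<le> real (card S)"
    using S(4) by (simp add: exp_add[symmetric] algebra_simps)
  then have cS0: "0 < real (card S)" by (rule order_less_le_trans[OF exp_gt_zero])
  then have Sne: "S \<noteq> {}" by auto
  have ann: "real n0 \<le> len a" "len a \<le> real n0 + 1" "a \<in> A" "a \<in> carrier G" if "a \<in> S" for a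
    using S(1) that by (auto simp: annulus_def)
  define K where "K = {k \<in> carrier G. L \<le> len k}"
  obtain a0 where a0: "a0 \<in> S" using Sne by blast
  have "a0 \<in> K" using ann[OF a0] S(2) by (auto simp: K_def)
  then have Kne: "K \<noteq> {}" by blast
  have Kc: "countable K" by (rule countable_subset[OF _ countable_carrier]) (auto simp: K_def)
  define e where "e = from_nat_into K"
  have e: "e j \<in> carrier G" "L \<le> len (e j)" for j
    using from_nat_into[OF Kne, of j] by (auto simp: e_def K_def)
  have e_surj: "\<exists>j. e j = k" if "k \<in> K" for k
    using from_nat_into_surj[OF Kc that] by (auto simp: e_def)
  have "\<forall>j. \<exists>f1 f2. f1 \<in> F \<and> f2 \<in> F \<and> (\<forall>a\<in>A. gp bp (act (inv a) bp) (act (f1 \<otimes> e j \<otimes> f2) bp) \<le> c \<and>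
        gp bp (act (inv (f1 \<otimes> e j \<otimes> f2)) bp) (act a bp) \<le> c)"
    using AF(6) e(1) by blast
  then obtain f1 f2 where f: "\<And>j. f1 j \<in> F" "\<And>j. f2 j \<in> F"
    "\<And>j a. a \<in> A \<Longrightarrow> gp bp (act (inv a) bp) (act (f1 j \<otimes> e j \<otimes> f2 j) bp) \<le> c"
    "\<And>j a. a \<in> A \<Longrightarrow> gp bp (act (inv (f1 j \<otimes> e j \<otimes> f2 j)) bp) (act a bp) \<le> c"
    by metis
  have fG: "f1 j \<in> carrier G" "f2 j \<in> carrier G" for j using f(1,2) AF(4) by blast+
  define b where "b j = f1 j \<otimes> e j \<otimes> f2 j" for j
  have bG: "b j \<in> carrier G" for j using fG e(1) by (simp add: b_def)
  have b_len: "2 * c + 4 * \<delta> + 1 \<le> len (b j)" for j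
    using len_mult_ge(1)[OF fG(1) e(1), of j j] len_mult_ge(2)[of "f1 j \<otimes> e j" "f2 j"] fG e[of j]
      Lf[OF f(1)[of j]] Lf[OF f(2)[of j]] unfolding b_def L_def by simp
  \<comment> \<open>Each base letter gains a factor \<open>e\<close> in the growth condition; \<open>pos j\<close> is so late that these gains
    pay for the cost \<open>s * len (b l)\<close> of all letters \<open>b l\<close> inserted up to then.\<close>
  define h where "h j = s * len (b j) + 1" for j
  have h: "0 \<le> h j" for j unfolding h_def using s(1) by simp
  define pos where "pos j = (\<Sum>l\<le>j. nat \<lceil>h l\<rceil> + 1)" for j
  \<comment> \<open>Gaps of at least 2 isolate the inserted letters: their neighbours are base
    letters, so no turn between two inserted letters has to be controlled.\<close>
  have pos_Suc: "pos j + 2 \<le> pos (Suc j)" for j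
  proof -
    have "1 \<le> h (Suc j)" using s(1) by (simp add: h_def)
    then have "1 \<le> nat \<lceil>h (Suc j)\<rceil>" by linarith
    then show ?thesis by (simp add: pos_def)
  qed
  have pos_mono: "strict_mono pos"
    using pos_Suc by (intro strict_monoI_Suc) (meson add_lessD1 less_add_same_cancel1 order_less_le_trans zero_less_numeral)
  have pos_gap: "pos j' \<noteq> Suc (pos j)" for j j'
  proof
    assume eq: "pos j' = Suc (pos j)"
    then have "j < j'" using pos_mono by (metis lessI strict_mono_less)
    then have "pos (Suc j) \<le> pos j'" using pos_mono by (simp add: strict_mono_less_eq)
    then show False using eq pos_Suc[of j] by simp
  qed
  have pos_ge: "(\<Sum>l\<le>j. h l) \<le> real (pos j)" for j
  proof -
    have "h l \<le> real (nat \<lceil>h l\<rceil> + 1)" for l by linarith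
    then have "(\<Sum>l\<le>j. h l) \<le> (\<Sum>l\<le>j. real (nat \<lceil>h l\<rceil> + 1))" by (intro sum_mono)
    then show ?thesis by (simp add: pos_def)
  qed
  define T where "T i = (if i \<in> range pos then {b (inv_into UNIV pos i)} else S)" for i
  define M where "M i = (if i \<in> range pos then len (b (inv_into UNIV pos i)) else real n0 + 1)" for i
  define r where "r i = (if i \<in> range pos then h (inv_into UNIV pos i) else 0)" for i
  have inj: "inj pos" using pos_mono by (rule strict_mono_imp_inj_on)
  have T_pos: "T (pos j) = {b j}" "M (pos j) = len (b j)" "r (pos j) = h j" for j
    using inj by (simp_all add: T_def M_def r_def)
  have T_base: "T i = S" "M i = real n0 + 1" "r i = 0" if "i \<notin> range pos" for i
    using that by (simp_all add: T_def M_def r_def)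
  have tree: "tree c T"
    unfolding tree_def
  proof (intro conjI allI ballI impI)
    fix i
    show "finite (T i)" using finite_subset[OF S(1)] finite_annulus by (simp add: T_def)
    show "T i \<noteq> {}" using Sne by (simp add: T_def)
    show "T i \<subseteq> carrier G" using bG ann(4) by (auto simp: T_def)
    show "2 * c + 4 * \<delta> + 1 \<le> len a" if "a \<in> T i" for a
    proof (cases "i \<in> range pos")
      case True
      then show ?thesis using that b_len T_pos by auto
    next
      case False
      then show ?thesis using that ann(1)[of a] S(2) Lf0 T_base by (simp add: L_def)
    qed
    show "gp bp (act (inv a) bp) (act a' bp) \<le> c" if a: "a \<in> T i" "a' \<in> T (Suc i)" for a a'
    proof (cases "i \<in> range pos")
      case True
      then obtain j where j: "i = pos j" by blast
      then have "Suc i \<notin> range pos" using pos_gap by (metis rangeE)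
      then show ?thesis using a j T_pos T_base f(4)[of a' j] ann(3) by (auto simp: b_def)
    next
      case False
      note i = False
      show ?thesis
      proof (cases "Suc i \<in> range pos")
        case True
        then obtain j where j: "Suc i = pos j" by blast
        then show ?thesis using a i T_pos[of j] T_base f(3)[of a j] ann(3) by (auto simp: b_def)
      next
        case False
        then show ?thesis using a i T_base AF(5) ann(3) by auto
      qed
    qed
    show "\<bar>len a - len a'\<bar> + 4 * c + 12 * \<delta> < dist (act a bp) (act a' bp)" if a: "a \<in> T i" "a' \<in> T i" "a \<noteq> a'" for a a'
    proof (cases "i \<in> range pos")
      case True
      then show ?thesis using a T_pos by auto
    next
      case False
      then have "a \<in> S" "a' \<in> S" using a T_base by auto
      then show ?thesis using S(3) a(3) by (force simp: add.assoc)
    qed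
  qed
  have M: "len a \<le> M i" if "a \<in> T i" for i a
    using that ann(2) T_pos T_base by (cases "i \<in> range pos") auto
  \<comment> \<open>A base letter gains 1 from the number of choices. An inserted letter offers no
    choice, and the summand 1 in \<open>h\<close> lets the same inequality hold there.\<close>
  have step: "s * M i - ln (real (card (T i))) \<le> r i - 1" for i
  proof (cases "i \<in> range pos")
    case True
    then show ?thesis using T_pos by (auto simp: h_def)
  next
    case False
    have "s * (real n0 + 1) + 1 \<le> ln (real (card S))" using cS cS0 by (simp add: ln_ge_iff)
    then show ?thesis using T_base[OF False] by simp
  qed
  have budget: "(\<Sum>i<n. r i) \<le> real n" for n
    by (rule sparse_sum_le[of h pos]) (use h pos_ge pos_mono T_pos(3) T_base(3) in auto)
  have growth: "exp (- s * (real n0 + 1)) \<le> exp (- \<epsilon> * t * (\<Sum>i<Suc n. M i)) * (\<Prod>i<n. real (card (T i)))" for n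
  proof -
    have cT: "0 < real (card (T i))" for i using cS0 by (simp add: T_def)
    have 1: "(\<Sum>i<n. s * M i - ln (real (card (T i)))) \<le> (\<Sum>i<n. r i) - real n"
      using sum_mono[of "{..<n}" "\<lambda>i. s * M i - ln (real (card (T i)))" "\<lambda>i. r i - 1"] step
      by (simp add: sum_subtractf)
    \<comment> \<open>The surplus term \<open>s * M n\<close> is covered by the budget up to
      \<open>Suc n\<close> if it belongs to an inserted letter; otherwise it is the fixed cost of
      one base letter, which goes into \<open>\<kappa>\<close>.\<close>
    have 2: "(\<Sum>i<n. r i) - real n + s * M n \<le> s * (real n0 + 1)"
    proof (cases "n \<in> range pos")
      case True
      then have "r n = s * M n + 1" using T_pos by (auto simp: h_def)
      then have "(\<Sum>i<n. r i) - real n + s * M n \<le> 0" using budget[of "Suc n"] by simp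
      also have "\<dots> \<le> s * (real n0 + 1)" using s(1) by simp
      finally show ?thesis .
    next
      case False
      then show ?thesis using budget[of n] T_base[OF False] by simp
    qed
    have 3: "(\<Prod>i<n. real (card (T i))) = exp (\<Sum>i<n. ln (real (card (T i))))"
      using cT by (simp add: exp_sum)
    have "exp (- \<epsilon> * t * (\<Sum>i<Suc n. M i)) * (\<Prod>i<n. real (card (T i))) =
        exp (- ((\<Sum>i<n. s * M i - ln (real (card (T i)))) + s * M n))"
      unfolding 3 exp_add[symmetric] by (simp add: sum_subtractf sum_distrib_left sum_negf s_def algebra_simps)
    moreover have "(\<Sum>i<n. s * M i - ln (real (card (T i)))) + s * M n \<le> s * (real n0 + 1)" using 1 2 by linarith
    ultimately show ?thesis by simp
  qed
  have pos: "0 < hausdorff_content \<rho> (bdry bp) t 1 (branch_end ` {w. \<forall>i. w i \<in> T i})"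
    by (rule content_branch_ends_pos[OF tree M t(1) _ growth]) auto
  have sub: "branch_end ` {w. \<forall>i. w i \<in> T i} \<subseteq> myrberg_limit_set G act bp \<rho>"
  proof safe
    fix w assume w: "\<forall>i. w i \<in> T i"
    show "branch_end w \<in> myrberg_limit_set G act bp \<rho>"
    proof (rule branch_end_myrberg[OF tree w, of L Lf])
      fix k assume "k \<in> carrier G" "L \<le> len k"
      then obtain j where j: "e j = k" using e_surj[of k] by (auto simp: K_def)
      have "w (pos j) = f1 j \<otimes> k \<otimes> f2 j" using w[rule_format, of "pos j"] T_pos(1)[of j] by (simp add: b_def j)
      then show "\<exists>i f1 f2. f1 \<in> carrier G \<and> f2 \<in> carrier G \<and> len f1 \<le> Lf \<and> len f2 \<le> Lf \<and> w i = f1 \<otimes> k \<otimes> f2"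
        using fG Lf[OF f(1)] Lf[OF f(2)] by blast
    qed
  qed
  show "0 < hausdorff_content \<rho> (bdry bp) t 1 (myrberg_limit_set G act bp \<rho>)"
    by (rule order_less_le_trans[OF pos hausdorff_content_mono[OF sub]])
qed

lemma dim_limit_sets:
  "hausdorff_dim \<rho> (bdry bp) (conical_limit_set G act bp) = crit_exp G act bp / ereal \<epsilon>"
  "hausdorff_dim \<rho> (bdry bp) (unif_conical_limit_set G act bp) = crit_exp G act bp / ereal \<epsilon>"
  "hausdorff_dim \<rho> (bdry bp) (myrberg_limit_set G act bp \<rho>) = crit_exp G act bp / ereal \<epsilon>"
  using dim_conical_le dim_unif_conical_ge dim_myrberg_ge
    hausdorff_dim_mono[OF unif_conical_subset_conical, of \<rho> "bdry bp"]
    hausdorff_dim_mono[OF myrberg_subset_conical, of \<rho> "bdry bp"]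
  by (auto intro: antisym order_trans)

end

theorem theorem7p1:
  fixes G :: "('g, 'm) monoid_scheme"
    and act :: "'g \<Rightarrow> 'a::metric_space \<Rightarrow> 'a"
    and bp :: 'a
    and \<epsilon> :: real
    and \<rho> :: "(nat \<Rightarrow> 'a) set \<Rightarrow> (nat \<Rightarrow> 'a) set \<Rightarrow> real"
  assumes "proper_space TYPE('a)"
    and "geodesic_space TYPE('a)"
    and "gromov_hyperbolic TYPE('a)"
    and "group G"
    and "isometric_action G act"
    and "proper_action G act"
    and "non_elementary G act bp"
    and "\<epsilon> > 0"
    and "visual_metric bp \<epsilon> \<rho>"
  shows "hausdorff_dim \<rho> (bdry bp) (conical_limit_set G act bp) = crit_exp G act bp / ereal \<epsilon>
       \<and> hausdorff_dim \<rho> (bdry bp) (unif_conical_limit_set G act bp) = crit_exp G act bp / ereal \<epsilon>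
       \<and> hausdorff_dim \<rho> (bdry bp) (myrberg_limit_set G act bp \<rho>) = crit_exp G act bp / ereal \<epsilon>"
proof -
  obtain \<delta> :: real where \<delta>: "0 \<le> \<delta>"
    "\<And>w x y z :: 'a. min (gromov_prod w x y) (gromov_prod w y z) - \<delta> \<le> gromov_prod w x z"
    using assms(3) unfolding gromov_hyperbolic_def by blast
  interpret gromov_space bp \<delta>
    using assms(1,2) \<delta> by unfold_locales
  interpret visual_space bp \<delta> \<epsilon> \<rho>
    using assms(8,9) by unfold_locales
  interpret group G by (rule assms(4))
  interpret hyperbolic_action bp \<delta> G act
    using assms(5-7) by unfold_locales
  interpret visual_action bp \<delta> \<epsilon> \<rho> G act ..
  show ?thesis using dim_limit_sets by blast
qed

end
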